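(* Let $\mu,\nu\in\mathcal{M}_{\mathbb{C}}(M)$. We have $$\bigl(\boldsymbol{\mathcal{F}}(\mu*_k\nu)\bigr)(k,\lambda)=(\boldsymbol{\mathcal{F}}\mu)(k,\lambda)\cdot(\boldsymbol{\mathcal{F}}\nu)(k,\lambda)\qquad\text{for all }k\in\mathbb{Z}\text{ and }\lambda\ge0.$$ Moreover, for fixed $k\in\mathbb{Z}$ and $\alpha\in\mathcal{M}_{\mathbb{C}}(M)$ we have $$(\boldsymbol{\mathcal{F}}\alpha)(k,\cdot)=(\boldsymbol{\mathcal{F}}\mu)(k,\cdot)\cdot(\boldsymbol{\mathcal{F}}\nu)(k,\cdot)\quad\text{if and only if}\quad\widehat\alpha_k=\widehat\mu_k\diamond_k\widehat\nu_k,$$ where for $\tau\in\{\alpha,\mu,\nu\}$, $\widehat\tau_k$ is the complex measure on $\mathbb{R}_0^+$ defined by $\widehat\tau_k(J)=\int_Me^{-i2k\pi\theta}\,\mathbf{1}_J(x)\,\tau(d\xi)$, and $(\widehat\mu_k\diamond_k\widehat\nu_k)(\cdot):=\int_{\mathbb{R}_0^+}\int_{\mathbb{R}_0^+}\pi^{[k]}_{x_1,x_2}(\cdot)\,\widehat\mu_k(dx_1)\,\widehat\nu_k(dx_2)$.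
   Context: Notation: $\mathbb{R}^+=(0,\infty)$, $\mathbb{R}_0^+=[0,\infty)$, $\mathbb{T}=\mathbb{R}/\mathbb{Z}$, $M=\mathbb{R}_0^+\times\mathbb{T}$, points written $\xi=(x,\theta)$; $\mathcal{M}_{\mathbb{C}}(E)$, $\mathcal{P}(E)$ are the sets of finite complex, respectively probability, Borel measures on $E$. Standing assumption: $A\in \mathrm{C}(\mathbb{R}_0^+)\cap \mathrm{C}^1(\mathbb{R}^+)$, $A(x)>0$ for $x>0$, $\int_0^1\frac{dx}{A(x)}<\infty$, and $A'/A$ is nonnegative and decreasing (not necessarily strictly). For $k\in\mathbb{Z}$, $\lambda\in\mathbb{C}$, $v_{k,\lambda}$ is the unique solution, continuous on $\mathbb{R}_0^+$, of $-v''-\frac{A'}{A}v'+\frac{(2k\pi)^2}{A^2}v=\lambda v$ on $\mathbb{R}^+$ with $v(0)=1$, $\lim_{x\downarrow0}A(x)v'(x)=0$; $w_{k,\lambda}(x,\theta)=e^{i2k\pi\theta}v_{k,\lambda}(x)$; $\zeta_k(x)=\cosh\bigl(2k\pi\int_0^x\frac{dy}{A(y)}\bigr)$; $\widetilde v_{k,\lambda}=v_{k,\lambda}/\zeta_k$ (one has $|\widetilde v_{k,\lambda}|\le1$ for $\lambda\ge0$). It is known that for $x_1,x_2\in\mathbb{R}_0^+$ there is a unique $\pi^{[k]}_{x_1,x_2}\in\mathcal{P}(\mathbb{R}_0^+)$, supported in $[|x_1-x_2|,x_1+x_2]$, such that $\widetilde v_{k,\lambda}(x_1)\widetilde v_{k,\lambda}(x_2)=\int_{\mathbb{R}_0^+}\widetilde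 v_{k,\lambda}\,d\pi^{[k]}_{x_1,x_2}$ for all $\lambda\in\mathbb{C}$. For $\xi_j=(x_j,\theta_j)\in M$ put $\boldsymbol{\nu}_{k,\xi_1,\xi_2}:=\pi^{[k]}_{x_1,x_2}\otimes\delta_{\theta_1+\theta_2}$. The $\Delta_k$-convolution of $\mu,\nu\in\mathcal{M}_{\mathbb{C}}(M)$ is $(\mu*_k\nu)(\cdot)=\int_M\int_M\boldsymbol{\nu}_{k,\xi_1,\xi_2}(\cdot)\,\mu(d\xi_1)\,\nu(d\xi_2)$. The $\Delta$-Fourier transform of $\mu\in\mathcal{M}_{\mathbb{C}}(M)$ is $(\boldsymbol{\mathcal{F}}\mu)(k,\lambda)=\int_M\frac{w_{-k,\lambda}(\xi)}{\zeta_k(x)}\,\mu(d\xi)$, $k\in\mathbb{Z}$, $\lambda\ge0$. *)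

theory Defs
  imports "HOL-Probability.Probability"
begin

subsection \<open>The torus \<open>\<real>/\<int>\<close> with its group structure and quotient topology\<close>

quotient_type torus = real / "\<lambda>s t :: real. s - t \<in> \<int>"
proof (rule equivpI)
  show "reflp (\<lambda>s t :: real. s - t \<in> \<int>)"
    by (simp add: reflp_def)
  show "symp (\<lambda>s t :: real. s - t \<in> \<int>)"
  proof (rule sympI)
    fix x y :: real
    assume "x - y \<in> \<int>"
    then have "- (x - y) \<in> \<int>" by (rule Ints_minus)
    then show "y - x \<in> \<int>" by simp
  qed
  show "transp (\<lambda>s t :: real. s - t \<in> \<int>)"
  proof (rule transpI)
    fix x y z :: real
    assume "x - y \<in> \<int>" "y - z \<in> \<int>"
    then have "(x - y) + (y - z) \<in> \<int>" by (rule Ints_add)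
    then show "x - z \<in> \<int>" by simp
  qed
qed

instantiation torus :: ab_group_add
begin

lift_definition zero_torus :: torus is "0 :: real" .

lift_definition plus_torus :: "torus \<Rightarrow> torus \<Rightarrow> torus" is "(+)"
proof -
  fix s s' t t' :: real
  assume "s - s' \<in> \<int>" "t - t' \<in> \<int>"
  then have "(s - s') + (t - t') \<in> \<int>" by (rule Ints_add)
  then show "(s + t) - (s' + t') \<in> \<int>" by (simp add: algebra_simps)
qed

lift_definition uminus_torus :: "torus \<Rightarrow> torus" is "uminus"
proof -
  fix s s' :: real
  assume "s - s' \<in> \<int>"
  then have "- (s - s') \<in> \<int>" by (rule Ints_minus)
  then show "(- s) - (- s') \<in> \<int>" by simp
qed

lift_definition minus_torus :: "torus \<Rightarrow> torus \<Rightarrow> torus" is "(-)"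
proof -
  fix s s' t t' :: real
  assume "s - s' \<in> \<int>" "t - t' \<in> \<int>"
  then have "(s - s') - (t - t') \<in> \<int>" by (rule Ints_diff)
  then show "(s - t) - (s' - t') \<in> \<int>" by (simp add: algebra_simps)
qed

instance
proof
  fix a b c :: torus
  show "a + b + c = a + (b + c)" by transfer (simp add: add.assoc)
  show "a + b = b + a" by transfer (simp add: add.commute)
  show "0 + a = a" by transfer simp
  show "- a + a = 0" by transfer simp
  show "a - b = a + - b" by transfer simp
qed

end

instantiation torus :: topological_space
begin

definition open_torus :: "torus set \<Rightarrow> bool"
  where "open_torus U \<longleftrightarrow> open (abs_torus -` U)"

instance
proof
  show "open (UNIV :: torus set)" by (simp add: open_torus_def)
next
  fix S T :: "torus set"
  assume "open S" "open T"
  then show "open (S \<inter> T)" by (simp add: open_torus_def vimage_Int open_Int)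
next
  fix K :: "torus set set"
  assume "\<forall>S\<in>K. open S"
  then show "open (\<Union>K)" unfolding open_torus_def vimage_Union by (intro open_UN)
qed

end

lift_definition torus_char :: "int \<Rightarrow> torus \<Rightarrow> complex"
  is "\<lambda>k t. exp (\<i> * of_real (2 * of_int k * pi * t))"
proof -
  fix k :: int and s t :: real
  assume "s - t \<in> \<int>"
  then obtain n where "s - t = of_int n" by (elim Ints_cases)
  then have s: "s = t + of_int n" by simp
  have "\<i> * of_real (2 * of_int k * pi * s)
      = \<i> * of_real (2 * of_int k * pi * t) + of_int (2 * (k * n)) * of_real pi * \<i>"
    unfolding s by (simp add: algebra_simps)
  then show "exp (\<i> * of_real (2 * of_int k * pi * s)) = exp (\<i> * of_real (2 * of_int k * pi * t))"
    unfolding exp_eq by (intro exI[of _ "k * n"]) simp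
qed


subsection \<open>Complex measures\<close>

text \<open>A complex measure is a countably additive complex-valued set function; finiteness is
  automatic. Its values off \<open>sets N\<close> carry no meaning, so two complex measures are compared
  on \<open>sets N\<close> only.\<close>

definition complex_measures :: "'a measure \<Rightarrow> ('a set \<Rightarrow> complex) set"
  where "complex_measures N = {\<mu>. \<forall>E :: nat \<Rightarrow> 'a set. range E \<subseteq> sets N \<longrightarrow> disjoint_family E
           \<longrightarrow> (\<lambda>n. \<mu> (E n)) sums \<mu> (\<Union>n. E n)}"

text \<open>The positive variation \<open>E \<mapsto> sup {s F | F \<subseteq> E measurable}\<close> of a signed measure. Negative
  values are truncated to 0 by \<open>ennreal\<close>, which is harmless as \<open>F = {}\<close> is admitted.\<close>

definition positive_variation :: "'a measure \<Rightarrow> ('a set \<Rightarrow> real) \<Rightarrow> 'a measure"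
  where "positive_variation N s =
    measure_of (space N) (sets N) (\<lambda>E. SUP F\<in>{F \<in> sets N. F \<subseteq> E}. ennreal (s F))"

definition signed_integral :: "'a measure \<Rightarrow> ('a set \<Rightarrow> real) \<Rightarrow> ('a \<Rightarrow> complex) \<Rightarrow> complex"
  where "signed_integral N s f =
    (\<integral>x. f x \<partial>positive_variation N s) - (\<integral>x. f x \<partial>positive_variation N (\<lambda>E. - s E))"

text \<open>Integration against a complex measure through the Jordan decompositions of its real and
  imaginary parts.\<close>

definition complex_integral :: "'a measure \<Rightarrow> ('a set \<Rightarrow> complex) \<Rightarrow> ('a \<Rightarrow> complex) \<Rightarrow> complex"
  where "complex_integral N \<mu> f =
    signed_integral N (\<lambda>E. Re (\<mu> E)) f + \<i> * signed_integral N (\<lambda>E. Im (\<mu> E)) f"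


subsection \<open>The Sturm--Liouville data\<close>

definition half_line :: "real measure"
  where "half_line = restrict_space borel {0..}"

definition cylinder :: "(real \<times> torus) measure"
  where "cylinder = restrict_space borel ({0..} \<times> UNIV)"

definition admissible :: "(real \<Rightarrow> real) \<Rightarrow> bool"
  where "admissible A \<longleftrightarrow>
    continuous_on {0..} A \<and>
    (\<forall>x>0. A differentiable at x) \<and> continuous_on {0<..} (deriv A) \<and>
    (\<forall>x>0. A x > 0) \<and>
    set_integrable lborel {0<..1} (\<lambda>x. 1 / A x) \<and>
    (\<forall>x>0. deriv A x / A x \<ge> 0) \<and>
    antimono_on {0<..} (\<lambda>x. deriv A x / A x)"

text \<open>The functions \<open>v'\<close>, \<open>v''\<close> are the first two derivatives on \<open>(0, \<infinity>)\<close>. The values of \<open>v\<close>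
  on the negative half-line are irrelevant and left unconstrained.\<close>

definition sl_solution :: "(real \<Rightarrow> real) \<Rightarrow> int \<Rightarrow> complex \<Rightarrow> (real \<Rightarrow> complex) \<Rightarrow> bool"
  where "sl_solution A k lam v \<longleftrightarrow>
    continuous_on {0..} v \<and> v 0 = 1 \<and>
    (\<exists>v' v''.
      (\<forall>x>0. (v has_vector_derivative v' x) (at x) \<and>
             (v' has_vector_derivative v'' x) (at x) \<and>
             - v'' x - of_real (deriv A x / A x) * v' x
               + of_real ((2 * of_int k * pi)\<^sup>2 / (A x)\<^sup>2) * v x = lam * v x) \<and>
      ((\<lambda>x. of_real (A x) * v' x) \<longlongrightarrow> 0) (at_right 0))"

definition zeta :: "(real \<Rightarrow> real) \<Rightarrow> int \<Rightarrow> real \<Rightarrow> real"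
  where "zeta A k x = cosh (2 * of_int k * pi * (LBINT y:{0..x}. 1 / A y))"

text \<open>Below, \<open>v k lam\<close> is the solution with parameters \<open>k\<close>, \<open>lam\<close>, and \<open>\<pi> k x1 x2\<close> is the
  measure representing the product of its normalizations at \<open>x1\<close> and \<open>x2\<close>.\<close>

definition v_tilde ::
    "(real \<Rightarrow> real) \<Rightarrow> (int \<Rightarrow> complex \<Rightarrow> real \<Rightarrow> complex) \<Rightarrow> int \<Rightarrow> complex \<Rightarrow> real \<Rightarrow> complex"
  where "v_tilde A v k lam x = v k lam x / of_real (zeta A k x)"

definition w :: "(int \<Rightarrow> complex \<Rightarrow> real \<Rightarrow> complex) \<Rightarrow> int \<Rightarrow> complex \<Rightarrow> real \<times> torus \<Rightarrow> complex"
  where "w v k lam = (\<lambda>(x, \<theta>). torus_char k \<theta> * v k lam x)"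

definition product_formula_measure ::
    "(real \<Rightarrow> real) \<Rightarrow> (int \<Rightarrow> complex \<Rightarrow> real \<Rightarrow> complex) \<Rightarrow> int \<Rightarrow> real \<Rightarrow> real \<Rightarrow> real measure \<Rightarrow> bool"
  where "product_formula_measure A v k x1 x2 p \<longleftrightarrow>
    prob_space p \<and> sets p = sets half_line \<and>
    (AE y in p. y \<in> {\<bar>x1 - x2\<bar>..x1 + x2}) \<and>
    (\<forall>lam. v_tilde A v k lam x1 * v_tilde A v k lam x2 = (\<integral>y. v_tilde A v k lam y \<partial>p))"


subsection \<open>Convolution and Fourier transform\<close>

definition product_kernel ::
    "(int \<Rightarrow> real \<Rightarrow> real \<Rightarrow> real measure) \<Rightarrow> int \<Rightarrow> real \<times> torus \<Rightarrow> real \<times> torus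
      \<Rightarrow> (real \<times> torus) measure"
  where "product_kernel \<pi> k = (\<lambda>(x1, \<theta>1) (x2, \<theta>2). \<pi> k x1 x2 \<Otimes>\<^sub>M return borel (\<theta>1 + \<theta>2))"

definition delta_convolution ::
    "(int \<Rightarrow> real \<Rightarrow> real \<Rightarrow> real measure) \<Rightarrow> int \<Rightarrow> ((real \<times> torus) set \<Rightarrow> complex)
      \<Rightarrow> ((real \<times> torus) set \<Rightarrow> complex) \<Rightarrow> (real \<times> torus) set \<Rightarrow> complex"
  where "delta_convolution \<pi> k \<mu> \<nu> E =
    complex_integral cylinder \<nu> (\<lambda>\<xi>2.
      complex_integral cylinder \<mu> (\<lambda>\<xi>1. of_real (measure (product_kernel \<pi> k \<xi>1 \<xi>2) E)))"

definition fourier ::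
    "(real \<Rightarrow> real) \<Rightarrow> (int \<Rightarrow> complex \<Rightarrow> real \<Rightarrow> complex) \<Rightarrow> ((real \<times> torus) set \<Rightarrow> complex)
      \<Rightarrow> int \<Rightarrow> real \<Rightarrow> complex"
  where "fourier A v \<mu> k lam =
    complex_integral cylinder \<mu> (\<lambda>\<xi>. w v (- k) (of_real lam) \<xi> / of_real (zeta A k (fst \<xi>)))"

definition hat :: "int \<Rightarrow> ((real \<times> torus) set \<Rightarrow> complex) \<Rightarrow> real set \<Rightarrow> complex"
  where "hat k \<tau> J = complex_integral cylinder \<tau> (\<lambda>(x, \<theta>). torus_char (- k) \<theta> * indicator J x)"

definition diamond ::
    "(int \<Rightarrow> real \<Rightarrow> real \<Rightarrow> real measure) \<Rightarrow> int \<Rightarrow> (real set \<Rightarrow> complex) \<Rightarrow> (real set \<Rightarrow> complex)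
      \<Rightarrow> real set \<Rightarrow> complex"
  where "diamond \<pi> k m n J =
    complex_integral half_line n (\<lambda>x2.
      complex_integral half_line m (\<lambda>x1. of_real (measure (\<pi> k x1 x2) J)))"

end

(* Put B = A zeta_k^2. The normalized solutions v~_lam solve L u = - lam u, where L u = (B u')' / B
   with a Neumann condition at 0, and B is nondecreasing. Everything rests on one fact: the v~_lam
   with lam >= 0 generate all bounded Borel functions on the half-line under linear combinations and
   bounded pointwise limits. By the product formula this makes the kernel pi_{x1,x2} measurable in
   (x1, x2), and it makes the transform injective; the two claims are then Fubini's theorem for
   complex measures.

   To prove that fact, let T = (1 - L)^{-1}. Its Green function is explicit in terms of
   phi = v~_{-1}, and 0 <= T <= 1 on L^2(B dx). For a function h, Bernstein polynomials give signed
   quadratures with nodes t = j/n and uniformly bounded total weight which converge to the functional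
   p |-> (T p(T) h)(0) on polynomials p. Let D_n(p)(x) be the difference between (T p(T) h)(x) and
   the n-th quadrature of p(t) v~_lam(x), where t = 1/(1 + lam). Then L D_n(t p) = - D_n((1 - t) p),
   and D_n(t p)(0) tends to 0 as n grows, so up to o(1) the size of D_n(t^m q)(x) is at most
   const * sup |q| * x^(2m) / (2m)!. Now t is the uniform limit on [0,1] of the polynomials
   t (1 - (1 - t)^m)^m = t^m q with |q| <= m^m, whence D_n(t) -> 0: every T^2 h is a bounded
   pointwise limit of linear combinations of the v~_lam. Smooth cutoff functions have the form T^2 h. *)

theory Submission
  imports Defs
begin

text \<open>Nothing is assumed on how \<open>\<pi> k x1 x2\<close> depends on the points, so its
  measurability has to be proved before iterated integrals can be handled. The difficulty of the
  approximation is t = 0: v~_lam(x) need not converge as lam grows (it is cos(sqrt(lam) x) for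
  constant A and k = 0), so convergence of the quadratures on polynomials does not reach t |->
  v~_lam(x). The factor t^m suppresses that end, and its price m^m is beaten by (2m)!. The two
  powers of T have different tasks: one is the factor t, the other turns L^2 bounds on p(T) h into
  pointwise bounds, by Cauchy-Schwarz against Green's function. Monotonicity of B gives the energy
  bound |v~_lam| <= 1, the comparison with constant weight that produces x^(2m) / (2m)!, and the
  infinite mass of B dx, which makes T h the only solution of u - L u = h in \<open>E\<close>. The
  potential (2 k pi)^2 / A^2 disappears because zeta_k solves the equation with lam = 0, and
  division by a positive solution removes the zero-order term.\<close>

section \<open>The Sturm--Liouville operator with Neumann condition\<close>

text \<open>Here \<open>r\<close> is the quasi-derivative \<open>B u'\<close>, so that the equation reads \<open>L u = f\<close>.\<close>

definition neumann :: "(real \<Rightarrow> real) \<Rightarrow> (real \<Rightarrow> real) \<Rightarrow> (real \<Rightarrow> real) \<Rightarrow> bool"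
  where "neumann B u f \<longleftrightarrow> continuous_on {0..} u \<and>
    (\<exists>r. (\<forall>x>0. (u has_real_derivative r x / B x) (at x) \<and>
                (r has_real_derivative B x * f x) (at x)) \<and> (r \<longlongrightarrow> 0) (at_right 0))"

lemma neumannI:
  assumes "continuous_on {0..} u"
    and "\<And>x. x > 0 \<Longrightarrow> (u has_real_derivative r x / B x) (at x)"
    and "\<And>x. x > 0 \<Longrightarrow> (r has_real_derivative B x * f x) (at x)"
    and "(r \<longlongrightarrow> 0) (at_right 0)"
  shows "neumann B u f"
  using assms unfolding neumann_def by blast

lemma neumann_zero: "neumann B (\<lambda>_. 0) (\<lambda>_. 0)"
  by (rule neumannI[where r="\<lambda>_. 0"]) auto

lemma neumann_add:
  assumes "neumann B u f" "neumann B v g"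
  shows "neumann B (\<lambda>x. u x + v x) (\<lambda>x. f x + g x)"
proof -
  from assms(1) obtain r where r: "continuous_on {0..} u"
    "\<And>x. x > 0 \<Longrightarrow> (u has_real_derivative r x / B x) (at x)"
    "\<And>x. x > 0 \<Longrightarrow> (r has_real_derivative B x * f x) (at x)"
    "(r \<longlongrightarrow> 0) (at_right 0)" unfolding neumann_def by blast
  from assms(2) obtain s where s: "continuous_on {0..} v"
    "\<And>x. x > 0 \<Longrightarrow> (v has_real_derivative s x / B x) (at x)"
    "\<And>x. x > 0 \<Longrightarrow> (s has_real_derivative B x * g x) (at x)"
    "(s \<longlongrightarrow> 0) (at_right 0)" unfolding neumann_def by blast
  show ?thesis
  proof (rule neumannI[where r="\<lambda>x. r x + s x"])
    show "((\<lambda>x. r x + s x) \<longlongrightarrow> 0) (at_right 0)"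
      using tendsto_add[OF r(4) s(4)] by simp
    show "((\<lambda>x. u x + v x) has_real_derivative (r x + s x) / B x) (at x)" if "x > 0" for x
      using DERIV_add[OF r(2)[OF that] s(2)[OF that]] by (simp add: add_divide_distrib)
    show "((\<lambda>x. r x + s x) has_real_derivative B x * (f x + g x)) (at x)" if "x > 0" for x
      using DERIV_add[OF r(3)[OF that] s(3)[OF that]] by (simp add: distrib_left)
  qed (use r(1) s(1) in \<open>intro continuous_intros\<close>)
qed

lemma neumann_scale:
  assumes "neumann B u f"
  shows "neumann B (\<lambda>x. c * u x) (\<lambda>x. c * f x)"
proof -
  from assms(1) obtain r where r: "continuous_on {0..} u"
    "\<And>x. x > 0 \<Longrightarrow> (u has_real_derivative r x / B x) (at x)"
    "\<And>x. x > 0 \<Longrightarrow> (r has_real_derivative B x * f x) (at x)"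
    "(r \<longlongrightarrow> 0) (at_right 0)" unfolding neumann_def by blast
  show ?thesis
  proof (rule neumannI[where r="\<lambda>x. c * r x"])
    show "((\<lambda>x. c * r x) \<longlongrightarrow> 0) (at_right 0)"
      using tendsto_mult_left[OF r(4), of c] by simp
    show "((\<lambda>x. c * u x) has_real_derivative (c * r x) / B x) (at x)" if "x > 0" for x
      using DERIV_cmult[OF r(2)[OF that], of c] by simp
    show "((\<lambda>x. c * r x) has_real_derivative B x * (c * f x)) (at x)" if "x > 0" for x
      using DERIV_cmult[OF r(3)[OF that], of c] by (simp add: mult_ac)
  qed (use r(1) in \<open>intro continuous_intros\<close>)
qed

lemma neumann_diff:
  assumes "neumann B u f" "neumann B v g"
  shows "neumann B (\<lambda>x. u x - v x) (\<lambda>x. f x - g x)"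
  using neumann_add[OF assms(1) neumann_scale[OF assms(2), of "-1"]] by simp

lemma neumann_sum:
  assumes "finite I" "\<And>i. i \<in> I \<Longrightarrow> neumann B (u i) (f i)"
  shows "neumann B (\<lambda>x. \<Sum>i\<in>I. u i x) (\<lambda>x. \<Sum>i\<in>I. f i x)"
  using assms by (induction rule: finite_induct) (auto simp: neumann_zero neumann_add)

lemma neumann_cong:
  assumes "neumann B u f" "\<And>x. x \<ge> 0 \<Longrightarrow> u x = u' x" "\<And>x. x > 0 \<Longrightarrow> f x = f' x"
  shows "neumann B u' f'"
proof -
  from assms(1) obtain r where r: "continuous_on {0..} u"
    "\<And>x. x > 0 \<Longrightarrow> (u has_real_derivative r x / B x) (at x)"
    "\<And>x. x > 0 \<Longrightarrow> (r has_real_derivative B x * f x) (at x)"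
    "(r \<longlongrightarrow> 0) (at_right 0)" unfolding neumann_def by blast
  show ?thesis
  proof (rule neumannI[where r=r])
    show "continuous_on {0..} u'" using r(1) assms(2) by (metis atLeast_iff continuous_on_cong)
    show "(u' has_real_derivative r x / B x) (at x)" if "x > 0" for x
      by (rule has_field_derivative_transform_within_open[OF r(2)[OF that], of "{0<..}"])
         (use that assms(2) in auto)
    show "(r has_real_derivative B x * f' x) (at x)" if "x > 0" for x
      using r(3)[OF that] assms(3)[OF that] by simp
  qed (rule r(4))
qed

lemma DERIV_nonneg_imp_le_open:
  fixes f :: "real \<Rightarrow> real"
  assumes "\<And>y. a < y \<Longrightarrow> y \<le> b \<Longrightarrow> \<exists>d. (f has_real_derivative d) (at y) \<and> d \<ge> 0"
    and "a < x" "x \<le> b"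
  shows "f x \<le> f b"
proof (rule DERIV_nonneg_imp_nondecreasing[OF assms(3)])
  fix y assume "x \<le> y" "y \<le> b"
  with assms(2) show "\<exists>d. (f has_real_derivative d) (at y) \<and> 0 \<le> d" by (intro assms(1)) auto
qed

text \<open>Derivatives exist on (0, infinity) only, and B may vanish at 0, so initial conditions
  enter as one-sided limits. This replaces the mean value theorem on [0, x] throughout.\<close>

lemma limit_at_0_le:
  fixes f :: "real \<Rightarrow> real"
  assumes "\<And>y. 0 < y \<Longrightarrow> y \<le> x \<Longrightarrow> \<exists>d. (f has_real_derivative d) (at y) \<and> d \<ge> 0"
    and "x > 0" "(f \<longlongrightarrow> l) (at_right 0)"
  shows "l \<le> f x"
proof (rule tendsto_le[OF _ tendsto_const assms(3)])
  have "\<forall>\<^sub>F y in at_right 0. y \<in> {0<..<x}"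
    using assms(2) by (rule eventually_at_right_real)
  then show "\<forall>\<^sub>F y in at_right 0. f y \<le> f x"
  proof eventually_elim
    case (elim y)
    then show ?case by (intro DERIV_nonneg_imp_le_open[of 0 x f y] assms(1)) auto
  qed
qed simp

lemma continuous_on_at_right_0:
  assumes "continuous_on {0..} (f :: real \<Rightarrow> real)"
  shows "(f \<longlongrightarrow> f 0) (at_right 0)"
proof -
  have "(f \<longlongrightarrow> f 0) (at 0 within {0..})"
    using assms by (auto simp: continuous_on_def)
  then show ?thesis by (rule tendsto_within_subset) auto
qed

text \<open>Integrability of 1 / B near 0 allows B to vanish at 0 and still makes \<open>Q\<close>,
  and with it the second solution \<open>psi\<close>, finite there.\<close>

locale sl_weight =
  fixes B B' :: "real \<Rightarrow> real"
  assumes B_pos: "x > 0 \<Longrightarrow> B x > 0"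
    and B_deriv: "x > 0 \<Longrightarrow> (B has_real_derivative B' x) (at x)"
    and B'_nonneg: "x > 0 \<Longrightarrow> B' x \<ge> 0"
    and B_inv_integrable: "set_integrable lborel {0<..1} (\<lambda>x. 1 / B x)"
begin

lemma B_mono: "0 < x \<Longrightarrow> x \<le> y \<Longrightarrow> B x \<le> B y"
  by (rule DERIV_nonneg_imp_le_open[of 0 y B]) (use B_deriv B'_nonneg in auto)

lemma continuous_B: "continuous_on {0<..} B"
  by (intro DERIV_continuous_on) (use B_deriv in \<open>auto intro: has_field_derivative_at_within\<close>)

text \<open>Formally r(x) is the integral of B f over (0, x), and \<open>B_mono\<close> pulls the
  weight out as the constant \<open>B x\<close>. Accordingly \<open>x\<close> is frozen in
  \<open>B x * G1 y + c * r y\<close>, which has a nonnegative derivative in y for c = 1 and c =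
  -1.\<close>

lemma quasi_derivative_bound:
  assumes r: "\<And>x. x > 0 \<Longrightarrow> (r has_real_derivative B x * f x) (at x)" "(r \<longlongrightarrow> 0) (at_right 0)"
    and f: "\<And>y. 0 < y \<Longrightarrow> y \<le> x \<Longrightarrow> \<bar>f y\<bar> \<le> g y"
    and G1: "\<And>y. 0 \<le> y \<Longrightarrow> y \<le> x \<Longrightarrow> (G1 has_real_derivative g y) (at y)" "G1 0 = 0"
    and "x > 0"
  shows "\<bar>r x\<bar> \<le> B x * G1 x"
proof -
  have lim: "(G1 \<longlongrightarrow> 0) (at_right 0)"
  proof -
    have "isCont G1 0" using G1(1)[of 0] \<open>x > 0\<close> by (auto intro: DERIV_isCont)
    then show ?thesis using G1(2) by (auto simp: isCont_def intro: tendsto_within_subset)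
  qed
  have "0 \<le> B x * G1 x + c * r x" if "c = 1 \<or> c = -1" for c
  proof (rule limit_at_0_le[where f="\<lambda>y. B x * G1 y + c * r y", OF _ \<open>x > 0\<close>])
    show "((\<lambda>y. B x * G1 y + c * r y) \<longlongrightarrow> 0) (at_right 0)"
      using tendsto_add[OF tendsto_mult_left[OF lim, of "B x"] tendsto_mult_left[OF r(2), of c]] by simp
    show "\<exists>d. ((\<lambda>y. B x * G1 y + c * r y) has_real_derivative d) (at y) \<and> d \<ge> 0"
      if y: "0 < y" "y \<le> x" for y
    proof (intro exI conjI)
      show "((\<lambda>y. B x * G1 y + c * r y) has_real_derivative B x * g y + c * (B y * f y)) (at y)"
        using y by (intro DERIV_add DERIV_cmult G1 r) auto
      have "\<bar>B y * f y\<bar> \<le> B x * g y"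
        unfolding abs_mult using B_mono[OF y] B_pos[of x] B_pos[of y] y f[OF y]
        by (intro mult_mono) auto
      then show "0 \<le> B x * g y + c * (B y * f y)" using \<open>c = 1 \<or> c = -1\<close> by auto
    qed
  qed
  from this[of 1] this[of "-1"] show ?thesis by auto
qed

text \<open>Dividing the previous bound by B leaves |u'| <= G1, as if the weight were constant; one
  more integration gives G2. Applied to powers of y, the two antiderivatives produce the factorials
  of \<open>D_iterate\<close>.\<close>

lemma neumann_comparison:
  assumes n: "neumann B u f"
    and f: "\<And>y. 0 < y \<Longrightarrow> y \<le> x \<Longrightarrow> \<bar>f y\<bar> \<le> g y"
    and G1: "\<And>y. 0 \<le> y \<Longrightarrow> y \<le> x \<Longrightarrow> (G1 has_real_derivative g y) (at y)" "G1 0 = 0"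
    and G2: "\<And>y. 0 \<le> y \<Longrightarrow> y \<le> x \<Longrightarrow> (G2 has_real_derivative G1 y) (at y)" "G2 0 = 0"
    and "x \<ge> 0"
  shows "\<bar>u x - u 0\<bar> \<le> G2 x"
proof (cases "x = 0")
  case False
  with \<open>x \<ge> 0\<close> have "x > 0" by simp
  from n obtain r where r: "continuous_on {0..} u"
    "\<And>x. x > 0 \<Longrightarrow> (u has_real_derivative r x / B x) (at x)"
    "\<And>x. x > 0 \<Longrightarrow> (r has_real_derivative B x * f x) (at x)"
    "(r \<longlongrightarrow> 0) (at_right 0)" unfolding neumann_def by blast
  have lim: "(G2 \<longlongrightarrow> 0) (at_right 0)"
  proof -
    have "isCont G2 0" using G2(1)[of 0] \<open>x > 0\<close> by (auto intro: DERIV_isCont)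
    then show ?thesis using G2(2) by (auto simp: isCont_def intro: tendsto_within_subset)
  qed
  have "c * u 0 \<le> G2 x + c * u x" if "c = 1 \<or> c = -1" for c
  proof (rule limit_at_0_le[where f="\<lambda>y. G2 y + c * u y", OF _ \<open>x > 0\<close>])
    show "((\<lambda>y. G2 y + c * u y) \<longlongrightarrow> c * u 0) (at_right 0)"
      using tendsto_add[OF lim tendsto_mult_left[OF continuous_on_at_right_0[OF r(1)], of c]] by simp
    show "\<exists>d. ((\<lambda>y. G2 y + c * u y) has_real_derivative d) (at y) \<and> d \<ge> 0"
      if y: "0 < y" "y \<le> x" for y
    proof (intro exI conjI)
      show "((\<lambda>y. G2 y + c * u y) has_real_derivative G1 y + c * (r y / B y)) (at y)"
        using y by (intro DERIV_add DERIV_cmult G2 r) auto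
      have "\<bar>r y\<bar> \<le> B y * G1 y"
        by (rule quasi_derivative_bound[OF r(3,4) f G1]) (use y in auto)
      then have "\<bar>r y / B y\<bar> \<le> G1 y" using B_pos[OF y(1)] by (simp add: field_simps)
      then show "0 \<le> G1 y + c * (r y / B y)"
        using \<open>c = 1 \<or> c = -1\<close> abs_le_D1[of "r y / B y" "G1 y"] abs_le_D2[of "r y / B y" "G1 y"] by force
    qed
  qed
  from this[of 1] this[of "-1"] show ?thesis by auto
qed (use G2 in auto)

text \<open>The energy \<open>lam * u^2 + (r / B)^2\<close> has derivative
  \<open>- 2 r^2 B' / B^3 <= 0\<close> and starts at \<open>lam * u(0)^2\<close>. Besides the bound
  |v~_lam| <= 1 this gives uniqueness for lam >= 0.\<close>

lemma neumann_eigen_bound: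
  assumes n: "neumann B u (\<lambda>x. - lam * u x)" and "lam \<ge> 0" "x \<ge> 0"
  shows "\<bar>u x\<bar> \<le> \<bar>u 0\<bar>"
proof (cases "lam = 0 \<or> x = 0")
  \<comment> \<open>For lam = 0 the energy does not see u; comparison with f = 0 then shows that u
    is constant.\<close>
  case True
  then show ?thesis
    using neumann_comparison[OF n, of x "\<lambda>_. 0" "\<lambda>_. 0" "\<lambda>_. 0"] \<open>x \<ge> 0\<close> by auto
next
  case False
  then have "lam > 0" "x > 0" using assms by auto
  from n obtain r where r: "continuous_on {0..} u"
    "\<And>x. x > 0 \<Longrightarrow> (u has_real_derivative r x / B x) (at x)"
    "\<And>x. x > 0 \<Longrightarrow> (r has_real_derivative B x * (- lam * u x)) (at x)"
    "(r \<longlongrightarrow> 0) (at_right 0)" unfolding neumann_def by blast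
  \<comment> \<open>Since B may vanish at 0, r -> 0 alone does not give r / B -> 0. A crude bound C
    of u on [0, x] yields |r / B| <= lam C y.\<close>
  have "compact (u ` {0..x})"
    by (rule compact_continuous_image) (auto intro: continuous_on_subset[OF r(1)])
  then obtain C where C: "\<And>y. 0 \<le> y \<Longrightarrow> y \<le> x \<Longrightarrow> \<bar>u y\<bar> \<le> C"
    by (force dest!: compact_imp_bounded simp: bounded_iff)
  have rB: "\<bar>r y / B y\<bar> \<le> lam * C * y" if y: "0 < y" "y \<le> x" for y
  proof -
    have "\<bar>r y\<bar> \<le> B y * (lam * C * y)"
    proof (rule quasi_derivative_bound[OF r(3,4)])
      show "\<bar>- lam * u z\<bar> \<le> lam * C" if "0 < z" "z \<le> y" for z
        using C[of z] that y \<open>lam > 0\<close> by (auto simp: abs_mult intro!: mult_left_mono)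
      show "((*) (lam * C) has_real_derivative lam * C) (at z)" for z
        by (auto intro!: derivative_eq_intros)
    qed (use y in auto)
    then show ?thesis using B_pos[OF y(1)] by (simp add: field_simps)
  qed
  have "((\<lambda>y. r y / B y) \<longlongrightarrow> 0) (at_right 0)"
  proof (rule tendsto_rabs_zero_cancel, rule tendsto_sandwich[OF _ _ tendsto_const])
    show "\<forall>\<^sub>F y in at_right 0. \<bar>r y / B y\<bar> \<le> lam * C * y"
      using eventually_at_right_real[OF \<open>x > 0\<close>] by eventually_elim (use rB in auto)
    show "((\<lambda>y. lam * C * y) \<longlongrightarrow> 0) (at_right 0)" by (auto intro!: tendsto_eq_intros)
  qed auto
  then have "((\<lambda>y. - (lam * (u y)\<^sup>2 + (r y / B y)\<^sup>2)) \<longlongrightarrow> - (lam * (u 0)\<^sup>2 + 0\<^sup>2)) (at_right 0)"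
    by (intro tendsto_intros continuous_on_at_right_0 r(1))
  then have "- (lam * (u 0)\<^sup>2 + 0\<^sup>2) \<le> - (lam * (u x)\<^sup>2 + (r x / B x)\<^sup>2)"
  proof (rule limit_at_0_le[OF _ \<open>x > 0\<close>, rotated])
    fix y :: real assume y: "0 < y" "y \<le> x"
    have B: "B y > 0" using B_pos y by auto
    have "((\<lambda>y. - (lam * (u y)\<^sup>2 + (r y / B y)\<^sup>2)) has_real_derivative 2 * (r y)\<^sup>2 * B' y / (B y) ^ 3) (at y)"
    proof (rule DERIV_cong)
      show "((\<lambda>y. - (lam * (u y)\<^sup>2 + (r y / B y)\<^sup>2)) has_real_derivative
         - (lam * (2 * u y * (r y / B y))
            + 2 * (r y / B y) * ((B y * (- lam * u y) * B y - r y * B' y) / (B y * B y)))) (at y)"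
        using DERIV_minus[OF DERIV_add[OF
            DERIV_cmult[OF DERIV_power[OF r(2)[OF y(1)], where n=2], of lam]
            DERIV_power[OF DERIV_divide[OF r(3)[OF y(1)] B_deriv[OF y(1)]], where n=2]]] B
        by (simp add: mult_ac)
      show "- (lam * (2 * u y * (r y / B y))
            + 2 * (r y / B y) * ((B y * (- lam * u y) * B y - r y * B' y) / (B y * B y)))
          = 2 * (r y)\<^sup>2 * B' y / (B y) ^ 3"
        using B by (simp add: field_simps power2_eq_square power3_eq_cube)
    qed
    then show "\<exists>d. ((\<lambda>y. - (lam * (u y)\<^sup>2 + (r y / B y)\<^sup>2)) has_real_derivative d) (at y) \<and> 0 \<le> d"
      using B'_nonneg[OF y(1)] B by (intro exI[of _ "2 * (r y)\<^sup>2 * B' y / (B y) ^ 3"] conjI) auto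
  qed
  then have "lam * (u x)\<^sup>2 + (r x / B x)\<^sup>2 \<le> lam * (u 0)\<^sup>2" by simp
  then have "lam * (u x)\<^sup>2 \<le> lam * (u 0)\<^sup>2"
    by (rule order.trans[rotated]) (rule add_increasing2[OF zero_le_power2 order_refl])
  then show ?thesis using \<open>lam > 0\<close> by (simp add: abs_le_square_iff)
qed

end

section \<open>Polynomials of a symmetric operator between 0 and 1\<close>

definition poly_op :: "('v::real_vector \<Rightarrow> 'v) \<Rightarrow> real poly \<Rightarrow> 'v \<Rightarrow> 'v"
  where "poly_op T p f = (\<Sum>i\<le>degree p. coeff p i *\<^sub>R (T ^^ i) f)"

lemma poly_op_altdef:
  assumes "degree p \<le> n"
  shows "poly_op T p f = (\<Sum>i\<le>n. coeff p i *\<^sub>R (T ^^ i) f)"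
  unfolding poly_op_def
  by (rule sum.mono_neutral_left) (use assms in \<open>auto simp: coeff_eq_0\<close>)

lemma poly_op_0 [simp]: "poly_op T 0 f = 0"
  by (simp add: poly_op_def)

lemma poly_op_pCons:
  assumes "linear T"
  shows "poly_op T (pCons a p) f = a *\<^sub>R f + T (poly_op T p f)"
proof -
  have "poly_op T (pCons a p) f = (\<Sum>i\<le>Suc (degree p). coeff (pCons a p) i *\<^sub>R (T ^^ i) f)"
    by (rule poly_op_altdef) (rule degree_pCons_le)
  also have "\<dots> = a *\<^sub>R f + (\<Sum>i\<le>degree p. coeff p i *\<^sub>R T ((T ^^ i) f))"
    by (subst sum.atMost_Suc_shift) simp
  finally show ?thesis
    by (simp add: poly_op_def linear_sum[OF assms] linear_scale[OF assms])
qed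

lemma poly_op_add: "poly_op T (p + q) f = poly_op T p f + poly_op T q f"
proof -
  let ?n = "max (degree p) (degree q)"
  have "degree (p + q) \<le> ?n" by (rule degree_add_le) auto
  then show ?thesis
    by (subst (1 2 3) poly_op_altdef[where n="?n"]) (auto simp: scaleR_add_left sum.distrib)
qed

lemma poly_op_smult: "poly_op T (smult c p) f = c *\<^sub>R poly_op T p f"
  by (subst (1 2) poly_op_altdef[where n="degree p"])
     (auto simp: scaleR_sum_right intro: degree_smult_le)

lemma poly_op_diff: "poly_op T (p - q) f = poly_op T p f - poly_op T q f"
  using poly_op_add[of T p "smult (-1) q" f] poly_op_smult[of T "-1" q f] by simp

lemma poly_op_1 [simp]: "poly_op T 1 f = f"
  by (simp add: poly_op_def)

lemma linear_funpow: "linear T \<Longrightarrow> linear (T ^^ n)" for T :: "'v::real_vector \<Rightarrow> 'v"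
  by (induction n) (use linear_compose in \<open>auto simp: linear_id\<close>)

lemma linear_poly_op:
  assumes "linear T"
  shows "linear (poly_op T p)"
  unfolding poly_op_def
  by (intro linear_compose_sum ballI linear_compose_scale_right linear_funpow assms)

lemma poly_op_mult:
  assumes "linear T"
  shows "poly_op T (p * q) f = poly_op T p (poly_op T q f)"
proof (induction p)
  case (pCons a p)
  show ?case
    by (simp add: poly_op_add poly_op_smult pCons.IH poly_op_pCons[OF assms])
qed simp

section \<open>Bernstein polynomials as formal polynomials\<close>

definition bernstein :: "nat \<Rightarrow> nat \<Rightarrow> real poly"
  where "bernstein n j = smult (of_nat (n choose j)) ([:0, 1:] ^ j * [:1, -1:] ^ (n - j))"

definition bernstein_sum :: "nat \<Rightarrow> real poly \<Rightarrow> real poly"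
  where "bernstein_sum n p = (\<Sum>j\<le>n. smult (poly p (real j / real n)) (bernstein n j))"

lemma sum_bernstein: "(\<Sum>j\<le>n. bernstein n j) = 1"
proof -
  have "[:0, 1:] + [:1, -1:] = (1 :: real poly)" by (simp add: one_pCons)
  then have "1 = ([:0, 1:] + [:1, -1:] :: real poly) ^ n" by (simp only: power_one)
  also have "\<dots> = (\<Sum>j\<le>n. bernstein n j)"
    unfolding binomial_ring bernstein_def
    by (intro sum.cong refl) (simp add: of_nat_poly)
  finally show ?thesis ..
qed

lemma smult_sum_right: "smult c (\<Sum>i\<in>I. f i) = (\<Sum>i\<in>I. smult c (f i))"
  by (induction I rule: infinite_finite_induct) (auto simp: smult_add_right)

text \<open>The logarithmic derivative of X^j (1 - X)^(n - j), cleared of denominators;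
  \<open>[:0, 1, -1:]\<close> is X (1 - X).\<close>

lemma pderiv_bernstein:
  assumes "j \<le> n"
  shows "[:0, 1, -1:] * pderiv (bernstein n j) = [:real j, - real n:] * bernstein n j"
proof -
  have X: "[:0, 1:] * pderiv ([:0, 1:] ^ j) = smult (real j) ([:0, 1:] ^ j)"
    by (cases j) (auto simp: pderiv_power_Suc pderiv_pCons simp del: power_Suc, simp_all)
  have Y: "[:1, -1:] * pderiv ([:1, -1:] ^ m) = smult (- real m) ([:1, -1:] ^ m)" for m
    by (cases m) (auto simp: pderiv_power_Suc pderiv_pCons simp del: power_Suc, simp_all)
  define P Q where "P = ([:0, 1:] ^ j :: real poly)" and "Q = ([:1, -1:] ^ (n - j) :: real poly)"
  have *: "[:0, 1, -1:] = [:0, 1:] * ([:1, -1:] :: real poly)" by simp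
  have "[:0, 1, -1:] * pderiv (P * Q)
      = [:1, -1:] * Q * ([:0, 1:] * pderiv P) + [:0, 1:] * P * ([:1, -1:] * pderiv Q)"
    unfolding * pderiv_mult by (simp only: algebra_simps)
  also have "\<dots> = (smult (real j) [:1, -1:] + smult (- real (n - j)) [:0, 1:]) * (P * Q)"
    unfolding P_def Q_def X Y by (simp only: algebra_simps mult_smult_left mult_smult_right)
  also have "smult (real j) [:1, -1:] + smult (- real (n - j)) [:0, 1:] = [:real j, - real n:]"
    using assms by (simp add: of_nat_diff)
  finally show ?thesis unfolding bernstein_def P_def Q_def pderiv_smult by simp
qed

text \<open>Writing the node as j / n = X + (j - n X) / n turns multiplication by X under the
  samples into multiplication outside plus a term of order 1 / n. This recursion drives the
  induction on p in \<open>bernstein_sum_converges\<close>.\<close>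

lemma bernstein_sum_X:
  assumes "n > 0"
  shows "bernstein_sum n (pCons 0 p) = pCons 0 (bernstein_sum n p)
     + smult (1 / real n) ([:0, 1, -1:] * pderiv (bernstein_sum n p))"
proof -
  let ?c = "\<lambda>j. poly p (real j / real n)"
  have "[:0, 1, -1:] * pderiv (bernstein_sum n p)
      = (\<Sum>j\<le>n. smult (?c j) ([:0, 1, -1:] * pderiv (bernstein n j)))"
    unfolding bernstein_sum_def by (simp add: higher_pderiv_sum[of 1, simplified] pderiv_smult sum_distrib_left del: mult_pCons_left)
  also have "\<dots> = (\<Sum>j\<le>n. smult (?c j) ([:real j, - real n:] * bernstein n j))"
    by (intro sum.cong refl) (simp add: pderiv_bernstein del: mult_pCons_left)
  finally have 1: "[:0, 1, -1:] * pderiv (bernstein_sum n p)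
     = (\<Sum>j\<le>n. smult (?c j) ([:real j, - real n:] * bernstein n j))" .
  have 2: "pCons 0 (bernstein_sum n p) = (\<Sum>j\<le>n. smult (?c j) ([:0, 1:] * bernstein n j))"
  proof -
    have "pCons 0 (bernstein_sum n p) = [:0, 1:] * bernstein_sum n p" by simp
    then show ?thesis
      unfolding bernstein_sum_def by (simp only: sum_distrib_left mult_smult_right)
  qed
  have "pCons 0 (bernstein_sum n p)
     + smult (1 / real n) ([:0, 1, -1:] * pderiv (bernstein_sum n p))
     = (\<Sum>j\<le>n. smult (?c j) ([:0, 1:] * bernstein n j
          + smult (1 / real n) ([:real j, - real n:] * bernstein n j)))"
    unfolding 1 2 smult_sum_right
    by (simp only: sum.distrib smult_add_right smult_smult mult.commute)
  also have "\<dots> = (\<Sum>j\<le>n. smult (?c j) (([:0, 1:] + smult (1 / real n) [:real j, - real n:]) * bernstein n j))"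
    by (simp only: distrib_right mult_smult_left)
  also have "\<dots> = bernstein_sum n (pCons 0 p)"
    unfolding bernstein_sum_def using assms by (simp add: mult.commute)
  finally show ?thesis ..
qed

lemma bernstein_sum_const: "bernstein_sum n [:a:] = [:a:]"
  using sum_bernstein[of n] by (simp add: bernstein_sum_def smult_sum_right[symmetric])

lemma bernstein_sum_add: "bernstein_sum n (p + q) = bernstein_sum n p + bernstein_sum n q"
  by (simp add: bernstein_sum_def smult_add_left sum.distrib)

text \<open>Unlike the usual uniform statement of Bernstein's theorem, coefficientwise convergence for
  polynomials transfers to every linear functional on polynomials.\<close>

lemma bernstein_sum_converges:
  "(\<forall>n>0. degree (bernstein_sum n p) \<le> degree p) \<and>
   (\<forall>l. (\<lambda>n. coeff (bernstein_sum n p) l) \<longlonglongrightarrow> coeff p l)"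
proof (induction p)
  case 0
  then show ?case by (simp add: bernstein_sum_def)
next
  case (pCons a p)
  show ?case
  proof (cases "p = 0")
    case True
    then show ?thesis by (simp add: bernstein_sum_const)
  next
    case False
    have eq: "bernstein_sum n (pCons a p) = [:a:] + (pCons 0 (bernstein_sum n p)
       + smult (1 / real n) ([:0, 1, -1:] * pderiv (bernstein_sum n p)))" if "n > 0" for n
    proof -
      have "bernstein_sum n (pCons a p) = bernstein_sum n ([:a:] + pCons 0 p)" by simp
      then show ?thesis unfolding bernstein_sum_add bernstein_sum_const bernstein_sum_X[OF that] .
    qed
    have deg: "degree (bernstein_sum n (pCons a p)) \<le> degree (pCons a p)" if "n > 0" for n
    proof -
      let ?b = "bernstein_sum n p"
      have b: "degree ?b \<le> degree p" using pCons.IH that by blast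
      have "degree (pderiv ?b) \<le> degree p - 1" using b by (simp add: degree_pderiv)
      \<comment> \<open>Differentiation lowers the degree by one before X (1 - X) raises it by two.
        The degrees stay bounded in n, so finitely many coefficients carry the convergence.\<close>
      have "degree ([:0, 1, -1:] * pderiv ?b) \<le> Suc (degree p)"
      proof (cases "pderiv ?b = 0")
        case False
        then have "degree ?b \<noteq> 0" by (auto simp: pderiv_eq_0_iff)
        have "degree ([:0, 1, -1:] * pderiv ?b) \<le> 2 + degree (pderiv ?b)"
          by (rule order.trans[OF degree_mult_le]) simp
        then show ?thesis using \<open>degree ?b \<noteq> 0\<close> b by (simp add: degree_pderiv)
      qed (simp del: mult_pCons_left)
      then show ?thesis
        unfolding eq[OF that] using False b
        by (intro degree_add_le order.trans[OF degree_smult_le] order.trans[OF degree_pCons_le])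
           auto
    qed
    have "(\<lambda>n. coeff (bernstein_sum n (pCons a p)) l) \<longlonglongrightarrow> coeff (pCons a p) l" for l
    proof (rule Lim_transform_eventually)
      let ?b = "\<lambda>n. bernstein_sum n p"
      have "(\<lambda>n. coeff [:a:] l + ((if l = 0 then 0 else coeff (?b n) (l - 1))
          + 1 / real n * (\<Sum>i\<le>l. coeff [:0, 1, -1:] i * (real (Suc (l - i)) * coeff (?b n) (Suc (l - i))))))
         \<longlonglongrightarrow> coeff [:a:] l + ((if l = 0 then 0 else coeff p (l - 1))
          + 0 * (\<Sum>i\<le>l. coeff [:0, 1, -1:] i * (real (Suc (l - i)) * coeff p (Suc (l - i)))))"
        using pCons.IH by (intro tendsto_intros lim_1_over_n) (auto intro!: tendsto_intros)
      then show "(\<lambda>n. coeff [:a:] l + ((if l = 0 then 0 else coeff (?b n) (l - 1))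
          + 1 / real n * (\<Sum>i\<le>l. coeff [:0, 1, -1:] i * (real (Suc (l - i)) * coeff (?b n) (Suc (l - i))))))
         \<longlonglongrightarrow> coeff (pCons a p) l"
        by (cases l) auto
      show "\<forall>\<^sub>F n in sequentially. coeff [:a:] l + ((if l = 0 then 0 else coeff (?b n) (l - 1))
          + 1 / real n * (\<Sum>i\<le>l. coeff [:0, 1, -1:] i * (real (Suc (l - i)) * coeff (?b n) (Suc (l - i)))))
         = coeff (bernstein_sum n (pCons a p)) l"
        using eventually_gt_at_top[of 0]
        by eventually_elim
           (simp add: eq coeff_mult coeff_pderiv coeff_pCons[of 0 "bernstein_sum _ p"]
             del: mult_pCons_left split: nat.split)
    qed
    then show ?thesis using deg by blast
  qed
qed

text \<open>The form is semidefinite and lives on a subspace \<open>E\<close> of an arbitrary vector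
  space, because the example in view, integrable bounded continuous functions with the L^2 product,
  is not complete. Polynomials of T take the place of the spectral theorem.\<close>

locale symmetric_contraction =
  fixes T :: "'v::real_vector \<Rightarrow> 'v" and E :: "'v set" and ip :: "'v \<Rightarrow> 'v \<Rightarrow> real"
  assumes T_linear: "linear T"
    and E_subspace: "subspace E"
    and T_E: "f \<in> E \<Longrightarrow> T f \<in> E"
    and ip_add_left: "f \<in> E \<Longrightarrow> g \<in> E \<Longrightarrow> h \<in> E \<Longrightarrow> ip (f + g) h = ip f h + ip g h"
    and ip_scale_left: "f \<in> E \<Longrightarrow> h \<in> E \<Longrightarrow> ip (c *\<^sub>R f) h = c * ip f h"
    and ip_commute: "f \<in> E \<Longrightarrow> g \<in> E \<Longrightarrow> ip f g = ip g f"
    and ip_nonneg: "f \<in> E \<Longrightarrow> ip f f \<ge> 0"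
    and T_symmetric: "f \<in> E \<Longrightarrow> g \<in> E \<Longrightarrow> ip (T f) g = ip f (T g)"
    and T_nonneg: "f \<in> E \<Longrightarrow> ip (T f) f \<ge> 0"
    and T_le: "f \<in> E \<Longrightarrow> ip (T f) f \<le> ip f f"
begin

lemma E_closed [intro]:
  "0 \<in> E" "f \<in> E \<Longrightarrow> g \<in> E \<Longrightarrow> f + g \<in> E" "f \<in> E \<Longrightarrow> c *\<^sub>R f \<in> E" "f \<in> E \<Longrightarrow> g \<in> E \<Longrightarrow> f - g \<in> E"
  using E_subspace by (auto simp: subspace_0 subspace_add subspace_scale subspace_diff)

lemma poly_op_E [intro]: "f \<in> E \<Longrightarrow> poly_op T p f \<in> E"
  by (induction p) (auto simp: poly_op_pCons[OF T_linear] T_E)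

lemma ip_add_right: "f \<in> E \<Longrightarrow> g \<in> E \<Longrightarrow> h \<in> E \<Longrightarrow> ip h (f + g) = ip h f + ip h g"
  using ip_add_left[of f g h] ip_commute[of h] E_closed by auto

lemma ip_scale_right: "f \<in> E \<Longrightarrow> h \<in> E \<Longrightarrow> ip h (c *\<^sub>R f) = c * ip h f"
  using ip_scale_left[of f h c] ip_commute[of h] E_closed by auto

lemma ip_diff_left: "f \<in> E \<Longrightarrow> g \<in> E \<Longrightarrow> h \<in> E \<Longrightarrow> ip (f - g) h = ip f h - ip g h"
  using ip_add_left[of f "(-1) *\<^sub>R g" h] ip_scale_left[of g h "-1"] E_closed(3)[of g "-1"] by auto

lemma ip_diff_right: "f \<in> E \<Longrightarrow> g \<in> E \<Longrightarrow> h \<in> E \<Longrightarrow> ip h (f - g) = ip h f - ip h g"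
  using ip_diff_left[of f g h] ip_commute[of h] E_closed by auto

lemma ip_sum_left:
  assumes "finite I" "\<And>i. i \<in> I \<Longrightarrow> f i \<in> E" "h \<in> E"
  shows "ip (\<Sum>i\<in>I. f i) h = (\<Sum>i\<in>I. ip (f i) h)"
proof -
  have "(\<Sum>i\<in>I. f i) \<in> E \<and> ip (\<Sum>i\<in>I. f i) h = (\<Sum>i\<in>I. ip (f i) h)"
    using assms(1,2)
  proof (induction rule: finite_induct)
    case empty
    show ?case using ip_scale_left[of 0 h 0] assms(3) by auto
  next
    case (insert i I)
    then show ?case using assms(3) by (simp add: ip_add_left) blast
  qed
  then show ?thesis ..
qed

lemma poly_op_symmetric: "f \<in> E \<Longrightarrow> g \<in> E \<Longrightarrow> ip (poly_op T p f) g = ip f (poly_op T p g)"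
proof (induction p arbitrary: f g)
  case 0
  have "ip 0 g = 0" "ip f 0 = 0"
    using ip_scale_left[of 0 g 0] ip_scale_right[of 0 f 0] 0 E_closed by auto
  then show ?case by simp
next
  case (pCons a p)
  have "ip (poly_op T (pCons a p) f) g = a * ip f g + ip f (poly_op T p (T g))"
    using pCons by (simp add: poly_op_pCons[OF T_linear] ip_add_left ip_scale_left
        T_E E_closed poly_op_E T_symmetric)
  also have "poly_op T p (T g) = T (poly_op T p g)"
    using poly_op_mult[OF T_linear, of p "[:0, 1:]" g] poly_op_mult[OF T_linear, of "[:0, 1:]" p g]
    by (simp add: mult.commute poly_op_pCons[OF T_linear] linear_0[OF T_linear])
  finally show ?case using pCons.prems
    by (simp add: poly_op_pCons[OF T_linear] ip_add_right ip_scale_right T_E E_closed poly_op_E)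
qed

text \<open>Even powers are absorbed as squares r(T)^2 by symmetry, which leaves exponents 0 and 1.
  The mixed case is t (1 - t) = t (1 - t)^2 + (1 - t) t^2, a sum of two cases already
  treated.\<close>

lemma poly_op_power_nonneg:
  assumes "f \<in> E"
  shows "ip (poly_op T ([:0, 1:] ^ i * [:1, -1:] ^ j) f) f \<ge> 0"
proof -
  define P where "P = (\<lambda>p. \<forall>f\<in>E. ip (poly_op T p f) f \<ge> 0)"
  have sq: "P (q * (r * r))" if "P q" for q r
    unfolding P_def
  proof
    fix f assume f: "f \<in> E"
    have "ip (poly_op T (q * (r * r)) f) f = ip (poly_op T (r * (q * r)) f) f"
      by (simp add: mult_ac)
    also have "\<dots> = ip (poly_op T q (poly_op T r f)) (poly_op T r f)"
      using f by (subst poly_op_mult[OF T_linear], subst poly_op_symmetric)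
        (auto simp: poly_op_mult[OF T_linear])
    finally show "0 \<le> ip (poly_op T (q * (r * r)) f) f" using that f by (auto simp: P_def)
  qed
  have P1: "P 1" using ip_nonneg by (simp add: P_def)
  have PX: "P [:0, 1:]" using T_nonneg by (simp add: P_def poly_op_pCons[OF T_linear] linear_0[OF T_linear])
  have PY: "P [:1, -1:]" using T_le 
    by (simp add: P_def poly_op_pCons[OF T_linear] linear_0[OF T_linear] linear_neg[OF T_linear]
        ip_diff_left T_E)
  have PXY: "P ([:0, 1:] * [:1, -1:])"
  proof -
    have "P ([:0, 1:] * ([:1, -1:] * [:1, -1:]) + [:1, -1:] * ([:0, 1:] * [:0, 1:]))"
      using sq[OF PX, of "[:1, -1:]"] sq[OF PY, of "[:0, 1:]"]
      unfolding P_def poly_op_add by (auto simp: ip_add_left poly_op_E simp del: mult_pCons_left)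
    moreover have "[:0, 1:] * ([:1, -1:] * [:1, -1:]) + [:1, -1:] * ([:0, 1:] * [:0, 1:])
        = [:0, 1:] * ([:1, -1:] :: real poly)" by simp
    ultimately show ?thesis by (simp only:)
  qed
  obtain i' j' a b where i: "i = 2 * i' + a" "a = 0 \<or> a = 1" and j: "j = 2 * j' + b" "b = 0 \<or> b = 1"
    by (metis mod2_eq_if mult_div_mod_eq)
  have "P ([:0, 1:] ^ a * [:1, -1:] ^ b)"
    using i(2) j(2) P1 PX PY PXY by (elim disjE) (simp_all only: power_0 power_one_right mult_1_left mult_1_right)
  from sq[OF this, of "[:0, 1:] ^ i' * [:1, -1:] ^ j'"] have "P ([:0, 1:] ^ i * [:1, -1:] ^ j)"
    unfolding i(1) j(1) mult_2 power_add by (simp only: mult_ac)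
  with assms show ?thesis by (simp add: P_def)
qed

text \<open>The integral of the Bernstein polynomial against the spectral measure of
  \<open>f\<close>, expressed through the form; at the nodes j / n these weights stand in for that
  measure.\<close>

definition bernstein_weight :: "'v \<Rightarrow> nat \<Rightarrow> nat \<Rightarrow> real"
  where "bernstein_weight f n j = ip (poly_op T (bernstein n j) f) f"

lemma bernstein_weight_nonneg: "f \<in> E \<Longrightarrow> bernstein_weight f n j \<ge> 0"
  unfolding bernstein_weight_def bernstein_def poly_op_smult
  by (simp add: ip_scale_left poly_op_E poly_op_power_nonneg)

lemma ip_bernstein_sum:
  assumes "f \<in> E"
  shows "ip (poly_op T (bernstein_sum n p) f) f
       = (\<Sum>j\<le>n. bernstein_weight f n j * poly p (real j / real n))"
proof -
  have "poly_op T (\<Sum>j\<in>J. q j) f = (\<Sum>j\<in>J. poly_op T (q j) f)" for J :: "nat set" and q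
    by (induction J rule: infinite_finite_induct) (auto simp: poly_op_add)
  then show ?thesis
    using assms unfolding bernstein_sum_def bernstein_weight_def
    by (simp add: ip_sum_left poly_op_smult ip_scale_left poly_op_E E_closed mult.commute)
qed

lemma sum_bernstein_weight:
  assumes "f \<in> E"
  shows "(\<Sum>j\<le>n. bernstein_weight f n j) = ip f f"
  using ip_bernstein_sum[OF assms, of n 1] bernstein_sum_const[of n 1]
  by (simp add: one_pCons[symmetric])

text \<open>By the degree bound the quadrature is, for all n > 0, the same linear function of
  finitely many coefficients of \<open>bernstein_sum n p\<close>, so coefficientwise convergence
  carries over.\<close>

lemma bernstein_weight_converges:
  assumes "f \<in> E"
  shows "(\<lambda>n. \<Sum>j\<le>n. bernstein_weight f n j * poly p (real j / real n)) \<longlonglongrightarrow> ip (poly_op T p f) f"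
proof -
  have Tf: "(T ^^ i) f \<in> E" for i by (induction i) (auto simp: assms T_E)
  have eq: "ip (poly_op T q f) f = (\<Sum>i\<le>degree p. coeff q i * ip ((T ^^ i) f) f)"
    if "degree q \<le> degree p" for q
    using poly_op_altdef[OF that, of T f] Tf assms
    by (simp add: ip_sum_left ip_scale_left E_closed)
  have "(\<lambda>n. \<Sum>i\<le>degree p. coeff (bernstein_sum n p) i * ip ((T ^^ i) f) f)
      \<longlonglongrightarrow> (\<Sum>i\<le>degree p. coeff p i * ip ((T ^^ i) f) f)"
    using bernstein_sum_converges[of p] by (intro tendsto_intros) auto
  then have "(\<lambda>n. \<Sum>i\<le>degree p. coeff (bernstein_sum n p) i * ip ((T ^^ i) f) f)
      \<longlonglongrightarrow> ip (poly_op T p f) f" by (simp add: eq)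
  then show ?thesis
  proof (rule Lim_transform_eventually)
    show "\<forall>\<^sub>F n in sequentially. (\<Sum>i\<le>degree p. coeff (bernstein_sum n p) i * ip ((T ^^ i) f) f)
       = (\<Sum>j\<le>n. bernstein_weight f n j * poly p (real j / real n))"
      using eventually_gt_at_top[of 0]
    proof eventually_elim
      case (elim n)
      then have "degree (bernstein_sum n p) \<le> degree p" using bernstein_sum_converges by blast
      from eq[OF this] show ?case by (simp add: ip_bernstein_sum assms)
    qed
  qed
qed

text \<open>Symmetry turns the left side into the form of p^2(T), the limit of quadratures of p^2;
  nonnegative weights with sum \<open>ip f f\<close> bound each of them by c^2 times that
  sum.\<close>

lemma poly_op_ip_le:
  assumes "f \<in> E" "\<And>t. 0 \<le> t \<Longrightarrow> t \<le> 1 \<Longrightarrow> \<bar>poly p t\<bar> \<le> c"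
  shows "ip (poly_op T p f) (poly_op T p f) \<le> c\<^sup>2 * ip f f"
proof -
  have "ip (poly_op T p f) (poly_op T p f) = ip (poly_op T (p * p) f) f"
    using assms(1) by (simp add: poly_op_mult[OF T_linear] poly_op_symmetric poly_op_E)
  also have "\<dots> \<le> c\<^sup>2 * ip f f"
  proof (rule LIMSEQ_le_const2[OF bernstein_weight_converges[OF assms(1)]], intro exI allI impI)
    fix n :: nat
    have "(\<Sum>j\<le>n. bernstein_weight f n j * poly (p * p) (real j / real n))
        \<le> (\<Sum>j\<le>n. bernstein_weight f n j * c\<^sup>2)"
    proof (intro sum_mono mult_left_mono bernstein_weight_nonneg assms(1))
      fix j assume "j \<in> {..n}"
      then have "\<bar>poly p (real j / real n)\<bar> \<le> c"
        by (intro assms(2)) (auto simp: divide_le_eq_1)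
      then show "poly (p * p) (real j / real n) \<le> c\<^sup>2"
        using abs_le_square_iff[of "poly p (real j / real n)" c] by (auto simp: power2_eq_square)
    qed
    then show "(\<Sum>j\<le>n. bernstein_weight f n j * poly (p * p) (real j / real n)) \<le> c\<^sup>2 * ip f f"
      by (simp only: sum_distrib_right[symmetric] sum_bernstein_weight[OF assms(1)] mult.commute[of "c\<^sup>2"])
  qed
  finally show ?thesis .
qed

lemma cauchy_schwarz:
  assumes "f \<in> E" "g \<in> E"
  shows "(ip f g)\<^sup>2 \<le> ip f f * ip g g"
proof -
  have q: "ip f f + 2 * t * ip f g + t\<^sup>2 * ip g g \<ge> 0" for t
  proof -
    have "ip (f + t *\<^sub>R g) (f + t *\<^sub>R g) = ip f f + 2 * t * ip f g + t\<^sup>2 * ip g g"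
      using assms by (simp add: ip_add_left ip_add_right ip_scale_left ip_scale_right E_closed
          ip_commute[of g f] power2_eq_square algebra_simps)
    then show ?thesis using ip_nonneg[of "f + t *\<^sub>R g"] assms by auto
  qed
  show ?thesis
  proof (cases "ip g g = 0")
    case True
    have "ip f g = 0"
    proof (rule ccontr)
      assume "ip f g \<noteq> 0"
      \<comment> \<open>For \<open>ip g g = 0\<close> the quadratic is affine in t, and this t is
        chosen to give it the value -1.\<close>
      then have "2 * (- (ip f f + 1) / (2 * ip f g)) * ip f g = - (ip f f + 1)" by simp
      then show False using q[of "- (ip f f + 1) / (2 * ip f g)"] True by simp
    qed
    then show ?thesis using True by simp
  next
    case False
    then have "ip g g > 0" using ip_nonneg[OF assms(2)] by simp
    then show ?thesis using q[of "- ip f g / ip g g"]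
      by (simp add: field_simps power2_eq_square)
  qed
qed

end

section \<open>Integrals over half-open intervals\<close>

text \<open>Functions on the half-line are extended to the left by their value at 0, so that the
  type of bounded continuous functions on the real line can be used.\<close>

lemma continuous_on_max_0:
  fixes g :: "real \<Rightarrow> 'a::topological_space"
  assumes "continuous_on {0..} g"
  shows "continuous_on UNIV (\<lambda>x. g (max 0 x))"
  by (rule continuous_on_compose2[OF assms]) (auto intro!: continuous_intros)

lemma set_borel_measurable_Ioi:
  fixes f :: "real \<Rightarrow> real"
  assumes "continuous_on {0<..} f" "A \<in> sets borel" "A \<subseteq> {0<..}"
  shows "set_borel_measurable borel A f"
  unfolding set_borel_measurable_def
  by (rule borel_measurable_continuous_on_indicator[OF assms(2) continuous_on_subset[OF assms(1,3)]])

lemma set_integrable_Ioc_extend: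
  fixes f :: "real \<Rightarrow> real"
  assumes "continuous_on {0<..} f" "set_integrable lborel {0<..1} f"
  shows "set_integrable lborel {0<..R} f"
proof -
  have "set_integrable lborel {1..max 1 R} f"
    by (rule borel_integrable_atLeastAtMost') (auto intro: continuous_on_subset[OF assms(1)])
  with assms(2) have "set_integrable lborel ({0<..1} \<union> {1..max 1 R}) f"
    by (rule set_integrable_Un) auto
  then show ?thesis by (rule set_integrable_subset) auto
qed

lemma set_integrable_Ioc_bounded:
  fixes f :: "real \<Rightarrow> real"
  assumes "continuous_on {0<..} f" "\<And>x. 0 < x \<Longrightarrow> x \<le> R \<Longrightarrow> \<bar>f x\<bar> \<le> C"
  shows "set_integrable lborel {0<..R} f"
  unfolding set_integrable_def
proof (rule integrableI_bounded_set[where A="{0<..R}" and B=C])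
  have "set_borel_measurable borel {0<..R} f"
    by (rule set_borel_measurable_Ioi[OF assms(1)]) auto
  then show "(\<lambda>x. indicator {0<..R} x *\<^sub>R f x) \<in> borel_measurable lborel"
    by (simp add: set_borel_measurable_def)
  show "emeasure lborel {0<..R} < \<infinity>"
    by (rule emeasure_bounded_finite) auto
qed (use assms(2) in \<open>auto simp: indicator_def\<close>)

text \<open>Typical f are 1 / B and its relatives, possibly unbounded at 0: the antiderivative is
  continuous at 0 but need not be differentiable there.\<close>

context
  fixes f :: "real \<Rightarrow> real"
  assumes f_cont: "continuous_on {0<..} f"
    and f_int: "\<And>R. set_integrable lborel {0<..R} f"
begin

lemma integral_Ioc_eq_integral:
  "f integrable_on {0..x}" "(LBINT y:{0<..x}. f y) = integral {0..x} f"
proof -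
  have n1: "negligible {y \<in> {0<..x} - {0..x}. f y \<noteq> 0}"
    by (rule negligible_subset[of "{0}"]) auto
  have n2: "negligible {y \<in> {0..x} - {0<..x}. f y \<noteq> 0}"
    by (rule negligible_subset[of "{0}"]) auto
  from set_borel_integral_eq_integral[OF f_int[of x]]
  show "f integrable_on {0..x}" "(LBINT y:{0<..x}. f y) = integral {0..x} f"
    using integrable_spike_set[OF _ n1 n2] integral_spike_set[OF n1 n2] by auto
qed

lemma DERIV_integral_Ioc:
  assumes "x > 0"
  shows "((\<lambda>z. LBINT y:{0<..z}. f y) has_real_derivative f x) (at x)"
proof -
  have "((\<lambda>u. integral {0..u} f) has_vector_derivative f x) (at x within {0..x + 1} - {})"
    using assms f_cont
    by (intro integral_has_vector_derivative_continuous_at integral_Ioc_eq_integral)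
       (auto simp: continuous_on_eq_continuous_at intro: continuous_at_imp_continuous_within)
  then have "((\<lambda>u. integral {0..u} f) has_real_derivative f x) (at x)"
    using assms by (simp add: has_real_derivative_iff_has_vector_derivative at_within_Icc_at)
  then show ?thesis by (simp add: integral_Ioc_eq_integral(2)[abs_def])
qed

lemma continuous_integral_Ioc: "continuous_on UNIV (\<lambda>z. LBINT y:{0<..z}. f y)"
proof -
  have "continuous_on {0..} (\<lambda>z. LBINT y:{0<..z}. f y)"
    unfolding continuous_on_eq_continuous_within
  proof
    fix x :: real assume x: "x \<in> {0..}"
    have "continuous_on {0..x + 1} (\<lambda>z. LBINT y:{0<..z}. f y)"
      unfolding integral_Ioc_eq_integral(2)
      by (rule indefinite_integral_continuous_1[OF integral_Ioc_eq_integral(1)])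
    then have "continuous (at x within {0..x + 1}) (\<lambda>z. LBINT y:{0<..z}. f y)"
      using x by (simp add: continuous_on_eq_continuous_within)
    moreover have "at x within {0..x + 1} = at x within {0..}"
      by (rule at_within_nhd[of _ "{..<x + 1}"]) auto
    ultimately show "continuous (at x within {0..}) (\<lambda>z. LBINT y:{0<..z}. f y)" by simp
  qed
  from continuous_on_max_0[OF this] show ?thesis
    by (rule continuous_on_eq) (auto simp: max_def set_lebesgue_integral_def)
qed

lemma integral_Ioc_nonpos: "x \<le> 0 \<Longrightarrow> (LBINT y:{0<..x}. f y) = 0"
  by (simp add: set_lebesgue_integral_def)

lemma integral_Ioc_tendsto_0: "((\<lambda>z. LBINT y:{0<..z}. f y) \<longlongrightarrow> 0) (at_right 0)"
  using continuous_on_at_right_0[OF continuous_on_subset[OF continuous_integral_Ioc]]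
  unfolding integral_Ioc_nonpos[OF order_refl] by simp

lemma set_integrable_Ioi_bounded:
  assumes "\<And>x. x > 0 \<Longrightarrow> f x \<ge> 0" "\<And>R. (LBINT y:{0<..R}. f y) \<le> C"
  shows "set_integrable lborel {0<..} f" "(LBINT y:{0<..}. f y) \<le> C"
proof -
  let ?g = "\<lambda>n x. indicator {0<..real n} x * f x"
  let ?I = "\<lambda>n. LBINT y:{0<..real n}. f y"
  have int: "integrable lborel (?g n)" for n
    using f_int[of "real n"] by (simp add: set_integrable_def)
  have I: "?I n = integral\<^sup>L lborel (?g n)" for n by (simp add: set_lebesgue_integral_def)
  have "incseq ?I" unfolding I
    by (intro incseq_SucI integral_mono int) (auto simp: indicator_def assms(1))
  with assms(2) obtain L where L: "?I \<longlonglongrightarrow> L" using incseq_convergent by blast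
  have mono: "AE x in lborel. mono (\<lambda>n. ?g n x)"
    by (auto simp: mono_def indicator_def assms(1))
  have lim: "AE x in lborel. (\<lambda>n. ?g n x) \<longlonglongrightarrow> indicator {0<..} x * f x"
  proof (intro AE_I2 tendsto_mult_right)
    fix x :: real
    obtain N :: nat where "x \<le> real N" using real_arch_simple by blast
    then have "\<forall>\<^sub>F n in sequentially. indicator {0<..real n} x = (indicator {0<..} x :: real)"
      unfolding eventually_sequentially by (intro exI[of _ N]) (auto simp: indicator_def)
    then show "(\<lambda>n. indicator {0<..real n} x) \<longlonglongrightarrow> (indicator {0<..} x :: real)"
      by (rule tendsto_eventually)
  qed
  have meas: "(\<lambda>x. indicator {0<..} x * f x) \<in> borel_measurable lborel"
    using borel_measurable_continuous_on_indicator[OF _ f_cont] by simp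
  show "set_integrable lborel {0<..} f"
    using integrable_monotone_convergence[OF int mono lim _ meas] L
    unfolding set_integrable_def I by simp
  have "(LBINT y:{0<..}. f y) = L"
    using integral_monotone_convergence[OF int mono lim _ meas] L
    unfolding set_lebesgue_integral_def I by simp
  then show "(LBINT y:{0<..}. f y) \<le> C" using L assms(2) by (auto intro: LIMSEQ_le_const2)
qed

end

section \<open>Green's function of the resolvent at \<open>-1\<close>\<close>

text \<open>\<open>phi\<close> is the eigenfunction with lam = -1, so it solves u - L u = 0; it will
  turn out positive and increasing, which permits reduction of order. The constant extension to the
  left keeps Green's function continuous on the whole plane.\<close>

locale sl_green = sl_weight +
  fixes phi :: "real \<Rightarrow> real"
  assumes phi_neumann: "neumann B phi phi"
    and phi_left: "x \<le> 0 \<Longrightarrow> phi x = 1"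
begin

text \<open>The quasi-derivative of \<open>phi\<close> as a named function, since
  \<open>neumann\<close> only asserts that one exists.\<close>

definition eta :: "real \<Rightarrow> real"
  where "eta x = B x * deriv phi x"

lemma phi_deriv: "x > 0 \<Longrightarrow> (phi has_real_derivative eta x / B x) (at x)"
  and eta_deriv: "x > 0 \<Longrightarrow> (eta has_real_derivative B x * phi x) (at x)"
  and eta_0: "(eta \<longlongrightarrow> 0) (at_right 0)"
proof -
  from phi_neumann obtain r where r: "continuous_on {0..} phi"
    "\<And>x. x > 0 \<Longrightarrow> (phi has_real_derivative r x / B x) (at x)"
    "\<And>x. x > 0 \<Longrightarrow> (r has_real_derivative B x * phi x) (at x)"
    "(r \<longlongrightarrow> 0) (at_right 0)" unfolding neumann_def by blast
  have eq: "eta x = r x" if "x > 0" for x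
    using DERIV_imp_deriv[OF r(2)[OF that]] B_pos[OF that] by (simp add: eta_def)
  show "(phi has_real_derivative eta x / B x) (at x)" if "x > 0"
    using r(2)[OF that] by (simp add: eq that)
  show "(eta has_real_derivative B x * phi x) (at x)" if "x > 0"
    by (rule has_field_derivative_transform_within_open[OF r(3)[OF that], of "{0<..}"])
       (use that eq in auto)
  show "(eta \<longlongrightarrow> 0) (at_right 0)"
    using r(4) by (rule Lim_transform_eventually)
      (auto simp: eventually_at_filter eq)
qed

lemma continuous_phi: "continuous_on UNIV phi"
proof -
  have "continuous_on {0..} phi" using phi_neumann unfolding neumann_def by blast
  from continuous_on_max_0[OF this] show ?thesis
    by (rule continuous_on_eq) (auto simp: max_def phi_left[symmetric] phi_left[of 0])
qed

lemma phi_lim_0: "(phi \<longlongrightarrow> 1) (at_right 0)"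
  using continuous_on_at_right_0[OF continuous_on_subset[OF continuous_phi]] phi_left[of 0] by simp

text \<open>The sign of \<open>phi\<close> is unknown at first, so squares are used: (eta phi)' = B
  phi^2 + eta^2 / B >= 0 gives eta phi >= 0, hence phi^2 is nondecreasing from 1. A change of sign
  would force a zero, contradicting phi^2 >= 1.\<close>

lemma phi_ge_1: "phi x \<ge> 1"
proof -
  have nn: "0 \<le> eta y * phi y" if "y > 0" for y
  proof (rule limit_at_0_le[where f="\<lambda>y. eta y * phi y", OF _ that])
    show "((\<lambda>y. eta y * phi y) \<longlongrightarrow> 0) (at_right 0)"
      using tendsto_mult[OF eta_0 phi_lim_0] by simp
    fix z :: real assume "0 < z"
    then show "\<exists>d. ((\<lambda>y. eta y * phi y) has_real_derivative d) (at z) \<and> 0 \<le> d"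
      using B_pos[of z] by (intro exI conjI) (rule DERIV_mult eta_deriv phi_deriv | simp add: mult.assoc)+
  qed
  have sq: "1 \<le> (phi y)\<^sup>2" for y
  proof (cases "y > 0")
    case True
    show ?thesis
    proof (rule limit_at_0_le[where f="\<lambda>y. (phi y)\<^sup>2", OF _ True])
      show "((\<lambda>y. (phi y)\<^sup>2) \<longlongrightarrow> 1) (at_right 0)"
        using tendsto_power[OF phi_lim_0, of 2] by simp
      fix z :: real assume z: "0 < z"
      have "2 * (eta z / B z * phi z) \<ge> 0"
        using nn[OF z] B_pos[OF z] by simp
      then show "\<exists>d. ((\<lambda>y. (phi y)\<^sup>2) has_real_derivative d) (at z) \<and> 0 \<le> d"
        using DERIV_power[OF phi_deriv[OF z], of 2] by auto
    qed
  qed (simp add: phi_left)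
  show ?thesis
  proof (rule ccontr)
    assume "\<not> 1 \<le> phi x"
    then have "x > 0" using phi_left[of x] by (cases "x > 0") auto
    have "phi x \<le> 0"
    proof (rule ccontr)
      assume "\<not> phi x \<le> 0"
      then have "(phi x)\<^sup>2 < 1" using \<open>\<not> 1 \<le> phi x\<close> by (simp add: power_less_one_iff)
      then show False using sq[of x] by simp
    qed
    then have "\<exists>y. 0 \<le> y \<and> y \<le> x \<and> phi y = 0"
      using \<open>x > 0\<close> by (intro IVT2') (auto simp: phi_left intro: continuous_on_subset[OF continuous_phi])
    then obtain y where "phi y = 0" by blast
    then show False using sq[of y] by simp
  qed
qed

lemma phi_pos: "phi x > 0"
  using phi_ge_1[of x] by simp

lemma eta_pos: "eta x > 0" if "x > 0"
proof -
  \<comment> \<open>The limit at 0 yields only a weak inequality; strictness comes from the increase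
    between x / 2 and x.\<close>
  have "0 \<le> eta (x / 2)"
    by (rule limit_at_0_le[OF _ _ eta_0])
       (use that eta_deriv B_pos phi_pos in \<open>auto, metis less_imp_le mult_pos_pos\<close>)
  also have "eta (x / 2) < eta x"
  proof (rule DERIV_pos_imp_increasing[where f=eta])
    show "x / 2 < x" using that by simp
    fix y assume "x / 2 \<le> y"
    with that have "y > 0" by simp
    then show "\<exists>d. (eta has_real_derivative d) (at y) \<and> 0 < d"
      using eta_deriv B_pos phi_pos by (intro exI[of _ "B y * phi y"]) auto
  qed
  finally show ?thesis .
qed

lemma phi_mono: "x \<le> y \<Longrightarrow> phi x \<le> phi y"
proof -
  assume xy: "x \<le> y"
  show ?thesis
  proof (cases "x > 0")
    case True
    show ?thesis
      by (rule DERIV_nonneg_imp_le_open[of 0 y phi x])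
         (use True xy phi_deriv eta_pos B_pos in \<open>auto intro!: exI less_imp_le divide_pos_pos\<close>)
  qed (use phi_ge_1[of y] phi_left[of x] in auto)
qed

text \<open>Reduction of order: \<open>phi\<close> times an antiderivative of 1 / (B phi^2) is a
  second solution. The nonincreasing one, \<open>psi\<close>, uses the tail integral
  \<open>H\<close> in place of \<open>Q\<close>.\<close>

definition Q :: "real \<Rightarrow> real"
  where "Q x = (LBINT y:{0<..x}. 1 / (B y * (phi y)\<^sup>2))"

lemma Q_cont: "continuous_on {0<..} (\<lambda>y. 1 / (B y * (phi y)\<^sup>2))"
  using B_pos phi_pos
  by (intro continuous_intros continuous_B continuous_on_subset[OF continuous_phi])
     (auto simp: less_imp_neq[symmetric])

lemma Q_int: "set_integrable lborel {0<..R} (\<lambda>y. 1 / (B y * (phi y)\<^sup>2))"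
proof (rule set_integrable_Ioc_extend[OF Q_cont])
  show "set_integrable lborel {0<..1} (\<lambda>y. 1 / (B y * (phi y)\<^sup>2))"
  proof (rule set_integrable_bound[OF B_inv_integrable])
    show "set_borel_measurable lborel {0<..1} (\<lambda>y. 1 / (B y * (phi y)\<^sup>2))"
      using set_borel_measurable_Ioi[OF Q_cont _ subsetI, of "{0<..1}"]
      unfolding set_borel_measurable_def by simp
    show "AE x in lborel. x \<in> {0<..1} \<longrightarrow> norm (1 / (B x * (phi x)\<^sup>2)) \<le> norm (1 / B x)"
    proof (intro AE_I2 impI)
      fix x :: real assume x: "x \<in> {0<..1}"
      have "1 \<le> (phi x)\<^sup>2" using phi_ge_1[of x] by (simp add: one_le_power)
      then have "B x * 1 \<le> B x * (phi x)\<^sup>2" using B_pos[of x] x by (intro mult_left_mono) auto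
      then show "norm (1 / (B x * (phi x)\<^sup>2)) \<le> norm (1 / B x)"
        using B_pos[of x] x phi_pos[of x] by (auto simp: abs_mult intro!: divide_left_mono mult_pos_pos)
    qed
  qed
qed

lemma Q_deriv: "x > 0 \<Longrightarrow> (Q has_real_derivative 1 / (B x * (phi x)\<^sup>2)) (at x)"
  unfolding Q_def by (rule DERIV_integral_Ioc[OF Q_cont Q_int])

lemma continuous_Q: "continuous_on UNIV Q"
  unfolding Q_def by (rule continuous_integral_Ioc[OF Q_cont Q_int])

lemma Q_left: "x \<le> 0 \<Longrightarrow> Q x = 0"
  unfolding Q_def by (simp add: set_lebesgue_integral_def)

lemma Q_mono: "x \<le> y \<Longrightarrow> Q x \<le> Q y"
  unfolding Q_def set_lebesgue_integral_def
  using Q_int[of x] Q_int[of y] B_pos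
  by (intro integral_mono) (auto simp: set_integrable_def indicator_def less_imp_le)

text \<open>Since phi' = eta / B and eta increases, 1 / (B phi^2) is at most 1 / eta(x) times the
  derivative of -1 / phi. This makes \<open>Q\<close> bounded and gives the decay of
  \<open>H\<close> from which chi <= 0 follows.\<close>

lemma Q_increment: "0 < x \<Longrightarrow> Q y - Q x \<le> 1 / (eta x * phi x)"
proof -
  assume x: "0 < x"
  show ?thesis
  proof (cases "x \<le> y")
    case True
    let ?K = "\<lambda>y. - (1 / eta x) * (1 / phi y) - Q y"
    have "?K x \<le> ?K y"
    proof (rule DERIV_nonneg_imp_nondecreasing[OF True])
      fix z assume z: "x \<le> z"
      then have "z > 0" using x by simp
      have "eta x \<le> eta z"
        by (rule DERIV_nonneg_imp_le_open[of 0 z eta x, OF _ x z])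
           (use eta_deriv B_pos phi_pos in \<open>metis less_imp_le mult_pos_pos\<close>)
      moreover have "(?K has_real_derivative (- (1 / eta x)) * ((0 * phi z - 1 * (eta z / B z)) / (phi z * phi z))
           - 1 / (B z * (phi z)\<^sup>2)) (at z)"
        using phi_pos[of z] \<open>z > 0\<close>
        by (intro DERIV_diff DERIV_cmult DERIV_divide DERIV_const phi_deriv Q_deriv) auto
      moreover have "(- (1 / eta x)) * ((0 * phi z - 1 * (eta z / B z)) / (phi z * phi z)) - 1 / (B z * (phi z)\<^sup>2)
           = (eta z / eta x - 1) / (B z * (phi z)\<^sup>2)"
        by (simp add: power2_eq_square diff_divide_distrib)
      moreover have "(eta z / eta x - 1) / (B z * (phi z)\<^sup>2) \<ge> 0"
        using \<open>eta x \<le> eta z\<close> eta_pos[OF x] B_pos[OF \<open>z > 0\<close>] by auto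
      ultimately show "\<exists>d. (?K has_real_derivative d) (at z) \<and> 0 \<le> d" by metis
    qed
    moreover have "1 / eta x * (1 / phi y) \<ge> 0" using eta_pos[OF x] phi_pos[of y] by auto
    moreover have "1 / (eta x * phi x) = 1 / eta x * (1 / phi x)" by simp
    ultimately show ?thesis by linarith
  next
    case False
    then show ?thesis using Q_mono[of y x] eta_pos[OF x] phi_pos[of x]
      by (auto intro: order.trans[of _ 0])
  qed
qed

text \<open>The tail integral of 1 / (B phi^2) over (x, infinity), as \<open>Q\<close> increases to
  its supremum.\<close>

definition H :: "real \<Rightarrow> real"
  where "H x = (SUP y. Q y) - Q x"

lemma Q_bdd: "bdd_above (range Q)"
  by (rule bdd_aboveI[of _ "Q 1 + 1 / (eta 1 * phi 1)"]) (use Q_increment[of 1] in \<open>auto simp: field_simps\<close>)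

lemma H_nonneg: "H x \<ge> 0"
  unfolding H_def using cSUP_upper[OF _ Q_bdd, of x] by simp

lemma H_le: "x > 0 \<Longrightarrow> H x \<le> 1 / (eta x * phi x)"
proof -
  assume x: "x > 0"
  have "(SUP y. Q y) \<le> Q x + 1 / (eta x * phi x)"
    by (rule cSUP_least) (use Q_increment[OF x] in \<open>auto simp: algebra_simps\<close>)
  then show ?thesis by (simp add: H_def)
qed

lemma H_deriv: "x > 0 \<Longrightarrow> (H has_real_derivative - (1 / (B x * (phi x)\<^sup>2))) (at x)"
  unfolding H_def by (rule DERIV_diff[OF DERIV_const Q_deriv, THEN DERIV_cong]) auto

lemma continuous_H: "continuous_on UNIV H"
  unfolding H_def by (intro continuous_intros continuous_Q)

definition psi :: "real \<Rightarrow> real"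
  where "psi x = phi x * H x"

text \<open>The quasi-derivative B psi'. Its limit at 0 is -1 and not 0, so \<open>psi\<close>
  violates the Neumann condition, and together with phi(0) = 1 this normalizes the Wronskian to
  1.\<close>

definition chi :: "real \<Rightarrow> real"
  where "chi x = eta x * H x - 1 / phi x"

lemma continuous_psi: "continuous_on UNIV psi"
  unfolding psi_def by (intro continuous_intros continuous_phi continuous_H)

lemma psi_nonneg: "psi x \<ge> 0"
  unfolding psi_def using phi_pos[of x] H_nonneg[of x] by simp

lemma psi_left: "x \<le> 0 \<Longrightarrow> psi x = psi 0"
  by (simp add: psi_def phi_left H_def Q_left)

lemma chi_nonpos: "x > 0 \<Longrightarrow> chi x \<le> 0"
  using mult_left_mono[OF H_le less_imp_le[OF eta_pos], of x x] eta_pos[of x] phi_pos[of x]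
  by (simp add: chi_def)

lemma psi_deriv: "x > 0 \<Longrightarrow> (psi has_real_derivative chi x / B x) (at x)"
  unfolding psi_def
  by (rule DERIV_mult[OF phi_deriv H_deriv, THEN DERIV_cong])
     (use phi_pos[of x] B_pos[of x] in \<open>auto simp: chi_def field_simps power2_eq_square\<close>)

lemma chi_deriv: "x > 0 \<Longrightarrow> (chi has_real_derivative B x * psi x) (at x)"
  unfolding chi_def
  by (rule DERIV_diff[OF DERIV_mult[OF eta_deriv H_deriv] DERIV_divide[OF DERIV_const phi_deriv], THEN DERIV_cong])
     (use phi_pos[of x] B_pos[of x] in \<open>auto simp: psi_def field_simps power2_eq_square\<close>)

lemma chi_0: "(chi \<longlongrightarrow> -1) (at_right 0)"
proof -
  have "(H \<longlongrightarrow> H 0) (at_right 0)"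
    by (rule continuous_on_at_right_0[OF continuous_on_subset[OF continuous_H]]) simp
  then have "((\<lambda>x. eta x * H x - 1 / phi x) \<longlongrightarrow> 0 * H 0 - 1 / 1) (at_right 0)"
    by (intro tendsto_intros eta_0 phi_lim_0) auto
  then show ?thesis by (simp add: chi_def[abs_def])
qed

lemma wronskian: "x > 0 \<Longrightarrow> psi x * eta x - phi x * chi x = 1"
  using phi_pos[of x] by (simp add: psi_def chi_def algebra_simps)

lemma psi_antimono: "x \<le> y \<Longrightarrow> psi y \<le> psi x"
proof -
  assume xy: "x \<le> y"
  have *: "psi y \<le> psi x" if "0 < x" "x \<le> y" for x
  proof -
    have "- psi x \<le> - psi y"
      by (rule DERIV_nonneg_imp_le_open[of 0 y "\<lambda>x. - psi x" x])
         (use that psi_deriv chi_nonpos B_pos in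
           \<open>auto intro!: exI conjI DERIV_minus divide_nonpos_pos\<close>)
    then show ?thesis by simp
  qed
  consider "0 < x" | "x \<le> 0" "y \<le> 0" | "x \<le> 0" "0 < y" by linarith
  then show ?thesis
  proof cases
    case 3
    have "psi y \<le> psi 0"
    proof (rule tendsto_le[OF _ _ tendsto_const])
      show "(psi \<longlongrightarrow> psi 0) (at_right 0)"
        by (rule continuous_on_at_right_0[OF continuous_on_subset[OF continuous_psi]]) simp
      show "\<forall>\<^sub>F x in at_right 0. psi y \<le> psi x"
        using eventually_at_right_real[OF 3(2)] by eventually_elim (rule *, auto)
    qed simp
    then show ?thesis using psi_left[OF 3(1)] by simp
  qed (use * xy psi_left[of x] psi_left[of y] in auto)
qed

end

section \<open>The weighted measure and the resolvent as an integral operator\<close>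

lemma integral_Ioc_antiderivative:
  fixes f g :: "real \<Rightarrow> real"
  assumes "continuous_on {0<..} f" "\<And>R. set_integrable lborel {0<..R} f"
    and g: "\<And>y. y > 0 \<Longrightarrow> (g has_real_derivative f y) (at y)" "(g \<longlongrightarrow> l) (at_right 0)"
    and "x > 0"
  shows "(LBINT y:{0<..x}. f y) = g x - l"
proof -
  let ?F = "\<lambda>x. LBINT y:{0<..x}. f y"
  have "c * l \<le> c * g x - c * ?F x" for c
  proof (rule limit_at_0_le[where f="\<lambda>x. c * g x - c * ?F x", OF _ \<open>x > 0\<close>])
    fix y :: real assume y: "0 < y"
    have "((\<lambda>x. c * g x - c * ?F x) has_real_derivative c * f y - c * f y) (at y)"
      by (intro DERIV_diff DERIV_cmult g DERIV_integral_Ioc assms y)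
    then show "\<exists>d. ((\<lambda>x. c * g x - c * ?F x) has_real_derivative d) (at y) \<and> 0 \<le> d" by auto
  next
    have "((\<lambda>x. c * g x - c * ?F x) \<longlongrightarrow> c * l - c * 0) (at_right 0)"
      by (intro tendsto_intros g(2) integral_Ioc_tendsto_0 assms)
    then show "((\<lambda>x. c * g x - c * ?F x) \<longlongrightarrow> c * l) (at_right 0)" by simp
  qed
  from this[of 1] this[of "-1"] show ?thesis by simp
qed

context sl_weight
begin

definition weight :: "real \<Rightarrow> real"
  where "weight x = indicator {0<..} x * B x"

lemma weight_measurable [measurable]: "weight \<in> borel_measurable borel"
  using borel_measurable_continuous_on_indicator[OF _ continuous_B] unfolding weight_def by simp

lemma weight_nonneg: "weight x \<ge> 0"
  using B_pos[of x] by (simp add: weight_def indicator_def less_imp_le)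

definition M :: "real measure"
  where "M = density lborel weight"

lemma sets_M [measurable_cong]: "sets M = sets borel"
  by (simp add: M_def)

lemma space_M [simp]: "space M = UNIV"
  by (simp add: M_def)

lemma AE_M_pos: "AE x in M. x > 0"
  unfolding M_def by (subst AE_density) (simp, auto simp: weight_def indicator_def)

lemma sigma_finite_M: "sigma_finite_measure M"
  unfolding M_def by (subst sigma_finite_measure.sigma_finite_iff_density_finite[OF sigma_finite_lborel]) auto

lemma integrable_M_iff:
  fixes f :: "real \<Rightarrow> real"
  assumes "f \<in> borel_measurable borel"
  shows "integrable M f \<longleftrightarrow> set_integrable lborel {0<..} (\<lambda>x. B x * f x)"
  unfolding M_def set_integrable_def using assms
  by (subst integrable_density) (auto simp: weight_nonneg, simp_all add: weight_def mult.assoc)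

lemma integral_M:
  fixes f :: "real \<Rightarrow> real"
  assumes "f \<in> borel_measurable borel"
  shows "integral\<^sup>L M f = (LBINT x:{0<..}. B x * f x)"
  unfolding M_def set_lebesgue_integral_def using assms
  by (subst integral_density) (auto simp: weight_nonneg, simp_all add: weight_def mult.assoc)

lemma set_integrable_B:
  assumes "continuous_on UNIV f"
  shows "set_integrable lborel {0<..R} (\<lambda>y. B y * f y)"
proof (cases "R > 0")
  case True
  have "compact (f ` {0..R})"
    by (rule compact_continuous_image) (auto intro: continuous_on_subset[OF assms])
  then obtain C where C: "\<And>y. 0 \<le> y \<Longrightarrow> y \<le> R \<Longrightarrow> \<bar>f y\<bar> \<le> C"
    by (force dest!: compact_imp_bounded simp: bounded_iff)
  show ?thesis
  proof (rule set_integrable_Ioc_bounded)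
    show "continuous_on {0<..} (\<lambda>y. B y * f y)"
      by (intro continuous_intros continuous_B continuous_on_subset[OF assms]) auto
    show "\<bar>B x * f x\<bar> \<le> B R * C" if "0 < x" "x \<le> R" for x
      unfolding abs_mult using B_mono[OF that] B_pos[of x] B_pos[of R] that C[of x]
      by (intro mult_mono) auto
  qed
qed (simp add: set_integrable_def)

lemma continuous_B_mult:
  assumes "continuous_on UNIV f"
  shows "continuous_on {0<..} (\<lambda>y. B y * f y)"
  by (intro continuous_intros continuous_B continuous_on_subset[OF assms]) auto

end

context sl_green
begin

lemma continuous_measurable: "continuous_on UNIV f \<Longrightarrow> f \<in> borel_measurable borel"
  for f :: "real \<Rightarrow> real"
  by (rule borel_measurable_continuous_onI)

lemma integral_B_psi: "x > 0 \<Longrightarrow> (LBINT y:{0<..x}. B y * psi y) = chi x + 1"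
  using integral_Ioc_antiderivative[OF continuous_B_mult[OF continuous_psi]
      set_integrable_B[OF continuous_psi] chi_deriv chi_0] by simp

lemma integral_B_phi: "x > 0 \<Longrightarrow> (LBINT y:{0<..x}. B y * phi y) = eta x"
  using integral_Ioc_antiderivative[OF continuous_B_mult[OF continuous_phi]
      set_integrable_B[OF continuous_phi] eta_deriv eta_0] by simp

text \<open>\<open>chi\<close> is an antiderivative of B psi that starts at -1 and never exceeds 0,
  so the integral is at most 1.\<close>

lemma integrable_psi: "integrable M psi"
  and integral_psi_le: "integral\<^sup>L M psi \<le> 1"
proof -
  have nn: "0 \<le> B x * psi x" if "x > 0" for x
    using B_pos[OF that] psi_nonneg[of x] by simp
  have le: "(LBINT y:{0<..R}. B y * psi y) \<le> 1" for R
  proof (cases "R > 0")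
    case True
    then show ?thesis using chi_nonpos by (simp add: integral_B_psi)
  qed (simp add: set_lebesgue_integral_def)
  note * = set_integrable_Ioi_bounded[OF continuous_B_mult[OF continuous_psi]
      set_integrable_B[OF continuous_psi] nn le]
  show "integrable M psi" "integral\<^sup>L M psi \<le> 1"
    using * continuous_measurable[OF continuous_psi] by (auto simp: integrable_M_iff integral_M)
qed

text \<open>The textbook Green's function of 1 - L; the Wronskian by which one divides is 1.\<close>

definition G :: "real \<Rightarrow> real \<Rightarrow> real"
  where "G x y = phi (min x y) * psi (max x y)"

lemma G_commute: "G x y = G y x"
  by (simp add: G_def min.commute max.commute)

lemma continuous_G: "continuous_on UNIV (\<lambda>(x, y). G x y)"
  unfolding G_def case_prod_beta
  by (intro continuous_intros continuous_on_compose2[OF continuous_phi]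
      continuous_on_compose2[OF continuous_psi]) auto

lemma G_measurable [measurable]: "(\<lambda>(x, y). G x y) \<in> borel_measurable (borel \<Otimes>\<^sub>M borel)"
  unfolding borel_prod by (rule borel_measurable_continuous_onI[OF continuous_G])

lemma continuous_G_right: "continuous_on UNIV (G x)"
  unfolding G_def
  by (intro continuous_intros continuous_on_compose2[OF continuous_phi]
      continuous_on_compose2[OF continuous_psi]) auto

lemma G_nonneg: "G x y \<ge> 0"
  using phi_pos[of "min x y"] psi_nonneg[of "max x y"] by (simp add: G_def)

lemma G_le: "G x y \<le> phi x * psi y"
  using phi_pos psi_nonneg unfolding G_def
  by (intro mult_mono phi_mono psi_antimono) (auto simp: less_imp_le)

lemma G_le_const: "x \<le> R \<Longrightarrow> G x y \<le> phi R * psi 0"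
proof -
  assume "x \<le> R"
  moreover have "psi y \<le> psi 0"
    using psi_antimono[of 0 y] psi_left[of y] by (cases "y \<ge> 0") auto
  ultimately have "phi x * psi y \<le> phi R * psi 0"
    using phi_pos psi_nonneg by (intro mult_mono phi_mono) (auto simp: less_imp_le)
  with G_le[of x y] show ?thesis by simp
qed

lemma integrable_G_mult:
  assumes "f \<in> borel_measurable borel" "\<And>y. \<bar>f y\<bar> \<le> C"
  shows "integrable M (\<lambda>y. G x y * f y)"
proof (rule Bochner_Integration.integrable_bound)
  show "integrable M (\<lambda>y. phi x * C * psi y)" by (intro integrable_mult_right integrable_psi)
  have [measurable]: "G x \<in> borel_measurable borel"
    by (rule continuous_measurable[OF continuous_G_right])
  note assms(1)[measurable]
  show "(\<lambda>y. G x y * f y) \<in> borel_measurable M" by measurable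
  have "\<bar>G x y * f y\<bar> \<le> phi x * psi y * C" for y
    unfolding abs_mult using G_le[of x y] G_nonneg[of x y] assms(2)[of y] phi_pos[of x] psi_nonneg[of y]
    by (intro mult_mono) (auto simp: less_imp_le)
  then show "AE y in M. norm (G x y * f y) \<le> norm (phi x * C * psi y)"
    by (intro AE_I2) (metis abs_ge_self mult.assoc mult.commute order.trans real_norm_def)
qed

text \<open>The part over (x, infinity) is written as the full integral minus the head, so that x
  enters only through integrals over (0, x] and \<open>DERIV_integral_Ioc\<close> applies.\<close>

lemma green_split:
  assumes f: "continuous_on UNIV f" "\<And>y. \<bar>f y\<bar> \<le> C" and x: "x \<ge> 0"
  shows "(\<integral>y. G x y * f y \<partial>M) = psi x * (LBINT y:{0<..x}. B y * (phi y * f y))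
     + phi x * ((\<integral>y. psi y * f y \<partial>M) - (LBINT y:{0<..x}. B y * (psi y * f y)))"
proof -
  have mf: "f \<in> borel_measurable borel" by (rule continuous_measurable[OF f(1)])
  have cGf: "continuous_on UNIV (\<lambda>y. G x y * f y)" and cpf: "continuous_on UNIV (\<lambda>y. psi y * f y)"
    by (intro continuous_intros continuous_G_right continuous_psi f)+
  have i1: "set_integrable lborel {0<..} (\<lambda>y. B y * (G x y * f y))"
    using integrable_G_mult[OF mf f(2), of x] integrable_M_iff[OF continuous_measurable[OF cGf]] by simp
  \<comment> \<open>As phi = 1 at 0, \<open>psi\<close> is the section of \<open>G\<close> at x = 0,
    so its integrability against f is an instance of \<open>integrable_G_mult\<close>.\<close>
  have G0: "G 0 y * f y = psi y * f y" if "y > 0" for y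
    using that by (simp add: G_def phi_left)
  have i2: "set_integrable lborel {0<..} (\<lambda>y. B y * (psi y * f y))"
  proof -
    have "continuous_on UNIV (\<lambda>y. G 0 y * f y)" by (intro continuous_intros continuous_G_right f)
    from integrable_M_iff[OF continuous_measurable[OF this]] integrable_G_mult[OF mf f(2), of 0]
    have "set_integrable lborel {0<..} (\<lambda>y. B y * (G 0 y * f y))" by simp
    then show ?thesis
      by (rule set_integrable_cong[THEN iffD1, rotated -1]) (simp_all add: G0)
  qed
  have U: "{0<..} = {0<..x} \<union> {x<..}" using x by auto
  have un: "(LBINT y:{0<..}. g y) = (LBINT y:{0<..x}. g y) + (LBINT y:{x<..}. g y)"
    if "set_integrable lborel {0<..} g" for g :: "real \<Rightarrow> real"
    unfolding U using x
    by (intro set_integral_Un) (auto intro: set_integrable_subset[OF that])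
  have "(\<integral>y. G x y * f y \<partial>M) = (LBINT y:{0<..x}. B y * (G x y * f y)) + (LBINT y:{x<..}. B y * (G x y * f y))"
    unfolding integral_M[OF continuous_measurable[OF cGf]] by (rule un[OF i1])
  also have "(LBINT y:{0<..x}. B y * (G x y * f y)) = (LBINT y:{0<..x}. psi x * (B y * (phi y * f y)))"
    by (rule set_lebesgue_integral_cong) (auto simp: G_def min_def max_def)
  also have "(LBINT y:{x<..}. B y * (G x y * f y)) = (LBINT y:{x<..}. phi x * (B y * (psi y * f y)))"
    by (rule set_lebesgue_integral_cong) (auto simp: G_def)
  finally show ?thesis
    unfolding integral_M[OF continuous_measurable[OF cpf]] un[OF i2] by simp
qed

lemma green_left:
  assumes "f \<in> borel_measurable borel"
  shows "(\<integral>y. G x y * f y \<partial>M) = (\<integral>y. G (max 0 x) y * f y \<partial>M)"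
proof (rule integral_cong_AE)
  have [measurable]: "G x \<in> borel_measurable borel" for x
    by (rule continuous_measurable[OF continuous_G_right])
  note assms [measurable]
  show "(\<lambda>y. G x y * f y) \<in> borel_measurable M" "(\<lambda>y. G (max 0 x) y * f y) \<in> borel_measurable M"
    by measurable
  show "AE y in M. G x y * f y = G (max 0 x) y * f y"
    using AE_M_pos by eventually_elim (auto simp: G_def max_def min_def phi_left)
qed

text \<open>By \<open>green_split\<close> the integral is the Wronskian plus \<open>phi x\<close>
  times (the integral of psi minus 1), and the latter is nonpositive. Thus T is a contraction in the
  sup norm (\<open>green_bound\<close>).\<close>

lemma integral_G_le: "(\<integral>y. G x y \<partial>M) \<le> 1"
proof -
  have "(\<integral>y. G x y * 1 \<partial>M) \<le> 1" if x: "x > 0" for x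
  proof -
    have "(\<integral>y. G x y * 1 \<partial>M) = psi x * eta x + phi x * (integral\<^sup>L M psi - (chi x + 1))"
      using green_split[of "\<lambda>_. 1" 1 x] x by (simp add: integral_B_phi integral_B_psi)
    also have "\<dots> \<le> psi x * eta x + phi x * (- chi x)"
      using integral_psi_le phi_pos[of x] by (intro add_left_mono mult_left_mono) auto
    finally show ?thesis using wronskian[OF x] by simp
  qed
  moreover have "(\<integral>y. G 0 y * 1 \<partial>M) \<le> 1"
    using green_split[of "\<lambda>_. 1" 1 0] integral_psi_le by (simp add: phi_left set_lebesgue_integral_def)
  ultimately show ?thesis
    using green_left[of "\<lambda>_. 1" x] by (cases "x > 0") (auto simp: max_def)
qed

lemma green_bound:
  assumes "f \<in> borel_measurable borel" "\<And>y. \<bar>f y\<bar> \<le> C"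
  shows "\<bar>\<integral>y. G x y * f y \<partial>M\<bar> \<le> C"
proof -
  have "C \<ge> 0" using assms(2)[of 0] by simp
  have i: "integrable M (\<lambda>y. G x y)" using integrable_G_mult[of "\<lambda>_. 1" 1 x] by simp
  have "\<bar>\<integral>y. G x y * f y \<partial>M\<bar> \<le> (\<integral>y. \<bar>G x y * f y\<bar> \<partial>M)" by (rule integral_abs_bound)
  also have "\<dots> \<le> (\<integral>y. G x y * C \<partial>M)"
    using assms(2) G_nonneg
    by (intro integral_mono integrable_abs integrable_G_mult[OF assms] integrable_mult_left i)
       (auto simp: abs_mult intro!: mult_left_mono)
  also have "\<dots> \<le> 1 * C"
    using mult_right_mono[OF integral_G_le[of x] \<open>C \<ge> 0\<close>] by simp
  finally show ?thesis by simp
qed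

text \<open>Variation of constants. In u' the terms with a' and b' cancel; in the derivative of the
  quasi-derivative chi a + eta (P - b) they combine to -B f times the Wronskian.\<close>

lemma green_neumann:
  assumes f: "continuous_on UNIV f" "\<And>y. \<bar>f y\<bar> \<le> C"
  defines "u \<equiv> \<lambda>x. \<integral>y. G x y * f y \<partial>M"
  shows "neumann B u (\<lambda>x. u x - f x)"
proof -
  define a where "a = (\<lambda>x. LBINT y:{0<..x}. B y * (phi y * f y))"
  define b where "b = (\<lambda>x. LBINT y:{0<..x}. B y * (psi y * f y))"
  define P where "P = (\<integral>y. psi y * f y \<partial>M)"
  have u: "u x = psi x * a x + phi x * (P - b x)" if "x \<ge> 0" for x
    unfolding u_def a_def b_def P_def by (rule green_split[OF f that])
  have c1: "continuous_on UNIV (\<lambda>y. phi y * f y)" and c2: "continuous_on UNIV (\<lambda>y. psi y * f y)"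
    by (intro continuous_intros continuous_phi continuous_psi f)+
  note A = continuous_B_mult[OF c1] set_integrable_B[OF c1]
  note B = continuous_B_mult[OF c2] set_integrable_B[OF c2]
  have da: "(a has_real_derivative B x * (phi x * f x)) (at x)" if "x > 0" for x
    unfolding a_def by (rule DERIV_integral_Ioc[OF A that])
  have db: "(b has_real_derivative B x * (psi x * f x)) (at x)" if "x > 0" for x
    unfolding b_def by (rule DERIV_integral_Ioc[OF B that])
  have ca: "continuous_on UNIV a" unfolding a_def by (rule continuous_integral_Ioc[OF A])
  have cb: "continuous_on UNIV b" unfolding b_def by (rule continuous_integral_Ioc[OF B])
  have ta: "(a \<longlongrightarrow> 0) (at_right 0)" unfolding a_def by (rule integral_Ioc_tendsto_0[OF A])
  have tb: "(b \<longlongrightarrow> 0) (at_right 0)" unfolding b_def by (rule integral_Ioc_tendsto_0[OF B])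
  show ?thesis
  proof (rule neumannI[where r="\<lambda>x. chi x * a x + eta x * (P - b x)"])
    have "continuous_on UNIV (\<lambda>x. psi x * a x + phi x * (P - b x))"
      by (intro continuous_intros continuous_phi continuous_psi ca cb)
    then have "continuous_on {0..} (\<lambda>x. psi x * a x + phi x * (P - b x))"
      by (rule continuous_on_subset) auto
    then show "continuous_on {0..} u" by (rule continuous_on_eq) (auto simp: u)
  next
    fix x :: real assume x: "x > 0"
    have Bx: "B x > 0" by (rule B_pos[OF x])
    have "((\<lambda>x. psi x * a x + phi x * (P - b x)) has_real_derivative
         (chi x / B x) * a x + (B x * (phi x * f x)) * psi x
         + ((eta x / B x) * (P - b x) + (0 - B x * (psi x * f x)) * phi x)) (at x)"
      by (intro DERIV_add DERIV_mult DERIV_diff DERIV_const psi_deriv phi_deriv da db x)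
    then have "((\<lambda>x. psi x * a x + phi x * (P - b x)) has_real_derivative
         (chi x * a x + eta x * (P - b x)) / B x) (at x)"
      by (rule DERIV_cong) (simp add: add_divide_distrib diff_divide_distrib algebra_simps)
    then show "(u has_real_derivative (chi x * a x + eta x * (P - b x)) / B x) (at x)"
      by (rule has_field_derivative_transform_within_open[of _ _ _ "{0<..}"]) (use x u in auto)
    have "((\<lambda>x. chi x * a x + eta x * (P - b x)) has_real_derivative
         (B x * psi x) * a x + (B x * (phi x * f x)) * chi x
         + ((B x * phi x) * (P - b x) + (0 - B x * (psi x * f x)) * eta x)) (at x)"
      by (intro DERIV_add DERIV_mult DERIV_diff DERIV_const chi_deriv eta_deriv da db x)
    then show "((\<lambda>x. chi x * a x + eta x * (P - b x)) has_real_derivative B x * (u x - f x)) (at x)"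
    proof (rule DERIV_cong)
      have "(B x * psi x) * a x + (B x * (phi x * f x)) * chi x
         + ((B x * phi x) * (P - b x) + (0 - B x * (psi x * f x)) * eta x)
         = B x * (u x - f x * (psi x * eta x - phi x * chi x))"
        using x by (simp add: u algebra_simps)
      then show "(B x * psi x) * a x + (B x * (phi x * f x)) * chi x
         + ((B x * phi x) * (P - b x) + (0 - B x * (psi x * f x)) * eta x) = B x * (u x - f x)"
        by (simp add: wronskian[OF x])
    qed
  next
    have "((\<lambda>x. chi x * a x + eta x * (P - b x)) \<longlongrightarrow> -1 * 0 + 0 * (P - 0)) (at_right 0)"
      by (intro tendsto_intros chi_0 eta_0 ta tb)
    then show "((\<lambda>x. chi x * a x + eta x * (P - b x)) \<longlongrightarrow> 0) (at_right 0)" by simp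
  qed
qed

lemma bcontfun_bound: "\<bar>apply_bcontfun f y\<bar> \<le> norm f" for f :: "real \<Rightarrow>\<^sub>C real"
  using norm_bounded[of f y] by simp

lemma bcontfun_continuous: "continuous_on UNIV (apply_bcontfun f)" for f :: "real \<Rightarrow>\<^sub>C real"
  using apply_bcontfun[of f] by (simp add: bcontfun_def)

lemma bcontfun_measurable [measurable]: "apply_bcontfun f \<in> borel_measurable borel" for f :: "real \<Rightarrow>\<^sub>C real"
  by (rule continuous_measurable[OF bcontfun_continuous])

text \<open>Bounded continuous functions form the vector space type on which \<open>poly_op\<close>
  acts. Values of \<open>f\<close> at negative arguments are invisible to T, as M is concentrated on
  (0, infinity).\<close>

definition T :: "(real \<Rightarrow>\<^sub>C real) \<Rightarrow> (real \<Rightarrow>\<^sub>C real)"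
  where "T f = Bcontfun (\<lambda>x. \<integral>y. G x y * f y \<partial>M)"

lemma T_apply: "apply_bcontfun (T f) x = (\<integral>y. G x y * f y \<partial>M)"
proof -
  let ?u = "\<lambda>x. \<integral>y. G x y * f y \<partial>M"
  have "continuous_on {0..} ?u"
    using green_neumann[OF bcontfun_continuous bcontfun_bound] unfolding neumann_def by blast
  from continuous_on_max_0[OF this] have "continuous_on UNIV ?u"
    by (rule continuous_on_eq) (rule green_left[symmetric, OF bcontfun_measurable])
  then have "?u \<in> bcontfun"
    by (rule bcontfun_normI) (use green_bound[OF bcontfun_measurable bcontfun_bound] in auto)
  then show ?thesis by (simp add: T_def Bcontfun_inverse)
qed

lemma T_neumann: "neumann B (T f) (\<lambda>x. T f x - f x)"
  unfolding T_apply by (rule green_neumann[OF bcontfun_continuous bcontfun_bound])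

lemma T_0: "T f 0 = (\<integral>y. psi y * f y \<partial>M)"
  using green_split[OF bcontfun_continuous bcontfun_bound, of 0 f]
  by (simp add: T_apply phi_left set_lebesgue_integral_def)

lemma integrable_T: "integrable M (\<lambda>y. G x y * apply_bcontfun f y)"
  by (rule integrable_G_mult[OF bcontfun_measurable bcontfun_bound])

lemma linear_T: "linear T"
proof (rule linearI)
  fix f g :: "real \<Rightarrow>\<^sub>C real" and c :: real
  show "T (f + g) = T f + T g"
    by (rule bcontfun_eqI) (simp add: T_apply plus_bcontfun.rep_eq distrib_left integrable_T)
  show "T (c *\<^sub>R f) = c *\<^sub>R T f"
  proof (rule bcontfun_eqI)
    fix x
    have "T (c *\<^sub>R f) x = (\<integral>y. c * (G x y * f y) \<partial>M)"
      by (simp add: T_apply scaleR_bcontfun.rep_eq mult_ac)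
    then show "T (c *\<^sub>R f) x = (c *\<^sub>R T f) x"
      by (simp add: T_apply scaleR_bcontfun.rep_eq)
  qed
qed

end

section \<open>The resolvent as a symmetric operator between 0 and 1 for the L^2 product\<close>

context sl_green
begin

interpretation M: sigma_finite_measure M by (rule sigma_finite_M)
interpretation MM: pair_sigma_finite M M ..

text \<open>Boundedness together with integrability makes products integrable, so \<open>ip\<close>
  is the L^2 product on \<open>E\<close>.\<close>

definition E :: "(real \<Rightarrow>\<^sub>C real) set"
  where "E = {f. integrable M (apply_bcontfun f)}"

definition ip :: "(real \<Rightarrow>\<^sub>C real) \<Rightarrow> (real \<Rightarrow>\<^sub>C real) \<Rightarrow> real"
  where "ip f g = (\<integral>x. f x * g x \<partial>M)"

lemma integrable_ip: "f \<in> E \<Longrightarrow> integrable M (\<lambda>x. apply_bcontfun f x * apply_bcontfun g x)"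
proof -
  assume f: "f \<in> E"
  show ?thesis
  proof (rule Bochner_Integration.integrable_bound)
    show "integrable M (\<lambda>x. norm g * \<bar>f x\<bar>)" using f by (auto simp: E_def)
    show "(\<lambda>x. f x * g x) \<in> borel_measurable M" by measurable
    have "\<bar>f x * g x\<bar> \<le> norm g * \<bar>f x\<bar>" for x
      using mult_left_mono[OF bcontfun_bound[of g x], of "\<bar>f x\<bar>"] by (simp add: abs_mult mult.commute)
    then show "AE x in M. norm (f x * g x) \<le> norm (norm g * \<bar>f x\<bar>)" by auto
  qed
qed

text \<open>Integrating first over x gives at most \<open>norm g\<close> by
  \<open>green_bound\<close>, and f is integrable; this is what Fubini asks for.\<close>

lemma integrable_kernel:
  assumes "f \<in> E"
  shows "integrable (M \<Otimes>\<^sub>M M) (\<lambda>(y, x). G x y * apply_bcontfun f y * apply_bcontfun g x)"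
proof -
  have [measurable]: "(\<lambda>(y, x). G x y) \<in> borel_measurable (M \<Otimes>\<^sub>M M)"
    using G_measurable by (simp add: G_commute[of "snd _"] case_prod_beta cong: measurable_cong_sets)
  show ?thesis
  proof (rule MM.Fubini_integrable)
    show [measurable]: "(\<lambda>(y, x). G x y * f y * g x) \<in> borel_measurable (M \<Otimes>\<^sub>M M)"
      by measurable
    have eq: "(\<integral>x. norm (case (y, x) of (y, x) \<Rightarrow> G x y * f y * g x) \<partial>M)
        = \<bar>f y\<bar> * (\<integral>x. G y x * \<bar>g x\<bar> \<partial>M)" for y
      by (subst integral_mult_right_zero[symmetric], intro Bochner_Integration.integral_cong)
         (auto simp: abs_mult G_nonneg G_commute[of y])
    have "(\<lambda>y. \<integral>x. norm (case (y, x) of (y, x) \<Rightarrow> G x y * f y * g x) \<partial>M) \<in> borel_measurable M"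
      by measurable
    then show "integrable M (\<lambda>y. \<integral>x. norm (case (y, x) of (y, x) \<Rightarrow> G x y * f y * g x) \<partial>M)"
      unfolding eq
    proof (rule Bochner_Integration.integrable_bound[rotated])
      show "integrable M (\<lambda>y. \<bar>f y\<bar> * norm g)" using assms by (auto simp: E_def)
      have "\<bar>\<integral>x. G y x * \<bar>g x\<bar> \<partial>M\<bar> \<le> norm g" for y
        by (rule green_bound) (auto intro: bcontfun_bound)
      then show "AE y in M. norm (\<bar>f y\<bar> * (\<integral>x. G y x * \<bar>g x\<bar> \<partial>M)) \<le> norm (\<bar>f y\<bar> * norm g)"
        by (auto simp: abs_mult intro!: mult_left_mono)
    qed
    have "integrable M (\<lambda>x. f y * (G y x * g x))" for y
      by (intro integrable_mult_right integrable_T)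
    then show "AE y in M. integrable M (\<lambda>x. case (y, x) of (y, x) \<Rightarrow> G x y * f y * g x)"
      by (simp add: G_commute mult_ac)
  qed
qed

lemma T_E: "f \<in> E \<Longrightarrow> T f \<in> E"
proof -
  assume f: "f \<in> E"
  define g :: "real \<Rightarrow>\<^sub>C real" where "g = const_bcontfun 1"
  have "integrable M (\<lambda>x. \<integral>y. G x y * f y * g x \<partial>M)"
    using MM.integrable_snd[OF integrable_kernel[OF f, of g]] .
  then show ?thesis
    by (simp add: E_def T_apply[abs_def] g_def const_bcontfun.rep_eq)
qed

lemma T_symmetric:
  assumes "f \<in> E" "g \<in> E"
  shows "ip (T f) g = ip f (T g)"
proof -
  have "ip (T f) g = (\<integral>x. \<integral>y. G x y * f y * g x \<partial>M \<partial>M)"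
    by (simp add: ip_def T_apply)
  also have "\<dots> = (\<integral>y. \<integral>x. G x y * f y * g x \<partial>M \<partial>M)"
    using MM.Fubini_integral[OF integrable_kernel[OF assms(1), of g]] by simp
  also have "\<dots> = (\<integral>y. f y * (\<integral>x. G y x * g x \<partial>M) \<partial>M)"
    by (subst integral_mult_right_zero[symmetric]) (simp add: G_commute mult_ac)
  finally show ?thesis by (simp add: ip_def T_apply)
qed

text \<open>Since \<open>B\<close> is nondecreasing, \<open>M\<close> has infinite mass near infinity.\<close>

lemma E_not_increasing:
  assumes "u \<in> E" "z0 > 0" "apply_bcontfun u z0 \<noteq> 0"
    and mono: "\<And>z. z \<ge> z0 \<Longrightarrow> (apply_bcontfun u z0)\<^sup>2 \<le> (apply_bcontfun u z)\<^sup>2"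
  shows False
proof -
  define k where "k = (u z0)\<^sup>2"
  have k: "k > 0" using assms(3) by (simp add: k_def)
  have m: "(\<lambda>x. (u x)\<^sup>2) \<in> borel_measurable borel" by measurable
  have int: "set_integrable lborel {0<..} (\<lambda>x. B x * (u x)\<^sup>2)"
    using integrable_ip[OF assms(1), of u] integrable_M_iff[OF m] by (simp add: power2_eq_square)
  have le: "k * B z0 * real n \<le> (LBINT x:{0<..}. B x * (u x)\<^sup>2)" for n
  proof -
    have fin: "integrable lborel (\<lambda>x. indicator {z0..z0 + real n} x *\<^sub>R (k * B z0))"
      by (intro integrable_mult_left integrable_scaleR_left) auto
    have "k * B z0 * real n = (\<integral>x. indicator {z0..z0 + real n} x *\<^sub>R (k * B z0) \<partial>lborel)"
      by (subst integral_scaleR_left) auto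
    also have "\<dots> \<le> (\<integral>x. indicator {0<..} x *\<^sub>R (B x * (u x)\<^sup>2) \<partial>lborel)"
    proof (rule integral_mono[OF fin])
      show "integrable lborel (\<lambda>x. indicator {0<..} x *\<^sub>R (B x * (u x)\<^sup>2))"
        using int by (simp add: set_integrable_def)
      fix x :: real
      have "k * B z0 \<le> (u x)\<^sup>2 * B x" if "x \<ge> z0"
        using B_mono[OF assms(2) that] mono[OF that] B_pos[OF assms(2)] k
        by (intro mult_mono) (auto simp: k_def)
      moreover have "0 \<le> B x * (u x)\<^sup>2" if "x > 0" using B_pos[OF that] by simp
      ultimately show "indicator {z0..z0 + real n} x *\<^sub>R (k * B z0) \<le> indicator {0<..} x *\<^sub>R (B x * (u x)\<^sup>2)"
        using assms(2) by (auto simp: indicator_def mult.commute)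
    qed
    finally show ?thesis by (simp add: set_lebesgue_integral_def)
  qed
  have "k * B z0 > 0" using k B_pos[OF assms(2)] by simp
  then obtain n where "(LBINT x:{0<..}. B x * (u x)\<^sup>2) < real n * (k * B z0)"
    using reals_Archimedean3 by blast
  with le[of n] show False by (simp add: mult_ac)
qed

text \<open>Here f - u = - L u, and integration by parts gives the integral of r^2 / B minus the
  boundary term u r, whose decay at infinity is unknown. If the form were negative, u r would
  eventually be positive, so u^2 would be nondecreasing from some point on, contrary to
  \<open>E_not_increasing\<close>.\<close>

lemma energy:
  assumes "u \<in> E" "f \<in> E" and n: "neumann B u (\<lambda>x. apply_bcontfun u x - apply_bcontfun f x)"
  shows "ip (f - u) u \<ge> 0"
proof -
  from n obtain r where r: "continuous_on {0..} u"
    "\<And>x. x > 0 \<Longrightarrow> (u has_real_derivative r x / B x) (at x)"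
    "\<And>x. x > 0 \<Longrightarrow> (r has_real_derivative B x * (u x - f x)) (at x)"
    "(r \<longlongrightarrow> 0) (at_right 0)" unfolding neumann_def by blast
  define g where "g = (\<lambda>x. (f x - u x) * u x)"
  have cg: "continuous_on UNIV g" unfolding g_def by (intro continuous_intros bcontfun_continuous)
  have "integrable M g"
    unfolding g_def using integrable_ip[OF assms(2), of u] integrable_ip[OF assms(1), of u]
    by (simp add: left_diff_distrib)
  then have gint: "set_integrable lborel {0<..} (\<lambda>x. B x * g x)"
    using integrable_M_iff[OF continuous_measurable[OF cg]] by simp
  have ip: "ip (f - u) u = (LBINT x:{0<..}. B x * g x)"
    unfolding ip_def using integral_M[OF continuous_measurable[OF cg]]
    by (simp add: g_def minus_bcontfun.rep_eq)
  define I where "I = (\<lambda>z. LBINT x:{0<..z}. B x * g x)"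
  have Ider: "(I has_real_derivative B z * g z) (at z)" if "z > 0" for z
    unfolding I_def by (rule DERIV_integral_Ioc[OF continuous_B_mult[OF cg] set_integrable_B[OF cg] that])
  have I0: "(I \<longlongrightarrow> 0) (at_right 0)"
    unfolding I_def by (rule integral_Ioc_tendsto_0[OF continuous_B_mult[OF cg] set_integrable_B[OF cg]])
  have K: "0 \<le> I z + u z * r z" if "z > 0" for z
  proof (rule limit_at_0_le[where f="\<lambda>z. I z + u z * r z", OF _ that])
    fix y :: real assume y: "0 < y"
    have "((\<lambda>z. I z + u z * r z) has_real_derivative
       B y * g y + ((r y / B y) * r y + (B y * (u y - f y)) * u y)) (at y)"
      by (intro DERIV_add DERIV_mult Ider r y)
    moreover have "B y * g y + ((r y / B y) * r y + (B y * (u y - f y)) * u y) = (r y)\<^sup>2 / B y"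
      by (simp add: g_def algebra_simps power2_eq_square)
    ultimately show "\<exists>d. ((\<lambda>z. I z + u z * r z) has_real_derivative d) (at y) \<and> 0 \<le> d"
      using B_pos[OF y] by (metis divide_nonneg_pos zero_le_power2)
  next
    show "((\<lambda>z. I z + u z * r z) \<longlongrightarrow> 0) (at_right 0)"
      using tendsto_add[OF I0 tendsto_mult[OF continuous_on_at_right_0[OF r(1)] r(4)]] by simp
  qed
  show ?thesis
  proof (rule ccontr)
    assume neg: "\<not> 0 \<le> ip (f - u) u"
    have "(I \<longlongrightarrow> ip (f - u) u) at_top"
      unfolding I_def ip set_lebesgue_integral_def
    proof (rule integral_dominated_convergence_at_top[where w="\<lambda>x. norm (indicator {0<..} x *\<^sub>R (B x * g x))"])
      show "integrable lborel (\<lambda>x. norm (indicator {0<..} x *\<^sub>R (B x * g x)))"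
        using gint by (simp add: set_integrable_def)
      show "(\<lambda>x. indicator {0<..t} x *\<^sub>R (B x * g x)) \<in> borel_measurable lborel" for t
        using set_integrable_B[OF cg, of t] by (auto simp: set_integrable_def)
      show "(\<lambda>x. indicator {0<..} x *\<^sub>R (B x * g x)) \<in> borel_measurable lborel"
        using gint by (auto simp: set_integrable_def)
      show "AE x in lborel. ((\<lambda>t. indicator {0<..t} x *\<^sub>R (B x * g x)) \<longlongrightarrow> indicator {0<..} x *\<^sub>R (B x * g x)) at_top"
      proof (intro AE_I2 tendsto_eventually)
        fix x :: real
        show "\<forall>\<^sub>F t in at_top. indicator {0<..t} x *\<^sub>R (B x * g x) = indicator {0<..} x *\<^sub>R (B x * g x)"
          using eventually_ge_at_top[of x] by eventually_elim (auto simp: indicator_def)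
      qed
    qed (auto simp: indicator_def)
    then have "\<forall>\<^sub>F z in at_top. I z < 0"
      using neg by (intro order_tendstoD(2)[where a=0]) auto
    then obtain z1 where z1: "\<And>z. z \<ge> z1 \<Longrightarrow> I z < 0" by (auto simp: eventually_at_top_linorder)
    define z0 where "z0 = max z1 1"
    have ur: "u z * r z > 0" if "z \<ge> z0" for z
      using K[of z] z1[of z] that by (auto simp: z0_def)
    show False
    proof (rule E_not_increasing[OF assms(1), of z0])
      show "z0 > 0" by (simp add: z0_def)
      show "u z0 \<noteq> 0" using ur[of z0] by auto
      fix z assume "z \<ge> z0"
      then show "(u z0)\<^sup>2 \<le> (u z)\<^sup>2"
      proof (rule DERIV_nonneg_imp_nondecreasing[where f="\<lambda>z. (u z)\<^sup>2"])
        fix y assume y: "z0 \<le> y"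
        then have "y > 0" by (simp add: z0_def)
        have "2 * (r y / B y * u y) = 2 * (u y * r y) / B y" by simp
        also have "\<dots> \<ge> 0" using ur[OF y] B_pos[OF \<open>y > 0\<close>] by simp
        finally show "\<exists>d. ((\<lambda>z. (u z)\<^sup>2) has_real_derivative d) (at y) \<and> 0 \<le> d"
          using DERIV_power[OF r(2)[OF \<open>y > 0\<close>], of 2] by auto
      qed
    qed
  qed
qed

text \<open>For L d = d the product d r starts at 0 and has derivative r^2 / B + B d^2 >= 0, so d^2
  is nondecreasing. In \<open>E\<close> this forces d = 0, which rules out the multiples of
  \<open>phi\<close>.\<close>

lemma neumann_E_unique:
  assumes "d \<in> E" and n: "neumann B d (apply_bcontfun d)" and "x \<ge> 0"
  shows "apply_bcontfun d x = 0"
proof -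
  from n obtain r where r: "continuous_on {0..} d"
    "\<And>x. x > 0 \<Longrightarrow> (d has_real_derivative r x / B x) (at x)"
    "\<And>x. x > 0 \<Longrightarrow> (r has_real_derivative B x * d x) (at x)"
    "(r \<longlongrightarrow> 0) (at_right 0)" unfolding neumann_def by blast
  have dr: "0 \<le> d z * r z" if "z > 0" for z
  proof (rule limit_at_0_le[where f="\<lambda>z. d z * r z", OF _ that])
    fix y :: real assume y: "0 < y"
    have "((\<lambda>z. d z * r z) has_real_derivative (r y / B y) * r y + (B y * d y) * d y) (at y)"
      by (intro DERIV_mult r y)
    moreover have "(r y / B y) * r y + (B y * d y) * d y = (r y)\<^sup>2 / B y + B y * (d y)\<^sup>2"
      by (simp add: power2_eq_square)
    moreover have "(r y)\<^sup>2 / B y + B y * (d y)\<^sup>2 \<ge> 0" using B_pos[OF y] by simp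
    ultimately show "\<exists>d'. ((\<lambda>z. d z * r z) has_real_derivative d') (at y) \<and> 0 \<le> d'" by metis
  next
    show "((\<lambda>z. d z * r z) \<longlongrightarrow> 0) (at_right 0)"
      using tendsto_mult[OF continuous_on_at_right_0[OF r(1)] r(4)] by simp
  qed
  have zero: "d z0 = 0" if z0: "z0 > 0" for z0
  proof (rule ccontr)
    assume "d z0 \<noteq> 0"
    show False
    proof (rule E_not_increasing[OF assms(1) z0 \<open>d z0 \<noteq> 0\<close>])
      fix z assume "z \<ge> z0"
      then show "(d z0)\<^sup>2 \<le> (d z)\<^sup>2"
      proof (rule DERIV_nonneg_imp_nondecreasing[where f="\<lambda>z. (d z)\<^sup>2"])
        fix y assume y: "z0 \<le> y"
        then have "y > 0" using z0 by simp
        have "2 * (r y / B y * d y) = 2 * (d y * r y) / B y" by simp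
        also have "\<dots> \<ge> 0" using dr[OF \<open>y > 0\<close>] B_pos[OF \<open>y > 0\<close>] by simp
        finally show "\<exists>d'. ((\<lambda>z. (d z)\<^sup>2) has_real_derivative d') (at y) \<and> 0 \<le> d'"
          using DERIV_power[OF r(2)[OF \<open>y > 0\<close>], of 2] by auto
      qed
    qed
  qed
  have "(d \<longlongrightarrow> 0) (at_right 0)"
    by (rule tendsto_eventually) (auto simp: eventually_at_filter zero)
  then have "d 0 = 0"
    using tendsto_unique[OF _ continuous_on_at_right_0[OF r(1)]] by simp
  then show ?thesis using zero \<open>x \<ge> 0\<close> by (cases "x = 0") auto
qed

lemma E_subspace: "subspace E"
  unfolding subspace_def E_def
  by (auto simp: zero_bcontfun.rep_eq plus_bcontfun.rep_eq scaleR_bcontfun.rep_eq)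

lemma T_unique:
  assumes "u \<in> E" "f \<in> E" "neumann B u (\<lambda>x. apply_bcontfun u x - apply_bcontfun f x)" "x \<ge> 0"
  shows "T f x = apply_bcontfun u x"
proof -
  have d: "u - T f \<in> E" using E_subspace assms(1) T_E[OF assms(2)] by (rule subspace_diff)
  have "neumann B (\<lambda>x. u x - T f x) (\<lambda>x. (u x - f x) - (T f x - f x))"
    by (rule neumann_diff[OF assms(3) T_neumann])
  then have "neumann B (u - T f) (apply_bcontfun (u - T f))"
    by (rule neumann_cong) (auto simp: minus_bcontfun.rep_eq)
  from neumann_E_unique[OF d this assms(4)] show ?thesis by (simp add: minus_bcontfun.rep_eq)
qed

sublocale op: symmetric_contraction T E ip
proof (rule symmetric_contraction.intro)
  fix f g h :: "real \<Rightarrow>\<^sub>C real" and c :: real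
  show "linear T" by (rule linear_T)
  show "subspace E" by (rule E_subspace)
  show ip_add: "ip (f + g) h = ip f h + ip g h" if "f \<in> E" "g \<in> E" "h \<in> E" for f g h
    using that integrable_ip by (simp add: ip_def plus_bcontfun.rep_eq distrib_right)
  show ip_scale: "ip (c *\<^sub>R f) h = c * ip f h" if "f \<in> E" "h \<in> E" for f h c
    by (simp add: ip_def scaleR_bcontfun.rep_eq mult.assoc)
  show ip_commute: "ip f g = ip g f" for f g by (simp add: ip_def mult.commute)
  show nn: "0 \<le> ip f f" for f by (simp add: ip_def)
  show "ip (T f) g = ip f (T g)" if "f \<in> E" "g \<in> E" using that by (rule T_symmetric)
  assume f: "f \<in> E"
  then show Tf: "T f \<in> E" by (rule T_E)
  have d: "f - T f \<in> E" using E_subspace f Tf by (rule subspace_diff)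
  \<comment> \<open>Both bounds on T come from this: adding \<open>ip (T f) (T f)\<close> gives T >=
    0, adding \<open>ip (f - T f) (f - T f)\<close> gives T <= 1.\<close>
  have e: "0 \<le> ip (f - T f) (T f)" using energy[OF Tf f T_neumann] .
  have *: "ip f h = ip (f - T f) h + ip (T f) h" if "h \<in> E" for h
    using ip_add[OF d Tf that] by simp
  show "0 \<le> ip (T f) f"
    using *[OF Tf] e nn[of "T f"] ip_commute[of f "T f"] by linarith
  show "ip (T f) f \<le> ip f f"
    using *[OF f] *[OF d] nn[of "f - T f"] e ip_commute[of "f - T f" f] ip_commute[of "T f" "f - T f"]
    by linarith
qed

end

section \<open>Spectral approximation\<close>

text \<open>With s = (1 - t)^m the error t (1 - (1 - s)^m) is at most t, and by Bernoulli at most m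
  s. The first bound serves for t <= d, the second for t > d because m (1 - d)^m tends to 0. The
  minimum in d keeps 1 - d in [0, 1).\<close>

lemma cutoff_limit:
  assumes "e > (0::real)"
  shows "\<forall>\<^sub>F m in sequentially. \<forall>t\<in>{0..1}. \<bar>t - t * (1 - (1 - t) ^ m) ^ m\<bar> \<le> e"
proof -
  define d where "d = min e 1"
  have "(\<lambda>m. of_nat m * (1 - d) ^ m) \<longlonglongrightarrow> 0"
    by (rule powser_times_n_limit_0) (use assms in \<open>auto simp: d_def min_def\<close>)
  then have "\<forall>\<^sub>F m in sequentially. of_nat m * (1 - d) ^ m < e"
    using assms by (rule order_tendstoD)
  then show ?thesis
  proof eventually_elim
    case (elim m)
    show ?case
    proof
      fix t :: real assume t: "t \<in> {0..1}"
      let ?s = "(1 - t) ^ m"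
      have s: "0 \<le> ?s" "?s \<le> 1" using t by (auto intro: power_le_one)
      have nn: "0 \<le> (1 - ?s) ^ m" "(1 - ?s) ^ m \<le> 1" using s by (auto intro: power_le_one)
      have "1 - (1 - ?s) ^ m \<le> of_nat m * ?s"
        using Bernoulli_inequality[of "- ?s" m] s by simp
      have eq: "t - t * (1 - ?s) ^ m = t * (1 - (1 - ?s) ^ m)" by (simp add: algebra_simps)
      have "t * (1 - (1 - ?s) ^ m) \<le> e"
      proof (cases "t \<le> d")
        case True
        have "t * (1 - (1 - ?s) ^ m) \<le> t * 1" using t nn by (intro mult_left_mono) auto
        then show ?thesis using True by (simp add: d_def)
      next
        case False
        have "t * (1 - (1 - ?s) ^ m) \<le> 1 * (of_nat m * ?s)"
          using t nn \<open>1 - (1 - ?s) ^ m \<le> of_nat m * ?s\<close> by (intro mult_mono) auto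
        also have "\<dots> \<le> of_nat m * (1 - d) ^ m"
          using False t by (auto intro!: mult_left_mono power_mono)
        finally show ?thesis using elim by simp
      qed
      then show "\<bar>t - t * (1 - ?s) ^ m\<bar> \<le> e" using eq t nn by simp
    qed
  qed
qed

text \<open>For k = m this says m^m / (2m)! <= 1 / m!, which compares the bound of the iteration
  with the exponential series of x^2.\<close>

lemma fact_add_ge: "fact m * real m ^ k \<le> fact (m + k)"
proof (induction k)
  case (Suc k)
  have "fact m * real m ^ Suc k = real m * (fact m * real m ^ k)" by simp
  also have "\<dots> \<le> real (Suc (m + k)) * fact (m + k)"
    using Suc by (intro mult_mono) auto
  finally show ?case by simp
qed simp

lemma DERIV_power_fact:
  "((\<lambda>y. y ^ Suc k / fact (Suc k)) has_real_derivative y ^ k / fact k) (at y)"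
proof (rule DERIV_cong[OF DERIV_cdivide[OF DERIV_pow]])
  have "fact (Suc k) = real (Suc k) * fact k" by simp
  then show "real (Suc k) * y ^ (Suc k - Suc 0) / fact (Suc k) = y ^ k / fact k"
    by (simp del: fact_Suc of_nat_Suc)
qed

lemma superexponential_limit: "(\<lambda>m. real m ^ m * x ^ (2 * m) / fact (2 * m)) \<longlonglongrightarrow> 0"
proof (rule tendsto_sandwich[OF _ _ tendsto_const])
  show "(\<lambda>m. inverse (fact m) * (x\<^sup>2) ^ m) \<longlonglongrightarrow> 0"
    by (rule summable_LIMSEQ_zero[OF summable_exp])
  have "0 \<le> real m ^ m * x ^ (2 * m) / fact (2 * m)" for m
    by (simp add: power_mult)
  then show "\<forall>\<^sub>F m in sequentially. 0 \<le> real m ^ m * x ^ (2 * m) / fact (2 * m)" by simp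
  have "real m ^ m * x ^ (2 * m) / fact (2 * m) \<le> inverse (fact m) * (x\<^sup>2) ^ m" for m
  proof -
    have "(x\<^sup>2) ^ m * (fact m * real m ^ m) \<le> (x\<^sup>2) ^ m * fact (m + m)"
      by (rule mult_left_mono[OF fact_add_ge]) simp
    then have "real m ^ m * (x\<^sup>2) ^ m * fact m \<le> (x\<^sup>2) ^ m * fact (2 * m)"
      by (simp add: mult_ac flip: mult_2)
    then show ?thesis by (simp only: power_mult) (simp add: field_simps)
  qed
  then show "\<forall>\<^sub>F m in sequentially. real m ^ m * x ^ (2 * m) / fact (2 * m) \<le> inverse (fact m) * (x\<^sup>2) ^ m"
    by simp
qed

locale sl_spectral = sl_green +
  fixes v :: "real \<Rightarrow> real \<Rightarrow> real"
  assumes v_neumann: "lam \<ge> 0 \<Longrightarrow> neumann B (v lam) (\<lambda>x. - lam * v lam x)"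
    and v_0: "lam \<ge> 0 \<Longrightarrow> v lam 0 = 1"
begin

lemma v_bound: "lam \<ge> 0 \<Longrightarrow> x \<ge> 0 \<Longrightarrow> \<bar>v lam x\<bar> \<le> 1"
  using neumann_eigen_bound[OF v_neumann] v_0 by force

definition psi_b :: "real \<Rightarrow>\<^sub>C real"
  where "psi_b = Bcontfun psi"

definition G_b :: "real \<Rightarrow> (real \<Rightarrow>\<^sub>C real)"
  where "G_b x = Bcontfun (G x)"

lemma G_b_apply: "apply_bcontfun (G_b x) = G x"
  unfolding G_b_def
  by (rule Bcontfun_inverse, rule bcontfun_normI[OF continuous_G_right])
     (use G_le_const[of x x] G_nonneg in auto)

lemma psi_b_apply: "apply_bcontfun psi_b = psi"
  unfolding psi_b_def
proof (rule Bcontfun_inverse, rule bcontfun_normI[OF continuous_psi])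
  show "norm (psi x) \<le> psi 0" for x
    using psi_antimono[of 0 x] psi_left[of x] psi_nonneg[of x] by (cases "x \<ge> 0") auto
qed

lemma psi_b_E: "psi_b \<in> E"
  by (simp add: E_def psi_b_apply integrable_psi)

lemma G_b_E: "G_b x \<in> E"
  using integrable_G_mult[of "\<lambda>_. 1" 1 x] by (simp add: E_def G_b_apply)

text \<open>\<open>T f x\<close> is the form of \<open>f\<close> with \<open>G x\<close>. In
  Cauchy-Schwarz the square of \<open>G x\<close> integrates to at most the bound
  \<open>phi R * psi 0\<close> of its values, because the integral of \<open>G x\<close> is at most
  1.\<close>

lemma T_bound:
  assumes "f \<in> E" "x \<le> R"
  shows "(T f x)\<^sup>2 \<le> (phi R * psi 0) * ip f f"
proof -
  have "T f x = ip (G_b x) f" by (simp add: T_apply ip_def G_b_apply)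
  then have "(T f x)\<^sup>2 \<le> ip (G_b x) (G_b x) * ip f f"
    using op.cauchy_schwarz[OF G_b_E assms(1)] by simp
  also have "ip (G_b x) (G_b x) \<le> phi R * psi 0"
  proof -
    have i: "integrable M (G x)" using G_b_E[of x] by (simp add: E_def G_b_apply)
    have "ip (G_b x) (G_b x) \<le> (\<integral>y. (phi R * psi 0) * G x y \<partial>M)"
      unfolding ip_def G_b_apply
    proof (rule integral_mono)
      show "integrable M (\<lambda>y. G x y * G x y)" using integrable_ip[OF G_b_E[of x], of "G_b x"]
        by (simp add: G_b_apply)
      show "integrable M (\<lambda>y. (phi R * psi 0) * G x y)" using i by simp
      show "G x y * G x y \<le> (phi R * psi 0) * G x y" for y
        using G_le_const[OF assms(2)] G_nonneg by (intro mult_right_mono) auto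
    qed
    also have "\<dots> \<le> (phi R * psi 0) * 1"
      using integral_G_le[of x] phi_pos[of R] psi_nonneg[of 0] by (simp add: mult_left_le)
    finally show ?thesis by simp
  qed
  finally show ?thesis using op.ip_nonneg[OF assms(1)] by (simp add: mult_right_mono)
qed

section \<open>Quadrature by eigenfunctions and its error\<close>

context
  fixes h :: "real \<Rightarrow>\<^sub>C real"
  assumes h: "h \<in> E"
begin

text \<open>By polarization, \<open>coef n\<close> are the weights of a signed quadrature at the nodes \<open>j / n\<close> for
  the functional \<open>p \<mapsto> \<langle>p(T) h, psi\<rangle> = (T p(T) h)(0)\<close>.\<close>

definition coef :: "nat \<Rightarrow> nat \<Rightarrow> real"
  where "coef n j = (op.bernstein_weight (h + psi_b) n j - op.bernstein_weight (h - psi_b) n j) / 4"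

definition coef_bound :: real
  where "coef_bound = (ip (h + psi_b) (h + psi_b) + ip (h - psi_b) (h - psi_b)) / 4"

lemma hpsi: "h + psi_b \<in> E" "h - psi_b \<in> E"
  using h psi_b_E by auto

lemma sum_coef_le: "(\<Sum>j\<le>n. \<bar>coef n j\<bar>) \<le> coef_bound"
proof -
  have "(\<Sum>j\<le>n. \<bar>coef n j\<bar>)
      \<le> (\<Sum>j\<le>n. (op.bernstein_weight (h + psi_b) n j + op.bernstein_weight (h - psi_b) n j) / 4)"
    using op.bernstein_weight_nonneg[OF hpsi(1)] op.bernstein_weight_nonneg[OF hpsi(2)]
    by (intro sum_mono) (auto simp: coef_def abs_le_iff divide_right_mono add_increasing add_increasing2
        intro: order.trans[OF _ add_left_mono])
  also have "\<dots> = coef_bound"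
    unfolding coef_bound_def
    by (simp add: sum_divide_distrib[symmetric] sum.distrib op.sum_bernstein_weight hpsi)
  finally show ?thesis .
qed

lemma coef_converges:
  "(\<lambda>n. \<Sum>j\<le>n. coef n j * poly p (real j / real n)) \<longlonglongrightarrow> ip (poly_op T p h) psi_b"
proof -
  have "(\<lambda>n. ((\<Sum>j\<le>n. op.bernstein_weight (h + psi_b) n j * poly p (real j / real n))
          - (\<Sum>j\<le>n. op.bernstein_weight (h - psi_b) n j * poly p (real j / real n))) / 4)
      \<longlonglongrightarrow> (ip (poly_op T p (h + psi_b)) (h + psi_b) - ip (poly_op T p (h - psi_b)) (h - psi_b)) / 4"
    by (intro tendsto_intros op.bernstein_weight_converges hpsi) auto
  moreover have "(ip (poly_op T p (h + psi_b)) (h + psi_b) - ip (poly_op T p (h - psi_b)) (h - psi_b)) / 4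
      = ip (poly_op T p h) psi_b"
  proof -
    have "ip (poly_op T p psi_b) h = ip (poly_op T p h) psi_b"
      using op.poly_op_symmetric[OF psi_b_E h, of p] op.ip_commute[OF psi_b_E op.poly_op_E[OF h]] by simp
    then show ?thesis
      using h psi_b_E
      by (simp add: linear_add[OF linear_poly_op[OF linear_T]] linear_diff[OF linear_poly_op[OF linear_T]]
          op.ip_add_left op.ip_add_right op.ip_diff_left op.ip_diff_right op.poly_op_E op.E_closed)
  qed
  moreover have "((\<Sum>j\<le>n. op.bernstein_weight (h + psi_b) n j * poly p (real j / real n))
          - (\<Sum>j\<le>n. op.bernstein_weight (h - psi_b) n j * poly p (real j / real n))) / 4
      = (\<Sum>j\<le>n. coef n j * poly p (real j / real n))" for n
    by (simp add: coef_def sum_subtractf sum_divide_distrib left_diff_distrib diff_divide_distrib)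
  ultimately show ?thesis by simp
qed

text \<open>The spectral parameters of \<open>T = (1 - L)\<^sup>-\<^sup>1\<close> and of \<open>-L\<close> are related by
  \<open>t = 1 / (1 + lam)\<close>; the node \<open>t = 0\<close> corresponds to \<open>lam = \<infinity>\<close>.\<close>

definition V :: "real \<Rightarrow> real \<Rightarrow> real"
  where "V t x = (if t = 0 then 0 else v ((1 - t) / t) x)"

definition W :: "nat \<Rightarrow> real poly \<Rightarrow> real \<Rightarrow> real"
  where "W n p x = (\<Sum>j\<le>n. coef n j * poly p (real j / real n) * V (real j / real n) x)"

definition D :: "nat \<Rightarrow> real poly \<Rightarrow> real \<Rightarrow> real"
  where "D n p x = T (poly_op T p h) x - W n p x"

text \<open>For n = 0 the only node is 0 / 0 = 0, so this case is covered as well.\<close>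

lemma node: "j \<le> n \<Longrightarrow> 0 \<le> real j / real n" "j \<le> n \<Longrightarrow> real j / real n \<le> 1"
  by (auto simp: divide_le_eq_1)

lemma V_bound: "0 \<le> t \<Longrightarrow> t \<le> 1 \<Longrightarrow> x \<ge> 0 \<Longrightarrow> \<bar>V t x\<bar> \<le> 1"
  unfolding V_def by (auto intro!: v_bound divide_nonneg_pos)

lemma W_bound:
  assumes "\<And>t. 0 \<le> t \<Longrightarrow> t \<le> 1 \<Longrightarrow> \<bar>poly p t\<bar> \<le> s" "x \<ge> 0"
  shows "\<bar>W n p x\<bar> \<le> coef_bound * s"
proof -
  have "s \<ge> 0" using assms(1)[of 0] by simp
  have "\<bar>W n p x\<bar> \<le> (\<Sum>j\<le>n. \<bar>coef n j\<bar> * s * 1)"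
    unfolding W_def
  proof (rule order.trans[OF sum_abs], rule sum_mono)
    fix j assume "j \<in> {..n}"
    then show "\<bar>coef n j * poly p (real j / real n) * V (real j / real n) x\<bar> \<le> \<bar>coef n j\<bar> * s * 1"
      unfolding abs_mult using node[of j n] assms \<open>s \<ge> 0\<close>
      by (intro mult_mono V_bound assms(1)) auto
  qed
  also have "\<dots> = (\<Sum>j\<le>n. \<bar>coef n j\<bar>) * s" by (simp add: sum_distrib_right)
  also have "\<dots> \<le> coef_bound * s" using sum_coef_le \<open>s \<ge> 0\<close> by (rule mult_right_mono)
  finally show ?thesis .
qed

text \<open>The square root comes from \<open>T_bound\<close> and \<open>op.poly_op_ip_le\<close>
  for the operator half of \<open>D\<close>, the other summand from \<open>W_bound\<close>. Neither
  depends on n.\<close>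

definition D_const :: "real \<Rightarrow> real"
  where "D_const R = sqrt (phi R * psi 0 * ip h h) + coef_bound"

lemma D_const_nonneg: "D_const R \<ge> 0"
proof -
  have "0 \<le> phi R * psi 0 * ip h h"
    using phi_pos[of R] psi_nonneg[of 0] op.ip_nonneg[OF h] by (simp add: less_imp_le)
  moreover have "coef_bound \<ge> 0"
    using order.trans[OF _ sum_coef_le[of 0]] by (simp add: sum_nonneg)
  ultimately show ?thesis by (simp add: D_const_def)
qed

lemma D_bound:
  assumes p: "\<And>t. 0 \<le> t \<Longrightarrow> t \<le> 1 \<Longrightarrow> \<bar>poly p t\<bar> \<le> s" and x: "0 \<le> x" "x \<le> R"
  shows "\<bar>D n p x\<bar> \<le> D_const R * s"
proof -
  have "s \<ge> 0" using p[of 0] by simp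
  have nn: "0 \<le> phi R * psi 0" using phi_pos[of R] psi_nonneg[of 0] by (simp add: less_imp_le)
  have "(T (poly_op T p h) x)\<^sup>2 \<le> (phi R * psi 0) * (s\<^sup>2 * ip h h)"
    using T_bound[OF op.poly_op_E[OF h] x(2)] mult_left_mono[OF op.poly_op_ip_le[OF h p] nn]
    by (rule order.trans)
  also have "\<dots> = (sqrt (phi R * psi 0 * ip h h) * s)\<^sup>2"
    using nn op.ip_nonneg[OF h] by (simp add: power_mult_distrib)
  finally have "\<bar>T (poly_op T p h) x\<bar> \<le> \<bar>sqrt (phi R * psi 0 * ip h h) * s\<bar>"
    by (rule abs_le_square_iff[THEN iffD2])
  also have "\<dots> = sqrt (phi R * psi 0 * ip h h) * s"
    using nn op.ip_nonneg[OF h] \<open>s \<ge> 0\<close> by (intro abs_of_nonneg) auto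
  finally have "\<bar>T (poly_op T p h) x\<bar> \<le> sqrt (phi R * psi 0 * ip h h) * s" .
  with W_bound[OF p x(1), of n] show ?thesis by (auto simp: D_def D_const_def distrib_right)
qed

lemma D_diff: "D n (p - q) x = D n p x - D n q x"
  by (simp add: D_def W_def poly_op_diff linear_diff[OF linear_T] minus_bcontfun.rep_eq
      left_diff_distrib right_diff_distrib sum_subtractf)

text \<open>L turns the factor t into -(1 - t) in both halves: L T = T - 1 for the operator, L v =
  -lam v with t lam = 1 - t for the eigenfunctions. At t = 0 both sides are 0 by the choice of
  \<open>V\<close>.\<close>

lemma D_neumann: "neumann B (D n ([:0, 1:] * p)) (\<lambda>x. - D n ([:1, -1:] * p) x)"
proof -
  let ?g = "poly_op T p h"
  have "neumann B (W n ([:0, 1:] * p)) (\<lambda>x. - W n ([:1, -1:] * p) x)"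
    unfolding W_def sum_negf[symmetric]
  proof (rule neumann_sum)
    fix j assume "j \<in> {..n}"
    define t where "t = real j / real n"
    have t: "0 \<le> t" "t \<le> 1" unfolding t_def using \<open>j \<in> {..n}\<close> node by auto
    have "neumann B (\<lambda>x. coef n j * poly ([:0, 1:] * p) t * V t x) (\<lambda>x. - (coef n j * poly ([:1, -1:] * p) t * V t x))"
    proof (cases "t = 0")
      case True
      then show ?thesis by (simp add: V_def neumann_zero)
    next
      case False
      then have "neumann B (v ((1 - t) / t)) (\<lambda>x. - ((1 - t) / t) * v ((1 - t) / t) x)"
        using t by (intro v_neumann) auto
      from neumann_scale[OF this, of "coef n j * poly ([:0, 1:] * p) t"] show ?thesis
        by (rule neumann_cong) (use False in \<open>auto simp: V_def field_simps\<close>)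
    qed
    then show "neumann B (\<lambda>x. coef n j * poly ([:0, 1:] * p) (real j / real n) * V (real j / real n) x)
      (\<lambda>x. - (coef n j * poly ([:1, -1:] * p) (real j / real n) * V (real j / real n) x))"
      unfolding t_def .
  qed simp
  from neumann_diff[OF T_neumann[of "T ?g"] this]
  have n: "neumann B (\<lambda>x. T (T ?g) x - W n ([:0, 1:] * p) x)
     (\<lambda>x. (T (T ?g) x - T ?g x) - - W n ([:1, -1:] * p) x)" .
  have "poly_op T [:0, 1:] ?g = T ?g" "poly_op T [:1, -1:] ?g = ?g - T ?g"
    by (simp_all add: poly_op_pCons[OF linear_T] linear_0[OF linear_T] linear_neg[OF linear_T])
  then show ?thesis
    by (intro neumann_cong[OF n])
       (auto simp only: D_def poly_op_mult[OF linear_T] linear_diff[OF linear_T] minus_bcontfun.rep_eq)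
qed

text \<open>At x = 0 all eigenfunctions equal 1, so this is convergence of the quadrature. The
  factor X erases the node t = 0, where \<open>V\<close> is 0 instead of 1.\<close>

lemma D_at_0: "(\<lambda>n. D n ([:0, 1:] * p) 0) \<longlonglongrightarrow> 0"
proof -
  let ?p = "[:0, 1:] * p"
  have W: "W n ?p 0 = (\<Sum>j\<le>n. coef n j * poly ?p (real j / real n))" for n
    unfolding W_def
  proof (rule sum.cong[OF refl])
    fix j assume "j \<in> {..n}"
    then show "coef n j * poly ?p (real j / real n) * V (real j / real n) 0 = coef n j * poly ?p (real j / real n)"
      using node[of j n] v_0[of "(1 - real j / real n) / (real j / real n)"]
      by (cases "real j / real n = 0") (auto simp: V_def)
  qed
  have "D n ?p 0 = ip (poly_op T ?p h) psi_b - (\<Sum>j\<le>n. coef n j * poly ?p (real j / real n))" for n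
    unfolding D_def W T_0 by (simp add: ip_def psi_b_apply mult.commute)
  then show ?thesis
    using tendsto_diff[OF tendsto_const coef_converges, of "ip (poly_op T ?p h) psi_b" ?p] by simp
qed

text \<open>Each step exchanges a factor 1 - t for t and costs two integrations, so S acquires
  x^(2i) / (2i)!. The values at 0, bounded by d, are integrated along with it, and cosh is stable
  under this: d + d (cosh x - 1) = d cosh x.\<close>

lemma D_iterate:
  assumes "i \<le> m"
    and d: "\<And>i. i < m \<Longrightarrow> \<bar>D n ([:0, 1:] * ([:0, 1:] ^ i * [:1, -1:] ^ (m - Suc i) * q)) 0\<bar> \<le> d"
    and S: "\<And>x. 0 \<le> x \<Longrightarrow> x \<le> R \<Longrightarrow> \<bar>D n ([:1, -1:] ^ m * q) x\<bar> \<le> S"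
    and "d \<ge> 0" "0 \<le> x" "x \<le> R"
  shows "\<bar>D n ([:0, 1:] ^ i * [:1, -1:] ^ (m - i) * q) x\<bar> \<le> d * cosh x + S * (x ^ (2 * i) / fact (2 * i))"
  using assms(1,5,6)
proof (induction i arbitrary: x)
  case 0
  have "0 \<le> d * cosh x" using \<open>d \<ge> 0\<close> cosh_real_nonneg[of x] by simp
  then show ?case using S[OF 0(2,3)] by simp
next
  case (Suc i)
  let ?p = "[:0, 1:] ^ i * [:1, -1:] ^ (m - Suc i) * q"
  have e1: "[:0, 1:] ^ Suc i * [:1, -1:] ^ (m - Suc i) * q = [:0, 1:] * ?p"
    by (simp only: power_Suc mult.assoc)
  have "m - i = Suc (m - Suc i)" using Suc.prems by simp
  then have e2: "[:0, 1:] ^ i * [:1, -1:] ^ (m - i) * q = [:1, -1:] * ?p"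
    by (simp only: power_Suc mult_ac)
  have "\<bar>D n ([:0, 1:] * ?p) x - D n ([:0, 1:] * ?p) 0\<bar>
      \<le> d * (cosh x - 1) + S * (x ^ (2 * Suc i) / fact (2 * Suc i))"
  proof (rule neumann_comparison[OF D_neumann])
    fix y assume "0 < y" "y \<le> x"
    then show "\<bar>- D n ([:1, -1:] * ?p) y\<bar> \<le> d * cosh y + S * (y ^ (2 * i) / fact (2 * i))"
      using Suc.IH[of y] Suc.prems unfolding e2 by simp
  next
    fix y :: real
    show "((\<lambda>y. d * sinh y + S * (y ^ Suc (2 * i) / fact (Suc (2 * i)))) has_real_derivative
        d * cosh y + S * (y ^ (2 * i) / fact (2 * i))) (at y)"
      by (intro DERIV_add DERIV_cmult DERIV_power_fact) (auto intro!: derivative_eq_intros)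
    have "((\<lambda>y. cosh y - 1) has_real_derivative sinh y) (at y)"
      by (auto intro!: derivative_eq_intros)
    moreover have "((\<lambda>y. y ^ (2 * Suc i) / fact (2 * Suc i)) has_real_derivative
        y ^ Suc (2 * i) / fact (Suc (2 * i))) (at y)"
      using DERIV_power_fact[of "Suc (2 * i)" y] by simp
    ultimately show "((\<lambda>y. d * (cosh y - 1) + S * (y ^ (2 * Suc i) / fact (2 * Suc i))) has_real_derivative
        d * sinh y + S * (y ^ Suc (2 * i) / fact (Suc (2 * i)))) (at y)"
      by (intro DERIV_add DERIV_cmult)
  qed (use Suc.prems in auto)
  moreover have "\<bar>D n ([:0, 1:] * ?p) 0\<bar> \<le> d" by (rule d) (use Suc.prems in simp)
  ultimately show ?case unfolding e1 by (simp add: algebra_simps)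
qed

text \<open>m is fixed before n, because the values at 0 become small only for finitely many
  polynomials at a time. The error is shared as r / 4 each for these values, for the factorial term
  and for t - t^m q.\<close>

lemma D_X_tendsto_0:
  assumes "x \<ge> 0"
  shows "(\<lambda>n. D n [:0, 1:] x) \<longlonglongrightarrow> 0"
proof (rule LIMSEQ_I)
  fix r :: real assume "r > 0"
  define K where "K = D_const x + 1"
  have K: "K > 0" "D_const x \<le> K" using D_const_nonneg[of x] by (auto simp: K_def)
  define e where "e = r / (4 * K)"
  have e: "e > 0" "K * e = r / 4" using K \<open>r > 0\<close> by (auto simp: e_def)
  have "(\<lambda>m. K * (real m ^ m * x ^ (2 * m) / fact (2 * m))) \<longlonglongrightarrow> K * 0"
    by (intro tendsto_intros superexponential_limit)
  then have "\<forall>\<^sub>F m in sequentially. K * (real m ^ m * x ^ (2 * m) / fact (2 * m)) < r / 4"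
    using \<open>r > 0\<close> by (intro order_tendstoD(2)[where y="K * 0"]) auto
  with cutoff_limit[OF e(1)]
  have "\<forall>\<^sub>F m in sequentially. (\<forall>t\<in>{0..1}. \<bar>t - t * (1 - (1 - t) ^ m) ^ m\<bar> \<le> e)
      \<and> K * (real m ^ m * x ^ (2 * m) / fact (2 * m)) < r / 4" by (rule eventually_conj)
  then obtain m where m: "\<forall>t\<in>{0..1}. \<bar>t - t * (1 - (1 - t) ^ m) ^ m\<bar> \<le> e"
    "K * (real m ^ m * x ^ (2 * m) / fact (2 * m)) < r / 4"
    unfolding eventually_sequentially by blast
  \<comment> \<open>By the geometric series t times the sum is 1 - (1 - t)^m, so t^m q = t (1 - (1 -
    t)^m)^m; a sum of m terms in [0, 1] gives q <= m^m.\<close>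
  define q :: "real poly" where "q = [:0, 1:] * (\<Sum>i<m. [:1, -1:] ^ i) ^ m"
  have pq: "poly ([:0, 1:] ^ m * q) t = t * (1 - (1 - t) ^ m) ^ m" for t
  proof -
    have "t * (\<Sum>i<m. (1 - t) ^ i) = 1 - (1 - t) ^ m"
      using one_diff_power_eq[of "1 - t" m] by simp
    moreover have "poly ([:0, 1:] ^ m * q) t = t * (t * (\<Sum>i<m. (1 - t) ^ i)) ^ m"
      by (simp add: q_def poly_sum poly_power power_mult_distrib mult_ac)
    ultimately show ?thesis by simp
  qed
  have qb: "\<bar>poly ([:1, -1:] ^ m * q) t\<bar> \<le> real m ^ m" if t: "0 \<le> t" "t \<le> 1" for t
  proof -
    have a: "0 \<le> (\<Sum>i<m. (1 - t) ^ i)" using t by (intro sum_nonneg) auto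
    have "(\<Sum>i<m. (1 - t) ^ i) \<le> (\<Sum>i<m. 1)" using t by (intro sum_mono power_le_one) auto
    then have b: "(\<Sum>i<m. (1 - t) ^ i) ^ m \<le> real m ^ m" using a by (intro power_mono) auto
    have "(1 - t) ^ m * (t * (\<Sum>i<m. (1 - t) ^ i) ^ m) \<le> 1 * (1 * real m ^ m)"
      using t a b by (intro mult_mono power_le_one) auto
    moreover have "0 \<le> (1 - t) ^ m * (t * (\<Sum>i<m. (1 - t) ^ i) ^ m)"
      by (intro mult_nonneg_nonneg zero_le_power a) (use t in auto)
    moreover have "poly ([:1, -1:] ^ m * q) t = (1 - t) ^ m * (t * (\<Sum>i<m. (1 - t) ^ i) ^ m)"
      by (simp add: q_def poly_sum poly_power)
    ultimately show ?thesis by linarith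
  qed
  define d where "d = r / (4 * cosh x)"
  have d: "d > 0" "d * cosh x = r / 4"
    using \<open>r > 0\<close> cosh_real_pos[of x] by (auto simp: d_def)
  let ?p = "\<lambda>i. [:0, 1:] ^ i * [:1, -1:] ^ (m - Suc i) * q"
  have "\<forall>\<^sub>F n in sequentially. \<forall>i\<in>{..<m}. \<bar>D n ([:0, 1:] * ?p i) 0\<bar> < d"
  proof (rule eventually_ball_finite[OF finite_lessThan], rule ballI)
    fix i
    from tendsto_rabs[OF D_at_0[of "?p i"]] d(1)
    show "\<forall>\<^sub>F n in sequentially. \<bar>D n ([:0, 1:] * ?p i) 0\<bar> < d"
      by (intro order_tendstoD(2)[where y="\<bar>0::real\<bar>"]) auto
  qed
  then obtain N where N: "\<And>n i. n \<ge> N \<Longrightarrow> i < m \<Longrightarrow> \<bar>D n ([:0, 1:] * ?p i) 0\<bar> < d"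
    unfolding eventually_sequentially by blast
  have "\<bar>D n [:0, 1:] x\<bar> < r" if "n \<ge> N" for n
  proof -
    have "\<bar>D n ([:0, 1:] ^ m * [:1, -1:] ^ (m - m) * q) x\<bar>
        \<le> d * cosh x + D_const x * real m ^ m * (x ^ (2 * m) / fact (2 * m))"
    proof (rule D_iterate[where R=x])
      show "\<bar>D n ([:0, 1:] * ?p i) 0\<bar> \<le> d" if "i < m" for i
        by (rule less_imp_le[OF N[OF \<open>n \<ge> N\<close> that]])
      show "\<bar>D n ([:1, -1:] ^ m * q) y\<bar> \<le> D_const x * real m ^ m" if "0 \<le> y" "y \<le> x" for y
        by (rule D_bound[OF qb that])
    qed (rule order_refl less_imp_le[OF d(1)] assms)+
    also have "D_const x * real m ^ m * (x ^ (2 * m) / fact (2 * m))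
        \<le> K * (real m ^ m * x ^ (2 * m) / fact (2 * m))"
      using mult_right_mono[OF K(2), of "real m ^ m * x ^ (2 * m) / fact (2 * m)"] assms
      by (simp add: mult.assoc)
    also have "[:0, 1:] ^ m * [:1, -1:] ^ (m - m) * q = [:0, 1:] ^ m * q"
      by (simp only: diff_self_eq_0 power_0 mult_1_right)
    finally have 1: "\<bar>D n ([:0, 1:] ^ m * q) x\<bar> < r / 2"
      unfolding d(2) using m(2) by linarith
    have "\<bar>D n ([:0, 1:] - [:0, 1:] ^ m * q) x\<bar> \<le> D_const x * e"
    proof (rule D_bound[OF _ assms order_refl])
      fix t :: real assume "0 \<le> t" "t \<le> 1"
      then have "\<bar>t - t * (1 - (1 - t) ^ m) ^ m\<bar> \<le> e" using m(1) by simp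
      moreover have "poly [:0, 1:] t = t" by simp
      ultimately show "\<bar>poly ([:0, 1:] - [:0, 1:] ^ m * q) t\<bar> \<le> e"
        unfolding poly_diff pq by (simp only:)
    qed
    also have "\<dots> \<le> K * e" using K e by (intro mult_right_mono) auto
    finally have 2: "\<bar>D n [:0, 1:] x - D n ([:0, 1:] ^ m * q) x\<bar> \<le> r / 4"
      unfolding D_diff e(2) .
    have "\<bar>a\<bar> < r" if "\<bar>b\<bar> < r / 2" "\<bar>a - b\<bar> \<le> r / 4" for a b :: real
      using that \<open>r > 0\<close> by linarith
    from this[OF 1 2] show ?thesis .
  qed
  then show "\<exists>N. \<forall>n\<ge>N. norm (D n [:0, 1:] x - 0) < r" by (intro exI[of _ N]) auto
qed

theorem spectral_approximation:
  obtains a :: "nat \<Rightarrow> nat \<Rightarrow> real" and l :: "nat \<Rightarrow> nat \<Rightarrow> real" and C :: real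
  where "\<And>n j. j \<le> n \<Longrightarrow> l n j \<ge> 0"
    "\<And>n x. x \<ge> 0 \<Longrightarrow> \<bar>\<Sum>j\<le>n. a n j * v (l n j) x\<bar> \<le> C"
    "\<And>x. x \<ge> 0 \<Longrightarrow> (\<lambda>n. \<Sum>j\<le>n. a n j * v (l n j) x) \<longlonglongrightarrow> T (T h) x"
proof -
  define t where "t n j = real j / real n" for n j :: nat
  define a where "a n j = coef n j * t n j" for n j
  \<comment> \<open>At t = 0 the coefficient \<open>a n j\<close> vanishes and the parameter 0 is a
    placeholder.\<close>
  define l where "l n j = (if t n j = 0 then 0 else (1 - t n j) / t n j)" for n j
  have W: "(\<Sum>j\<le>n. a n j * v (l n j) x) = W n [:0, 1:] x" for n x
    unfolding W_def by (rule sum.cong) (auto simp: a_def l_def V_def t_def)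
  have 1: "l n j \<ge> 0" if "j \<le> n" for n j
    using node[OF that] by (simp add: l_def t_def)
  have 2: "\<bar>\<Sum>j\<le>n. a n j * v (l n j) x\<bar> \<le> coef_bound * 1" if "x \<ge> 0" for n x
  proof -
    have "\<bar>poly [:0, 1:] s\<bar> \<le> 1" if "0 \<le> s" "s \<le> 1" for s :: real using that by simp
    from W_bound[OF this \<open>x \<ge> 0\<close>] show ?thesis unfolding W .
  qed
  have 3: "(\<lambda>n. \<Sum>j\<le>n. a n j * v (l n j) x) \<longlonglongrightarrow> T (T h) x" if "x \<ge> 0" for x
  proof -
    have "poly_op T [:0, 1:] h = T h"
      by (simp add: poly_op_pCons[OF linear_T] linear_0[OF linear_T])
    then have "W n [:0, 1:] x = T (T h) x - D n [:0, 1:] x" for n by (simp add: D_def)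
    then show ?thesis
      unfolding W using tendsto_diff[OF tendsto_const D_X_tendsto_0[OF that], of "T (T h) x"] by simp
  qed
  show ?thesis by (rule that[OF 1 2 3])
qed

end

end

section \<open>Generation of all Borel functions by the eigenfunctions\<close>

definition bump :: "real \<Rightarrow> real \<Rightarrow> (real \<Rightarrow> real) \<Rightarrow> bool"
  where "bump a b r \<longleftrightarrow> continuous_on UNIV r \<and> (\<forall>x. r x \<ge> 0) \<and> (\<forall>x. x \<le> a \<or> b \<le> x \<longrightarrow> r x = 0)
    \<and> (\<exists>x. r x > 0)"

text \<open>The antiderivative of rho r climbs across the bump and is constant elsewhere; c is the
  reciprocal of its total increase, positive because r is positive somewhere.\<close>

lemma bump_ramp:
  assumes r: "bump a b r" and a: "0 < a"
    and rho: "continuous_on {0<..} rho" "\<And>x. x > 0 \<Longrightarrow> rho x > 0"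
  obtains F c where "continuous_on UNIV F" "\<And>x. 0 \<le> F x" "\<And>x. F x \<le> 1"
    "\<And>x. x \<le> a \<Longrightarrow> F x = 0" "\<And>x. b \<le> x \<Longrightarrow> F x = 1"
    "\<And>x. x > 0 \<Longrightarrow> (F has_real_derivative c * (rho x * r x)) (at x)"
proof -
  have rc: "continuous_on UNIV r" and rn: "\<And>x. r x \<ge> 0"
    and r0: "\<And>x. x \<le> a \<Longrightarrow> r x = 0" "\<And>x. b \<le> x \<Longrightarrow> r x = 0"
    using r by (auto simp: bump_def)
  obtain x0 where x0: "r x0 > 0" using r by (auto simp: bump_def)
  have x0ab: "a < x0" "x0 < b" using x0 r0[of x0] by (auto simp: not_le[symmetric])
  let ?f = "\<lambda>y. rho y * r y"
  have fc: "continuous_on {0<..} ?f"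
    by (intro continuous_intros rho continuous_on_subset[OF rc]) auto
  have fi: "set_integrable lborel {0<..R} ?f" for R
  proof -
    have "compact (?f ` {a..R})"
      by (rule compact_continuous_image) (use a in \<open>auto intro: continuous_on_subset[OF fc]\<close>)
    then obtain C where C: "\<And>y. a \<le> y \<Longrightarrow> y \<le> R \<Longrightarrow> \<bar>?f y\<bar> \<le> C"
      by (force dest!: compact_imp_bounded simp: bounded_iff)
    show ?thesis
    proof (rule set_integrable_Ioc_bounded[OF fc])
      show "\<bar>?f y\<bar> \<le> max C 0" if "0 < y" "y \<le> R" for y
        using C[of y] r0(1)[of y] that by (cases "a \<le> y") auto
    qed
  qed
  define F0 where "F0 = (\<lambda>x. LBINT y:{0<..x}. ?f y)"
  have F0c: "continuous_on UNIV F0" unfolding F0_def by (rule continuous_integral_Ioc[OF fc fi])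
  have F0d: "(F0 has_real_derivative ?f x) (at x)" if "x > 0" for x
    unfolding F0_def by (rule DERIV_integral_Ioc[OF fc fi that])
  have F0m: "F0 x \<le> F0 y" if "x \<le> y" for x y
    unfolding F0_def set_lebesgue_integral_def
    using fi[of x] fi[of y] rho(2) rn that
    by (intro integral_mono) (auto simp: set_integrable_def indicator_def less_imp_le)
  have F0a: "F0 x = 0" if "x \<le> a" for x
  proof -
    have "F0 x = (LBINT y:{0<..x}. 0)"
      unfolding F0_def by (rule set_lebesgue_integral_cong) (use that r0 in auto)
    then show ?thesis by simp
  qed
  have F0b: "F0 x = F0 b" if "b \<le> x" for x
  proof (cases "x = b")
    case False
    show ?thesis
    proof (rule DERIV_isconst_end[where f=F0])
      show "b < x" using that False by simp
      show "continuous_on {b..x} F0" by (rule continuous_on_subset[OF F0c]) auto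
      fix y assume y: "b < y" "y < x"
      then show "(F0 has_real_derivative 0) (at y)"
        using F0d[of y] r0(2)[of y] x0ab a by simp
    qed
  qed simp
  have pos: "F0 b > 0"
  proof -
    have "?f x0 > 0" using x0 rho(2)[of x0] x0ab a by simp
    from DERIV_pos_inc_right[OF F0d this] obtain d where d: "d > 0"
      "\<And>h. h > 0 \<Longrightarrow> h < d \<Longrightarrow> F0 x0 < F0 (x0 + h)" using x0ab a by auto
    define h where "h = min (d / 2) (b - x0)"
    have "h > 0" "h < d" "x0 + h \<le> b" using d x0ab by (auto simp: h_def)
    then have "F0 x0 < F0 b" using d(2)[of h] F0m[of "x0 + h" b] by simp
    moreover have "0 \<le> F0 x0" using F0m[of a x0] F0a[of a] x0ab by simp
    ultimately show ?thesis by simp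
  qed
  show ?thesis
  proof (rule that[of "\<lambda>x. F0 x / F0 b" "1 / F0 b"])
    show "continuous_on UNIV (\<lambda>x. F0 x / F0 b)" by (intro continuous_intros F0c) (use pos in auto)
    show "0 \<le> F0 x / F0 b" for x
      using F0m[of a x] F0a[of a] F0a[of x] pos by (cases "a \<le> x") auto
    show "F0 x / F0 b \<le> 1" for x
      using F0m[of x b] F0b[of x] pos by (cases "x \<le> b") auto
    show "F0 x / F0 b = 0" if "x \<le> a" for x using F0a[OF that] by simp
    show "F0 x / F0 b = 1" if "b \<le> x" for x using F0b[OF that] pos by simp
    show "((\<lambda>x. F0 x / F0 b) has_real_derivative 1 / F0 b * (rho x * r x)) (at x)" if "x > 0" for x
      using DERIV_cdivide[OF F0d[OF that], of "F0 b"] by simp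
  qed
qed

text \<open>Iterating this step gives bumps in the domain of powers of the operator.\<close>

lemma bump_step:
  assumes "bump a c r1" "bump c b r2" and a: "0 < a" "a < c" "c < b"
    and rho: "continuous_on {0<..} rho" "\<And>x. x > 0 \<Longrightarrow> rho x > 0"
  obtains r c1 c2 where "bump a b r"
    "\<And>x. x > 0 \<Longrightarrow> (r has_real_derivative rho x * (c1 * r1 x - c2 * r2 x)) (at x)"
proof -
  from bump_ramp[OF assms(1) a(1) rho] obtain F1 c1 where F1: "continuous_on UNIV F1" "\<And>x. 0 \<le> F1 x" "\<And>x. F1 x \<le> 1"
    "\<And>x. x \<le> a \<Longrightarrow> F1 x = 0" "\<And>x. c \<le> x \<Longrightarrow> F1 x = 1"
    "\<And>x. x > 0 \<Longrightarrow> (F1 has_real_derivative c1 * (rho x * r1 x)) (at x)" by blast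
  have "0 < c" using a by simp
  from bump_ramp[OF assms(2) this rho] obtain F2 c2 where F2: "continuous_on UNIV F2" "\<And>x. 0 \<le> F2 x" "\<And>x. F2 x \<le> 1"
    "\<And>x. x \<le> c \<Longrightarrow> F2 x = 0" "\<And>x. b \<le> x \<Longrightarrow> F2 x = 1"
    "\<And>x. x > 0 \<Longrightarrow> (F2 has_real_derivative c2 * (rho x * r2 x)) (at x)" by blast
  show ?thesis
  proof (rule that[of "\<lambda>x. F1 x - F2 x" c1 c2])
    \<comment> \<open>F1 has climbed to 1 at c before F2 leaves 0, so the difference is nonnegative,
      equals 1 at c and returns to 0 at b.\<close>
    have "0 \<le> F1 x - F2 x" for x
      using F1(2)[of x] F1(5)[of x] F2(3)[of x] F2(4)[of x] by (cases "x \<le> c") auto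
    moreover have "F1 x - F2 x = 0" if "x \<le> a \<or> b \<le> x" for x
      using that F1(4,5)[of x] F2(4,5)[of x] a by auto
    moreover have "0 < F1 c - F2 c" using F1(5)[of c] F2(4)[of c] by simp
    moreover have "continuous_on UNIV (\<lambda>x. F1 x - F2 x)" by (intro continuous_intros F1 F2)
    ultimately show "bump a b (\<lambda>x. F1 x - F2 x)" unfolding bump_def by blast
    show "((\<lambda>x. F1 x - F2 x) has_real_derivative rho x * (c1 * r1 x - c2 * r2 x)) (at x)" if "x > 0" for x
      using DERIV_diff[OF F1(6)[OF that] F2(6)[OF that]] by (simp add: algebra_simps)
  qed
qed

lemma DERIV_max_square: "((\<lambda>s::real. (max 0 s)\<^sup>2) has_real_derivative 2 * max 0 s) (at s)"
proof -
  consider "s > 0" | "s < 0" | "s = 0" by linarith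
  then show ?thesis
  proof cases
    case 1
    have "((\<lambda>s. s\<^sup>2) has_real_derivative 2 * max 0 s) (at s)"
      using 1 by (auto intro!: derivative_eq_intros)
    then show ?thesis
      by (rule has_field_derivative_transform_within_open[of _ _ _ "{0<..}"]) (use 1 in auto)
  next
    case 2
    have "((\<lambda>s. 0) has_real_derivative 2 * max 0 s) (at s)"
      using 2 by (auto intro!: derivative_eq_intros)
    then show ?thesis
      by (rule has_field_derivative_transform_within_open[of _ _ _ "{..<0}"]) (use 2 in auto)
  next
    case 3
    have "((\<lambda>h::real. (max 0 h)\<^sup>2 / h) \<longlongrightarrow> 0) (at 0)"
    proof (rule tendsto_rabs_zero_cancel, rule tendsto_sandwich[OF _ _ tendsto_const])
      show "((\<lambda>h::real. \<bar>h\<bar>) \<longlongrightarrow> 0) (at 0)" by (auto intro!: tendsto_eq_intros)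
      have "\<bar>(max 0 h)\<^sup>2 / h\<bar> \<le> \<bar>h\<bar>" for h :: real
        by (auto simp: max_def power2_eq_square)
      then show "\<forall>\<^sub>F h in at 0. \<bar>(max 0 h)\<^sup>2 / h\<bar> \<le> \<bar>h::real\<bar>" by simp
    qed auto
    then show ?thesis using 3 by (simp add: DERIV_def)
  qed
qed

text \<open>The positive part of (x - a) (b - x) has corners at a and b; squaring removes
  them.\<close>

lemma bump_C1:
  assumes "a < b"
  obtains r d where "bump a b r" "continuous_on UNIV d" "\<And>x. x \<le> a \<or> b \<le> x \<Longrightarrow> d x = 0"
    "\<And>x. (r has_real_derivative d x) (at x)"
proof (rule that)
  let ?g = "\<lambda>x. (x - a) * (b - x)"
  have out: "max 0 (?g x) = 0" if "x \<le> a \<or> b \<le> x" for x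
    using that assms mult_nonneg_nonpos[of "x - a" "b - x"] mult_nonneg_nonpos2[of "b - x" "x - a"]
    by (auto simp: max_def)
  have "?g ((a + b) / 2) = (b - a) / 2 * ((b - a) / 2)" by (simp add: field_simps)
  also have "\<dots> > 0" using assms by (intro mult_pos_pos) auto
  finally have p: "?g ((a + b) / 2) > 0" .
  have "(max 0 y)\<^sup>2 > 0" if "y > 0" for y :: real using that by (simp add: max_def)
  from this[OF p] have "(max 0 (?g ((a + b) / 2)))\<^sup>2 > 0" .
  then show "bump a b (\<lambda>x. (max 0 (?g x))\<^sup>2)"
    unfolding bump_def using out
    by (intro conjI allI impI exI[of _ "(a + b) / 2"] continuous_intros) auto
  show "continuous_on UNIV (\<lambda>x. 2 * max 0 (?g x) * (a + b - 2 * x))" by (intro continuous_intros)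
  show "2 * max 0 (?g x) * (a + b - 2 * x) = 0" if "x \<le> a \<or> b \<le> x" for x using out[OF that] by simp
  show "((\<lambda>x. (max 0 (?g x))\<^sup>2) has_real_derivative 2 * max 0 (?g x) * (a + b - 2 * x)) (at x)" for x
    by (rule DERIV_chain2[OF DERIV_max_square]) (auto intro!: derivative_eq_intros)
qed

section \<open>Cutoff functions in the range of the squared resolvent\<close>

context sl_weight
begin

lemma B_neq_0: "x > 0 \<Longrightarrow> B x \<noteq> 0"
  using B_pos[of x] by simp

lemma inverse_B: "continuous_on {0<..} (\<lambda>x. 1 / B x)" "\<And>x. x > 0 \<Longrightarrow> 1 / B x > 0"
  by (intro continuous_on_divide continuous_on_const continuous_B) (auto simp: B_neq_0 B_pos)

text \<open>Integration with weight 1 / B makes a combination of C1 bumps the quasi-derivative of q,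
  so that L q is again continuous. Everything vanishes near 0, and the Neumann condition holds
  trivially.\<close>

lemma bump_neumann:
  assumes "0 < a" "a < b"
  obtains q g where "bump a b q" "neumann B q g" "continuous_on UNIV g" "\<And>x. x \<le> a \<or> b \<le> x \<Longrightarrow> g x = 0"
proof -
  define c where "c = (a + b) / 2"
  have c: "a < c" "c < b" using assms by (auto simp: c_def)
  obtain r1 d1 where 1: "bump a c r1" "continuous_on UNIV d1" "\<And>x. x \<le> a \<or> c \<le> x \<Longrightarrow> d1 x = 0"
    "\<And>x. (r1 has_real_derivative d1 x) (at x)" using bump_C1[OF c(1)] by blast
  obtain r2 d2 where 2: "bump c b r2" "continuous_on UNIV d2" "\<And>x. x \<le> c \<or> b \<le> x \<Longrightarrow> d2 x = 0"
    "\<And>x. (r2 has_real_derivative d2 x) (at x)" using bump_C1[OF c(2)] by blast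
  obtain q c1 c2 where q: "bump a b q"
    "\<And>x. x > 0 \<Longrightarrow> (q has_real_derivative 1 / B x * (c1 * r1 x - c2 * r2 x)) (at x)"
    using bump_step[OF 1(1) 2(1) assms(1) c inverse_B] by blast
  define k where "k = (\<lambda>x. c1 * d1 x - c2 * d2 x)"
  have k0: "k x = 0" if "x \<le> a \<or> b \<le> x" for x using 1(3)[of x] 2(3)[of x] that c by (auto simp: k_def)
  have kc: "continuous_on UNIV k" unfolding k_def by (intro continuous_intros 1 2)
  \<comment> \<open>To the left of 0 the values of B are arbitrary; as k vanishes at a, cutting
    there keeps g continuous.\<close>
  define g where "g = (\<lambda>x. if x \<le> a then 0 else k x / B x)"
  show ?thesis
  proof (rule that[OF q(1)])
    show "g x = 0" if "x \<le> a \<or> b \<le> x" for x using k0[OF that] by (simp add: g_def)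
    have "continuous_on ({..a} \<union> {a..}) g"
      unfolding g_def
    proof (rule continuous_on_cases)
      show "continuous_on {a..} (\<lambda>x. k x / B x)"
        by (intro continuous_intros continuous_on_subset[OF kc] continuous_on_subset[OF continuous_B])
           (use assms in \<open>auto simp: B_neq_0\<close>)
    qed (use k0 in auto)
    moreover have "{..a} \<union> {a..} = UNIV" by auto
    ultimately show "continuous_on UNIV g" by simp
    show "neumann B q g"
    proof (rule neumannI[where r="\<lambda>x. c1 * r1 x - c2 * r2 x"])
      show "continuous_on {0..} q" using q(1) by (auto simp: bump_def intro: continuous_on_subset)
      show "(q has_real_derivative (c1 * r1 x - c2 * r2 x) / B x) (at x)" if "x > 0" for x
        using q(2)[OF that] by simp
      show "((\<lambda>x. c1 * r1 x - c2 * r2 x) has_real_derivative B x * g x) (at x)" if "x > 0" for x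
      proof (rule DERIV_cong)
        show "((\<lambda>x. c1 * r1 x - c2 * r2 x) has_real_derivative k x) (at x)"
          unfolding k_def by (intro DERIV_diff DERIV_cmult 1 2)
        show "k x = B x * g x" using B_pos[OF that] k0[of x] by (auto simp: g_def)
      qed
      show "((\<lambda>x. c1 * r1 x - c2 * r2 x) \<longlongrightarrow> 0) (at_right 0)"
      proof (rule tendsto_eventually)
        show "\<forall>\<^sub>F x in at_right 0. c1 * r1 x - c2 * r2 x = 0"
          using eventually_at_right_real[OF assms(1)]
          by eventually_elim (use 1(1) 2(1) c in \<open>auto simp: bump_def\<close>)
      qed
    qed
  qed
qed

end

context sl_green
begin

text \<open>M has no mass on the negative half-line and finite mass on bounded sets, so a constant
  left end does not spoil integrability.\<close>

lemma plateau_in_E: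
  assumes f: "continuous_on UNIV f" "\<And>x. x \<le> a \<Longrightarrow> f x = C" "\<And>x. b \<le> x \<Longrightarrow> f x = 0"
  shows "apply_bcontfun (Bcontfun f) = f" "Bcontfun f \<in> E"
proof -
  have "compact (f ` {a..b})"
    by (rule compact_continuous_image) (auto intro: continuous_on_subset[OF f(1)])
  then obtain K where K: "\<And>y. a \<le> y \<Longrightarrow> y \<le> b \<Longrightarrow> \<bar>f y\<bar> \<le> K"
    by (force dest!: compact_imp_bounded simp: bounded_iff)
  have "norm (f x) \<le> max K \<bar>C\<bar>" for x
    using K[of x] f(2)[of x] f(3)[of x] by (cases "x \<le> a"; cases "b \<le> x") auto
  with f(1) show eq: "apply_bcontfun (Bcontfun f) = f"
    by (intro Bcontfun_inverse bcontfun_normI) auto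
  have "set_integrable lborel {0<..} (\<lambda>x. B x * f x)"
  proof -
    have "(\<lambda>x. indicator {0<..} x *\<^sub>R (B x * f x)) = (\<lambda>x. indicator {0<..b} x *\<^sub>R (B x * f x))"
      using f(3) by (auto simp: fun_eq_iff indicator_def)
    then show ?thesis using set_integrable_B[OF f(1), of b] by (simp only: set_integrable_def)
  qed
  then show "Bcontfun f \<in> E"
    unfolding E_def eq using integrable_M_iff[OF continuous_measurable[OF f(1)]] by (simp add: eq)
qed

lemma T_cong:
  assumes "\<And>x. x \<ge> 0 \<Longrightarrow> apply_bcontfun f x = apply_bcontfun g x"
  shows "T f = T g"
proof (rule bcontfun_eqI)
  fix x
  have [measurable]: "G x \<in> borel_measurable borel"
    by (rule continuous_measurable[OF continuous_G_right])
  show "T f x = T g x"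
    unfolding T_apply
  proof (rule integral_cong_AE)
    show "AE y in M. G x y * f y = G x y * g y"
      using AE_M_pos by eventually_elim (simp add: assms)
  qed measurable
qed

text \<open>The cutoff u = 1 - F is integrated up from \<open>q1\<close> and \<open>q2\<close> so
  that L u = q and L q = g are continuous. Then h = (1 - L)^2 u, and \<open>T_unique\<close> applied
  twice recovers u as T (T h) on the half-line.\<close>

lemma smooth_cutoff:
  assumes "0 < a" "a < b"
  obtains h where "h \<in> E" "\<And>x. x \<ge> 0 \<Longrightarrow> 0 \<le> T (T h) x \<and> T (T h) x \<le> 1"
    "\<And>x. 0 \<le> x \<Longrightarrow> x \<le> a \<Longrightarrow> T (T h) x = 1" "\<And>x. b \<le> x \<Longrightarrow> T (T h) x = 0"
proof -
  define c where "c = (a + b) / 2"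
  have c: "a < c" "c < b" using assms by (auto simp: c_def)
  obtain q1 g1 where 1: "bump a c q1" "neumann B q1 g1" "continuous_on UNIV g1" "\<And>x. x \<le> a \<or> c \<le> x \<Longrightarrow> g1 x = 0"
    using bump_neumann[OF assms(1) c(1)] by blast
  have "0 < c" using assms c by simp
  obtain q2 g2 where 2: "bump c b q2" "neumann B q2 g2" "continuous_on UNIV g2" "\<And>x. x \<le> c \<or> b \<le> x \<Longrightarrow> g2 x = 0"
    using bump_neumann[OF \<open>0 < c\<close> c(2)] by blast
  \<comment> \<open>The weight is B here and 1 / B in the next integration, so that k times
    \<open>r\<close> becomes the quasi-derivative of F.\<close>
  obtain r c1 c2 where r: "bump a b r"
    "\<And>x. x > 0 \<Longrightarrow> (r has_real_derivative B x * (c1 * q1 x - c2 * q2 x)) (at x)"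
    using bump_step[OF 1(1) 2(1) assms(1) c continuous_B B_pos] by blast
  obtain F k where F: "continuous_on UNIV F" "\<And>x. 0 \<le> F x" "\<And>x. F x \<le> 1"
    "\<And>x. x \<le> a \<Longrightarrow> F x = 0" "\<And>x. b \<le> x \<Longrightarrow> F x = 1"
    "\<And>x. x > 0 \<Longrightarrow> (F has_real_derivative k * (1 / B x * r x)) (at x)"
    using bump_ramp[OF r(1) assms(1) inverse_B] by blast
  define u where "u = (\<lambda>x. 1 - F x)"
  define q where "q = (\<lambda>x. - k * (c1 * q1 x - c2 * q2 x))"
  define g where "g = (\<lambda>x. - k * (c1 * g1 x - c2 * g2 x))"
  have uc: "continuous_on UNIV u" unfolding u_def by (intro continuous_intros F)
  have q12: "continuous_on UNIV q1" "continuous_on UNIV q2" using 1 2 by (auto simp: bump_def)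
  have qc: "continuous_on UNIV q" unfolding q_def by (intro continuous_intros q12)
  have gc: "continuous_on UNIV g" unfolding g_def by (intro continuous_intros 1 2)
  have q0: "q x = 0" if "x \<le> a \<or> b \<le> x" for x using 1(1) 2(1) that c by (auto simp: q_def bump_def)
  have g0: "g x = 0" if "x \<le> a \<or> b \<le> x" for x using 1(4)[of x] 2(4)[of x] that c by (auto simp: g_def)
  have nq: "neumann B q g"
    unfolding q_def g_def by (intro neumann_scale neumann_diff 1 2)
  have nu: "neumann B u q"
  proof (rule neumannI[where r="\<lambda>x. - k * r x"])
    show "continuous_on {0..} u" by (rule continuous_on_subset[OF uc]) auto
    show "(u has_real_derivative - k * r x / B x) (at x)" if "x > 0" for x
      unfolding u_def using DERIV_diff[OF DERIV_const F(6)[OF that], of 1] by simp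
    show "((\<lambda>x. - k * r x) has_real_derivative B x * q x) (at x)" if "x > 0" for x
      using DERIV_cmult[OF r(2)[OF that], of "- k"] by (simp add: q_def mult_ac)
    show "((\<lambda>x. - k * r x) \<longlongrightarrow> 0) (at_right 0)"
    proof (rule tendsto_eventually)
      show "\<forall>\<^sub>F x in at_right 0. - k * r x = 0"
        using eventually_at_right_real[OF assms(1)]
        by eventually_elim (use r(1) in \<open>auto simp: bump_def\<close>)
    qed
  qed
  define f where "f = (\<lambda>x. u x - q x)"
  define h where "h = (\<lambda>x. f x - (q x - g x))"
  have fc: "continuous_on UNIV f" unfolding f_def by (intro continuous_intros uc qc)
  have hc: "continuous_on UNIV h" unfolding h_def by (intro continuous_intros fc qc gc)
  have u1: "u x = 1" if "x \<le> a" for x using F(4)[OF that] by (simp add: u_def)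
  have u0: "u x = 0" if "b \<le> x" for x using F(5)[OF that] by (simp add: u_def)
  have "f x = 1" "h x = 1" if "x \<le> a" for x using u1 q0 g0 that by (auto simp: f_def h_def)
  moreover have "f x = 0" "h x = 0" if "b \<le> x" for x using u0 q0 g0 that by (auto simp: f_def h_def)
  ultimately have fE: "apply_bcontfun (Bcontfun f) = f" "Bcontfun f \<in> E"
    and hE: "apply_bcontfun (Bcontfun h) = h" "Bcontfun h \<in> E"
    using plateau_in_E[OF fc, of a 1 b] plateau_in_E[OF hc, of a 1 b] by auto
  have uE: "apply_bcontfun (Bcontfun u) = u" "Bcontfun u \<in> E"
    using plateau_in_E[OF uc u1 u0] by auto
  have nf: "neumann B f (\<lambda>x. q x - g x)"
    unfolding f_def by (rule neumann_diff[OF nu nq])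
  have "T (Bcontfun h) x = apply_bcontfun (Bcontfun f) x" if "x \<ge> 0" for x
    by (rule T_unique[OF fE(2) hE(2) _ that], unfold fE(1) hE(1), rule neumann_cong[OF nf])
       (auto simp: h_def)
  then have "T (T (Bcontfun h)) = T (Bcontfun f)" by (rule T_cong)
  moreover have "T (Bcontfun f) x = apply_bcontfun (Bcontfun u) x" if "x \<ge> 0" for x
    by (rule T_unique[OF uE(2) fE(2) _ that], unfold fE(1) uE(1), rule neumann_cong[OF nu])
       (auto simp: f_def)
  ultimately have TT: "T (T (Bcontfun h)) x = u x" if "x \<ge> 0" for x using that uE(1) by simp
  show ?thesis
  proof (rule that[OF hE(2)])
    show "0 \<le> T (T (Bcontfun h)) x \<and> T (T (Bcontfun h)) x \<le> 1" if "x \<ge> 0" for x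
      using TT[OF that] F(2,3)[of x] by (simp add: u_def)
    show "T (T (Bcontfun h)) x = 1" if "0 \<le> x" "x \<le> a" for x using TT u1 that by simp
    show "T (T (Bcontfun h)) x = 0" if "b \<le> x" for x using TT u0 that assms by simp
  qed
qed

end

section \<open>From cutoff functions to Borel sets\<close>

context sl_spectral
begin

text \<open>An induction principle with arbitrary P, because it serves twice: for functionals
  vanishing on the eigenfunctions and for measurability of the kernel. Cutoffs shrink to indicators
  of {..a}, and these sets generate the Borel sets as an intersection-stable family.\<close>

theorem eigenfunctions_generate:
  fixes P :: "(real \<Rightarrow> real) \<Rightarrow> bool"
  assumes cong: "\<And>f g. P f \<Longrightarrow> (\<And>x. x \<ge> 0 \<Longrightarrow> f x = g x) \<Longrightarrow> P g"
    and eigen: "\<And>lam. lam \<ge> 0 \<Longrightarrow> P (v lam)"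
    and add: "\<And>f g. P f \<Longrightarrow> P g \<Longrightarrow> P (\<lambda>x. f x + g x)"
    and scale: "\<And>c f. P f \<Longrightarrow> P (\<lambda>x. c * f x)"
    and lim: "\<And>f g C. (\<And>n. P (f n)) \<Longrightarrow> (\<And>n x. x \<ge> 0 \<Longrightarrow> \<bar>f n x\<bar> \<le> C) \<Longrightarrow>
       (\<And>x. x \<ge> 0 \<Longrightarrow> (\<lambda>n. f n x) \<longlonglongrightarrow> g x) \<Longrightarrow> P g"
    and J: "J \<in> sets borel"
  shows "P (indicator J)"
proof -
  have zero: "P (\<lambda>_. 0)" using scale[OF eigen[of 0], of 0] by simp
  have sum: "P (\<lambda>x. \<Sum>i\<in>I. f i x)" if "finite I" "\<And>i. i \<in> I \<Longrightarrow> P (f i)"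
    for I :: "nat set" and f
    using that by (induction rule: finite_induct) (auto simp: zero add)
  have TT: "P (T (T h))" if hE: "h \<in> E" for h
  proof (rule spectral_approximation[OF hE])
    fix a l C
    assume *: "\<And>n j. j \<le> n \<Longrightarrow> l n j \<ge> 0"
      "\<And>n x. x \<ge> 0 \<Longrightarrow> \<bar>\<Sum>j\<le>n. a n j * v (l n j) x\<bar> \<le> C"
      "\<And>x. x \<ge> 0 \<Longrightarrow> (\<lambda>n. \<Sum>j\<le>n. a n j * v (l n j) x) \<longlonglongrightarrow> T (T h) x"
    show ?thesis
      by (rule lim[of "\<lambda>n x. \<Sum>j\<le>n. a n j * v (l n j) x" C])
         (auto intro!: sum scale eigen * )
  qed
  have pos: "P (indicator {..a})" if a: "a > 0" for a
  proof -
    have "\<forall>n. \<exists>h. h \<in> E \<and> (\<forall>x\<ge>0. 0 \<le> T (T h) x \<and> T (T h) x \<le> 1) \<and>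
      (\<forall>x. 0 \<le> x \<and> x \<le> a \<longrightarrow> T (T h) x = 1) \<and> (\<forall>x. a + 1 / real (Suc n) \<le> x \<longrightarrow> T (T h) x = 0)"
      (is "\<forall>n. \<exists>h. ?Q n h")
    proof
      fix n
      have "a < a + 1 / real (Suc n)" by simp
      then show "\<exists>h. ?Q n h" by (rule smooth_cutoff[OF a]) blast
    qed
    from choice[OF this] obtain h where Q: "\<forall>n. ?Q n (h n)" by blast
    then have h: "\<And>n. h n \<in> E" "\<And>n x. x \<ge> 0 \<Longrightarrow> 0 \<le> T (T (h n)) x \<and> T (T (h n)) x \<le> 1"
      "\<And>n x. 0 \<le> x \<Longrightarrow> x \<le> a \<Longrightarrow> T (T (h n)) x = 1"
      "\<And>n x. a + 1 / real (Suc n) \<le> x \<Longrightarrow> T (T (h n)) x = 0"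
      by blast+
    show ?thesis
    proof (rule lim[of "\<lambda>n. T (T (h n))" 1])
      fix x :: real assume x: "x \<ge> 0"
      show "(\<lambda>n. T (T (h n)) x) \<longlonglongrightarrow> indicator {..a} x"
      proof (cases "x \<le> a")
        case True
        then show ?thesis using h(3)[OF x] by simp
      next
        case False
        then obtain N where N: "1 / real (Suc N) < x - a"
          using nat_approx_posE[of "x - a"] by (metis diff_gt_0_iff_gt not_le)
        have "T (T (h n)) x = 0" if "n \<ge> N" for n
        proof (rule h(4))
          have "1 / real (Suc n) \<le> 1 / real (Suc N)" using that by (simp add: frac_le)
          then show "a + 1 / real (Suc n) \<le> x" using N by simp
        qed
        then show ?thesis using False
          by (intro tendsto_eventually) (auto simp: eventually_sequentially)
      qed
    qed (use h TT in auto)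
  qed
  \<comment> \<open>Cutoffs exist only for a > 0. The case a = 0 is a limit from the right, and for
    a < 0 the indicator is 0 on the half-line.\<close>
  have half: "P (indicator {..a})" for a
  proof (cases "a > 0")
    case False
    show ?thesis
    proof (cases "a = 0")
      case True
      show ?thesis
      proof (rule lim[of "\<lambda>n. indicator {..1 / real (Suc n)}" 1])
        fix x :: real assume x: "x \<ge> 0"
        show "(\<lambda>n. indicator {..1 / real (Suc n)} x) \<longlonglongrightarrow> (indicator {..a} x :: real)"
        proof (cases "x = 0")
          case False
          then obtain N where N: "1 / real (Suc N) < x"
            using nat_approx_posE[of x] x by (metis less_eq_real_def)
          have "indicator {..1 / real (Suc n)} x = (0 :: real)" if "n \<ge> N" for n
          proof -
            have "1 / real (Suc n) \<le> 1 / real (Suc N)" using that by (simp add: frac_le)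
            then show ?thesis using N by (simp add: indicator_def)
          qed
          then show ?thesis using False True x
            by (intro tendsto_eventually) (auto simp: eventually_sequentially)
        qed (use True in simp)
      qed (auto intro: pos simp: indicator_def)
    next
      case False
      with \<open>\<not> a > 0\<close> show ?thesis by (intro cong[OF zero]) (auto simp: indicator_def)
    qed
  qed (rule pos)
  have one: "P (\<lambda>_. 1)"
  proof (rule lim[of "\<lambda>n. indicator {..real n}" 1])
    fix x :: real
    obtain N :: nat where "x \<le> real N" using real_arch_simple by blast
    then show "(\<lambda>n. indicator {..real n} x) \<longlonglongrightarrow> (1::real)"
      by (intro tendsto_eventually) (auto simp: eventually_sequentially intro!: exI[of _ N])
  qed (auto intro: half simp: indicator_def)
  have "Int_stable (range (\<lambda>a::real. {..a}))"
    by (auto simp: Int_stable_def)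
  moreover have "range (\<lambda>a::real. {..a}) \<subseteq> Pow UNIV" by simp
  moreover have "J \<in> sigma_sets UNIV (range (\<lambda>a. {..a}))"
    using J by (simp add: borel_eq_atMost)
  ultimately show ?thesis
  proof (induction rule: sigma_sets_induct_disjoint)
    case (basic A)
    then show ?case using half by auto
  next
    case empty
    then show ?case using zero by (simp add: indicator_def)
  next
    case (compl A)
    have "P (\<lambda>x. 1 + (-1) * indicator A x)" by (intro add one scale compl)
    then show ?case by (rule cong) (simp add: indicator_def)
  next
    case (union A)
    show ?case
    proof (rule lim[of "\<lambda>n x. \<Sum>i<n. indicator (A i) x" 1])
      show "P (\<lambda>x. \<Sum>i<n. indicator (A i) x)" for n by (rule sum) (use union in auto)
      have eq: "(\<Sum>i<n. indicator (A i) x) = (indicator (\<Union>i<n. A i) x :: real)" for n x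
        by (subst indicator_UN_disjoint) (auto intro: disjoint_family_on_mono[OF _ union(1)])
      show "\<bar>\<Sum>i<n. indicator (A i) x\<bar> \<le> (1::real)" for n x unfolding eq by simp
      show "(\<lambda>n. \<Sum>i<n. indicator (A i) x) \<longlonglongrightarrow> (indicator (\<Union>i. A i) x :: real)" for x
        unfolding eq by (rule LIMSEQ_indicator_UN)
    qed
  qed
qed

end

section \<open>Complex measures\<close>

lemma disjoint_family_UN_less: "disjoint_family A \<Longrightarrow> (\<Union>i<n. A i) \<inter> A n = {}" for n :: nat
proof -
  assume "disjoint_family A"
  then have "A i \<inter> A n = {}" if "i < n" for i using that by (simp add: disjoint_family_on_def)
  then show ?thesis by blast
qed

definition signed_measure :: "'a measure \<Rightarrow> ('a set \<Rightarrow> real) \<Rightarrow> bool"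
  where "signed_measure N s \<longleftrightarrow> (\<forall>E :: nat \<Rightarrow> 'a set. range E \<subseteq> sets N \<longrightarrow> disjoint_family E
           \<longrightarrow> (\<lambda>n. s (E n)) sums s (\<Union>n. E n))"

context
  fixes N :: "'a measure" and s :: "'a set \<Rightarrow> real"
  assumes s: "signed_measure N s"
begin

lemma signed_sums: "range E \<subseteq> sets N \<Longrightarrow> disjoint_family E \<Longrightarrow> (\<lambda>n. s (E n)) sums s (\<Union>n. E n)"
  for E :: "nat \<Rightarrow> 'a set"
  using s by (simp add: signed_measure_def)

lemma signed_empty: "s {} = 0"
proof -
  have "(\<lambda>n::nat. s {}) sums s (\<Union>n::nat. {})"
    by (rule signed_sums) (auto simp: disjoint_family_on_def)
  then show ?thesis using summable_LIMSEQ_zero[OF sums_summable] LIMSEQ_const_iff by blast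
qed

lemma signed_Un:
  assumes "A \<in> sets N" "B \<in> sets N" "A \<inter> B = {}"
  shows "s (A \<union> B) = s A + s B"
proof -
  let ?E = "\<lambda>n::nat. if n = 0 then A else if n = 1 then B else {}"
  have "(\<lambda>n. s (?E n)) sums s (\<Union>n. ?E n)"
    by (rule signed_sums) (use assms in \<open>auto simp: disjoint_family_on_def\<close>)
  moreover have "(\<lambda>n. s (?E n)) sums (\<Sum>n\<in>{0, 1}. s (?E n))"
    by (rule sums_finite) (auto simp: signed_empty)
  moreover have "(\<Union>n. ?E n) = A \<union> B" by (auto split: if_splits)
  ultimately show ?thesis using sums_unique2 by fastforce
qed

lemma signed_Diff: "A \<in> sets N \<Longrightarrow> B \<in> sets N \<Longrightarrow> B \<subseteq> A \<Longrightarrow> s (A - B) = s A - s B"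
  using signed_Un[of B "A - B"] by (simp add: Un_absorb1)

text \<open>If s were unbounded, sets with |s| >= 1 could be split off one after another, each
  leaving a remainder on which s is still unbounded. Their values would be the terms of a convergent
  series that do not tend to 0.\<close>

lemma signed_bounded: "\<exists>K. \<forall>F\<in>sets N. \<bar>s F\<bar> \<le> K"
proof (rule ccontr)
  define unb where "unb E \<longleftrightarrow> E \<in> sets N \<and> (\<forall>K. \<exists>F\<in>sets N. F \<subseteq> E \<and> \<bar>s F\<bar> > K)" for E
  assume "\<nexists>K. \<forall>F\<in>sets N. \<bar>s F\<bar> \<le> K"
  then have top: "unb (space N)"
    using sets.sets_into_space[of _ N] unfolding unb_def by (auto simp: not_le)
  have step: "\<exists>F\<in>sets N. F \<subseteq> E \<and> 1 \<le> \<bar>s F\<bar> \<and> unb (E - F)" if E: "unb E" for E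
  proof -
    have "E \<in> sets N" using E by (simp add: unb_def)
    \<comment> \<open>The surplus \<open>\<bar>s E\<bar> + 1\<close> makes |s| at least 1 on both F
      and E - F, so whichever of them stays unbounded, the other can be split off.\<close>
    from E obtain F where F: "F \<in> sets N" "F \<subseteq> E" "\<bar>s F\<bar> > \<bar>s E\<bar> + 1" unfolding unb_def by blast
    have d: "1 \<le> \<bar>s (E - F)\<bar>" using signed_Diff[OF \<open>E \<in> sets N\<close> F(1,2)] F(3) by linarith
    have "unb F \<or> unb (E - F)"
    proof (rule ccontr)
      assume "\<not> (unb F \<or> unb (E - F))"
      then obtain K1 K2 where K: "\<And>H. H \<in> sets N \<Longrightarrow> H \<subseteq> F \<Longrightarrow> \<bar>s H\<bar> \<le> K1"
        "\<And>H. H \<in> sets N \<Longrightarrow> H \<subseteq> E - F \<Longrightarrow> \<bar>s H\<bar> \<le> K2"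
        using F(1) \<open>E \<in> sets N\<close> unfolding unb_def by (force simp: not_less)
      from E obtain H where H: "H \<in> sets N" "H \<subseteq> E" "\<bar>s H\<bar> > K1 + K2" unfolding unb_def by blast
      have "s H = s (H \<inter> F) + s (H - F)"
        using signed_Un[of "H \<inter> F" "H - F"] H(1) F(1) by (simp add: Int_Diff_Un Int_Diff_disjoint)
      moreover have "\<bar>s (H \<inter> F)\<bar> \<le> K1" using K(1)[of "H \<inter> F"] H F by auto
      moreover have "\<bar>s (H - F)\<bar> \<le> K2" using K(2)[of "H - F"] H F by auto
      ultimately show False using H(3) by linarith
    qed
    then show ?thesis
    proof
      assume "unb F"
      moreover have "E - (E - F) = F" using F(2) by auto
      ultimately show ?thesis using d F \<open>E \<in> sets N\<close> by (intro bexI[of _ "E - F"]) auto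
    next
      assume "unb (E - F)"
      then show ?thesis using F by (intro bexI[of _ F]) auto
    qed
  qed
  define pick where "pick E = (SOME F. F \<in> sets N \<and> F \<subseteq> E \<and> 1 \<le> \<bar>s F\<bar> \<and> unb (E - F))" for E
  have pick: "pick E \<in> sets N" "pick E \<subseteq> E" "1 \<le> \<bar>s (pick E)\<bar>" "unb (E - pick E)" if "unb E" for E
    using someI_ex[OF step[OF that, unfolded Bex_def]] unfolding pick_def by auto
  define R where "R n = ((\<lambda>E. E - pick E) ^^ n) (space N)" for n
  have R: "unb (R n)" for n
    by (induction n) (auto simp: R_def top pick(4))
  have RS: "R (Suc n) = R n - pick (R n)" for n by (simp add: R_def)
  have dec: "R m \<subseteq> R n" if "n \<le> m" for n m
    using that by (induction rule: dec_induct) (auto simp: RS)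
  have "disjoint_family (\<lambda>n. pick (R n))"
    unfolding disjoint_family_on_def
  proof (intro ballI impI)
    have *: "pick (R m) \<inter> pick (R n) = {}" if "n < m" for n m
      using pick(2)[OF R[of m]] dec[of "Suc n" m] that RS[of n] by auto
    fix m n :: nat assume "m \<noteq> n"
    then show "pick (R m) \<inter> pick (R n) = {}" using *[of m n] *[of n m] by (cases "m < n") auto
  qed
  then have "(\<lambda>n. s (pick (R n))) sums s (\<Union>n. pick (R n))"
    using pick(1)[OF R] by (intro signed_sums) auto
  then have "(\<lambda>n. s (pick (R n))) \<longlonglongrightarrow> 0" by (intro summable_LIMSEQ_zero sums_summable)
  then have "\<forall>\<^sub>F n in sequentially. \<bar>s (pick (R n))\<bar> < 1"
    using tendsto_rabs_zero by (intro order_tendstoD(2)[of _ 0]) auto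
  then show False using pick(3)[OF R] by (auto simp: eventually_sequentially not_less[symmetric])
qed

text \<open>The supremum within the reals, meaningful by \<open>signed_bounded\<close>;
  \<open>emeasure_positive_variation\<close> identifies it with the extended one.\<close>

definition pvar :: "'a set \<Rightarrow> real"
  where "pvar E = Sup (s ` {F \<in> sets N. F \<subseteq> E})"

lemma pvar_bdd: "bdd_above (s ` {F \<in> sets N. F \<subseteq> E})"
  using signed_bounded by (auto simp: bdd_above_def abs_le_iff)

lemma pvar_upper: "F \<in> sets N \<Longrightarrow> F \<subseteq> E \<Longrightarrow> s F \<le> pvar E"
  unfolding pvar_def by (rule cSUP_upper[OF _ pvar_bdd]) auto

lemma pvar_least:
  assumes "\<And>F. F \<in> sets N \<Longrightarrow> F \<subseteq> E \<Longrightarrow> s F \<le> c"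
  shows "pvar E \<le> c"
  unfolding pvar_def by (rule cSUP_least) (use assms in auto)

lemma pvar_nonneg: "0 \<le> pvar E"
  using pvar_upper[of "{}" E] by (simp add: signed_empty)

lemma pvar_empty: "pvar {} = 0"
  using pvar_least[of "{}" 0] pvar_nonneg[of "{}"] by (force simp: signed_empty)

lemma pvar_mono: "A \<subseteq> B \<Longrightarrow> pvar A \<le> pvar B"
  by (rule pvar_least) (auto intro: pvar_upper)

lemma pvar_superadditive: "A \<inter> B = {} \<Longrightarrow> pvar A + pvar B \<le> pvar (A \<union> B)"
proof -
  assume AB: "A \<inter> B = {}"
  have "pvar A \<le> pvar (A \<union> B) - pvar B"
  proof (rule pvar_least)
    fix F assume F: "F \<in> sets N" "F \<subseteq> A"
    have "pvar B \<le> pvar (A \<union> B) - s F"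
    proof (rule pvar_least)
      fix G assume G: "G \<in> sets N" "G \<subseteq> B"
      have "s (F \<union> G) = s F + s G" using F G AB by (intro signed_Un) auto
      moreover have "s (F \<union> G) \<le> pvar (A \<union> B)" using F G by (intro pvar_upper) auto
      ultimately show "s G \<le> pvar (A \<union> B) - s F" by simp
    qed
    then show "s F \<le> pvar (A \<union> B) - pvar B" by simp
  qed
  then show ?thesis by simp
qed

lemma pvar_sums:
  fixes A :: "nat \<Rightarrow> 'a set"
  assumes A: "range A \<subseteq> sets N" "disjoint_family A"
  shows "(\<lambda>n. pvar (A n)) sums pvar (\<Union>n. A n)"
proof -
  have fin: "(\<Sum>i<n. pvar (A i)) \<le> pvar (\<Union>i<n. A i)" for n
  proof (induction n)
    case (Suc n)
    have "(\<Union>i<n. A i) \<inter> A n = {}" by (rule disjoint_family_UN_less[OF A(2)])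
    from pvar_superadditive[OF this] Suc show ?case by (simp add: lessThan_Suc Un_commute)
  qed (simp add: pvar_empty)
  have le: "(\<Sum>i<n. pvar (A i)) \<le> pvar (\<Union>i. A i)" for n
    using fin[of n] pvar_mono[of "\<Union>i<n. A i" "\<Union>i. A i"] by force
  have sm: "summable (\<lambda>i. pvar (A i))"
    by (rule summableI_nonneg_bounded[OF pvar_nonneg le])
  have "pvar (\<Union>i. A i) \<le> (\<Sum>i. pvar (A i))"
  proof (rule pvar_least)
    fix F assume F: "F \<in> sets N" "F \<subseteq> (\<Union>i. A i)"
    have "(\<lambda>n. s (F \<inter> A n)) sums s (\<Union>n. F \<inter> A n)"
      using A F by (intro signed_sums) (auto simp: disjoint_family_on_def)
    also have "(\<Union>n. F \<inter> A n) = F" using F by auto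
    finally have "(\<lambda>n. s (F \<inter> A n)) sums s F" .
    from sums_le[OF _ this summable_sums[OF sm]] show "s F \<le> (\<Sum>i. pvar (A i))"
      using A F by (auto intro!: pvar_upper)
  qed
  moreover have "(\<Sum>i. pvar (A i)) \<le> pvar (\<Union>i. A i)" by (rule suminf_le_const[OF sm le])
  ultimately have "(\<Sum>i. pvar (A i)) = pvar (\<Union>i. A i)" by (rule antisym[rotated])
  then show ?thesis using summable_sums[OF sm] by simp
qed

lemma sets_positive_variation [simp]: "sets (positive_variation N s) = sets N"
  and space_positive_variation [simp]: "space (positive_variation N s) = space N"
  by (auto simp: positive_variation_def sets.space_closed sets.sigma_sets_eq)

lemma emeasure_positive_variation:
  assumes "E \<in> sets N"
  shows "emeasure (positive_variation N s) E = ennreal (pvar E)"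
proof -
  let ?m = "\<lambda>E. SUP F\<in>{F \<in> sets N. F \<subseteq> E}. ennreal (s F)"
  have m: "?m E = ennreal (pvar E)" for E
  proof (rule antisym)
    show "?m E \<le> ennreal (pvar E)" by (rule SUP_least) (auto intro!: ennreal_leI pvar_upper)
    show "ennreal (pvar E) \<le> ?m E"
    proof (cases "?m E")
      case (real r)
      have "pvar E \<le> r"
      proof (rule pvar_least)
        fix F assume "F \<in> sets N" "F \<subseteq> E"
        then have "ennreal (s F) \<le> ?m E" by (intro SUP_upper) auto
        then show "s F \<le> r" using real ennreal_le_iff[of r "s F"] by auto
      qed
      then show ?thesis using real by (simp add: ennreal_leI)
    next
      case top
      then show ?thesis by (simp only: top_greatest)
    qed
  qed
  have "emeasure (positive_variation N s) E = ?m E"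
  proof (rule emeasure_measure_of[OF positive_variation_def])
    show "sets N \<subseteq> Pow (space N)" by (rule sets.space_closed)
    show "E \<in> sets (positive_variation N s)" using assms by simp
    show "positive (sets (positive_variation N s)) ?m"
      unfolding positive_def m by (simp add: pvar_empty)
    show "countably_additive (sets (positive_variation N s)) ?m"
      unfolding countably_additive_def m
    proof (intro allI impI)
      fix A :: "nat \<Rightarrow> 'a set"
      assume A: "range A \<subseteq> sets (positive_variation N s)" "disjoint_family A"
      then have "(\<lambda>n. pvar (A n)) sums pvar (\<Union>n. A n)" by (intro pvar_sums) auto
      then show "(\<Sum>i. ennreal (pvar (A i))) = ennreal (pvar (\<Union> (range A)))"
        by (subst suminf_ennreal2) (auto simp: pvar_nonneg sums_iff)
    qed
  qed
  then show ?thesis by (simp only: m)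
qed

lemma measure_positive_variation: "E \<in> sets N \<Longrightarrow> measure (positive_variation N s) E = pvar E"
  by (simp add: measure_def emeasure_positive_variation pvar_nonneg)

lemma finite_positive_variation: "finite_measure (positive_variation N s)"
  by (rule finite_measureI) (simp add: emeasure_positive_variation)

end

lemma signed_measure_uminus: "signed_measure N s \<Longrightarrow> signed_measure N (\<lambda>E. - s E)"
  unfolding signed_measure_def by (auto intro: sums_minus)

text \<open>Complements within E exchange the two suprema up to s E, because - s F = s (E - F) - s E
  for F inside E.\<close>

lemma jordan_decomposition:
  assumes s: "signed_measure N s" and E: "E \<in> sets N"
  shows "s E = measure (positive_variation N s) E - measure (positive_variation N (\<lambda>E. - s E)) E"
proof -
  have m: "signed_measure N (\<lambda>E. - s E)" by (rule signed_measure_uminus[OF s])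
  have "pvar N (\<lambda>E. - s E) E \<le> pvar N s E - s E"
  proof (rule pvar_least[OF m])
    fix F assume "F \<in> sets N" "F \<subseteq> E"
    then show "- s F \<le> pvar N s E - s E"
      using pvar_upper[OF s, of "E - F" E] signed_Diff[OF s E] E by auto
  qed
  moreover have "pvar N s E \<le> s E + pvar N (\<lambda>E. - s E) E"
  proof (rule pvar_least[OF s])
    fix F assume "F \<in> sets N" "F \<subseteq> E"
    then show "s F \<le> s E + pvar N (\<lambda>E. - s E) E"
      using pvar_upper[OF m, of "E - F" E] signed_Diff[OF s E] E by auto
  qed
  ultimately show ?thesis
    using measure_positive_variation[OF s E] measure_positive_variation[OF m E] by simp
qed

lemma complex_measure_signed:
  assumes "\<mu> \<in> complex_measures N"
  shows "signed_measure N (\<lambda>E. Re (\<mu> E))" "signed_measure N (\<lambda>E. Im (\<mu> E))"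
  using assms by (auto simp: complex_measures_def signed_measure_def sums_complex_iff)

section \<open>Functionals continuous under bounded convergence\<close>

definition bounded_by :: "'a measure \<Rightarrow> real \<Rightarrow> ('a \<Rightarrow> complex) \<Rightarrow> bool"
  where "bounded_by N C f \<longleftrightarrow> f \<in> borel_measurable N \<and> (\<forall>x\<in>space N. norm (f x) \<le> C)"

text \<open>Complex measures correspond to such functionals, evaluated at indicator functions; all
  manipulations of iterated integrals are carried out on this side.\<close>

definition measure_functional :: "'a measure \<Rightarrow> (('a \<Rightarrow> complex) \<Rightarrow> complex) \<Rightarrow> bool"
  where "measure_functional N L \<longleftrightarrow>
    (\<forall>f g C D. bounded_by N C f \<longrightarrow> bounded_by N D g \<longrightarrow> L (\<lambda>x. f x + g x) = L f + L g) \<and>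
    (\<forall>f C c. bounded_by N C f \<longrightarrow> L (\<lambda>x. c * f x) = c * L f) \<and>
    (\<forall>f g C. (\<forall>n::nat. bounded_by N C (f n)) \<longrightarrow> (\<forall>x\<in>space N. (\<lambda>n. f n x) \<longlonglongrightarrow> g x)
       \<longrightarrow> (\<lambda>n. L (f n)) \<longlonglongrightarrow> L g)"

lemma bounded_by_add: "bounded_by N C f \<Longrightarrow> bounded_by N D g \<Longrightarrow> bounded_by N (C + D) (\<lambda>x. f x + g x)"
  unfolding bounded_by_def by (auto intro: norm_triangle_mono)

lemma bounded_by_scale: "bounded_by N C f \<Longrightarrow> bounded_by N (norm c * C) (\<lambda>x. c * f x)"
  unfolding bounded_by_def by (auto simp: norm_mult mult_left_mono)

lemma bounded_by_indicator: "E \<in> sets N \<Longrightarrow> bounded_by N 1 (indicator E)"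
  unfolding bounded_by_def by (auto simp: indicator_def)

lemma bounded_by_lim:
  assumes "\<And>n::nat. bounded_by N C (f n)" "\<And>x. x \<in> space N \<Longrightarrow> (\<lambda>n. f n x) \<longlonglongrightarrow> g x"
  shows "bounded_by N C g"
  unfolding bounded_by_def
proof (intro conjI ballI)
  show "g \<in> borel_measurable N"
    by (rule borel_measurable_LIMSEQ_metric[of f]) (use assms in \<open>auto simp: bounded_by_def\<close>)
  show "norm (g x) \<le> C" if "x \<in> space N" for x
    by (rule LIMSEQ_le_const2[OF tendsto_norm[OF assms(2)[OF that]]])
       (use assms(1) that in \<open>auto simp: bounded_by_def\<close>)
qed

lemma measure_functionalD:
  assumes "measure_functional N L"
  shows "bounded_by N C f \<Longrightarrow> bounded_by N D g \<Longrightarrow> L (\<lambda>x. f x + g x) = L f + L g"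
    and "bounded_by N C f \<Longrightarrow> L (\<lambda>x. c * f x) = c * L f"
    and "(\<And>n::nat. bounded_by N C (h n)) \<Longrightarrow> (\<And>x. x \<in> space N \<Longrightarrow> (\<lambda>n. h n x) \<longlonglongrightarrow> g x)
       \<Longrightarrow> (\<lambda>n. L (h n)) \<longlonglongrightarrow> L g"
  using assms unfolding measure_functional_def by blast+

text \<open>The constant sequence f converges to g on the space, so the limit clause of
  \<open>measure_functional\<close> already covers functions that differ outside
  \<open>space N\<close>.\<close>

lemma measure_functional_cong:
  assumes "measure_functional N L" "bounded_by N C f" "\<And>x. x \<in> space N \<Longrightarrow> f x = g x"
  shows "L f = L g"
proof -
  have "(\<lambda>n::nat. L f) \<longlonglongrightarrow> L g"
    by (rule measure_functionalD(3)[OF assms(1), where h="\<lambda>_. f"]) (use assms in auto)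
  then show ?thesis by (simp add: LIMSEQ_const_iff)
qed

lemma measure_functional_eq_nonneg:
  fixes u :: "'a \<Rightarrow> real"
  assumes L: "measure_functional N L1" "measure_functional N L2"
    and eq: "\<And>E. E \<in> sets N \<Longrightarrow> L1 (indicator E) = L2 (indicator E)"
    and u: "u \<in> borel_measurable N" "\<And>x. 0 \<le> u x"
    and C: "\<And>x. x \<in> space N \<Longrightarrow> u x \<le> C"
  shows "L1 (\<lambda>x. of_real (u x)) = L2 (\<lambda>x. of_real (u x))"
proof -
  \<comment> \<open>The bound is quantified inside because it changes under scaling, where C becomes
    C / c.\<close>
  have "\<forall>C. (\<forall>x\<in>space N. u x \<le> C) \<longrightarrow> L1 (\<lambda>x. of_real (u x)) = L2 (\<lambda>x. of_real (u x))"
    using u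
  proof (induction rule: borel_measurable_induct_real)
    case (set A)
    have "(\<lambda>x. complex_of_real (indicator A x)) = indicator A"
      by (simp add: fun_eq_iff of_real_indicator)
    then show ?case using eq[OF set] by (intro allI impI) (simp only:)
  next
    case (mult u c)
    show ?case
    proof (intro allI impI)
      fix C assume C: "\<forall>x\<in>space N. c * u x \<le> C"
      show "L1 (\<lambda>x. of_real (c * u x)) = L2 (\<lambda>x. of_real (c * u x))"
      proof (cases "c = 0")
        case True
        have "bounded_by N 0 (\<lambda>_. 0)" by (simp add: bounded_by_def)
        from measure_functionalD(2)[OF L(1) this, of 0] measure_functionalD(2)[OF L(2) this, of 0]
        show ?thesis using True by simp
      next
        case False
        then have le: "u x \<le> C / c" if "x \<in> space N" for x
          using C that mult(1) by (simp add: field_simps)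
        then have b: "bounded_by N (C / c) (\<lambda>x. of_real (u x))"
          using mult(2,3) by (auto simp: bounded_by_def)
        have "L1 (\<lambda>x. of_real (u x)) = L2 (\<lambda>x. of_real (u x))" using mult(4) le by blast
        then show ?thesis
          using measure_functionalD(2)[OF L(1) b, of "of_real c"] measure_functionalD(2)[OF L(2) b, of "of_real c"]
          by simp
      qed
    qed
  next
    case (add u v)
    show ?case
    proof (intro allI impI)
      fix C assume C: "\<forall>x\<in>space N. v x + u x \<le> C"
      have le: "u x \<le> C" "v x \<le> C" if "x \<in> space N" for x
        using C[rule_format, OF that] add.hyps(2)[of x] add.hyps(4)[of x] by linarith+
      have b: "bounded_by N C (\<lambda>x. of_real (v x))" "bounded_by N C (\<lambda>x. of_real (u x))"
        using le add.hyps by (auto simp: bounded_by_def)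
      have "L1 (\<lambda>x. of_real (u x)) = L2 (\<lambda>x. of_real (u x))" "L1 (\<lambda>x. of_real (v x)) = L2 (\<lambda>x. of_real (v x))"
        using add.IH le by blast+
      then show "L1 (\<lambda>x. of_real (v x + u x)) = L2 (\<lambda>x. of_real (v x + u x))"
        using measure_functionalD(1)[OF L(1) b] measure_functionalD(1)[OF L(2) b] by simp
    qed
  next
    case (seq U)
    show ?case
    proof (intro allI impI)
      fix C assume C: "\<forall>x\<in>space N. u x \<le> C"
      have le: "U i x \<le> C" if "x \<in> space N" for i x
      proof -
        have "U i x \<le> u x"
          by (rule incseq_le[OF _ seq.hyps(4)[OF that]]) (use seq.hyps(3) in \<open>auto simp: incseq_def le_fun_def\<close>)
        then show ?thesis using C that by force
      qed
      have b: "bounded_by N C (\<lambda>x. of_real (U i x))" for i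
        using le seq.hyps by (auto simp: bounded_by_def)
      have "L1 (\<lambda>x. of_real (U i x)) = L2 (\<lambda>x. of_real (U i x))" for i
        using seq.IH le by blast
      then have "(\<lambda>i. L1 (\<lambda>x. of_real (U i x))) \<longlonglongrightarrow> L2 (\<lambda>x. of_real (u x))"
        using measure_functionalD(3)[OF L(2) b, where g="\<lambda>x. of_real (u x)"] seq.hyps(4)
        by (simp add: tendsto_of_real)
      moreover have "(\<lambda>i. L1 (\<lambda>x. of_real (U i x))) \<longlonglongrightarrow> L1 (\<lambda>x. of_real (u x))"
        using measure_functionalD(3)[OF L(1) b, where g="\<lambda>x. of_real (u x)"] seq.hyps(4)
        by (simp add: tendsto_of_real)
      ultimately show "L1 (\<lambda>x. of_real (u x)) = L2 (\<lambda>x. of_real (u x))"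
        by (rule LIMSEQ_unique[rotated])
    qed
  qed
  then show ?thesis using C by blast
qed

lemma measure_functional_eqI:
  assumes L: "measure_functional N L1" "measure_functional N L2"
    and eq: "\<And>E. E \<in> sets N \<Longrightarrow> L1 (indicator E) = L2 (indicator E)"
    and f: "bounded_by N C f"
  shows "L1 f = L2 f"
proof -
  have [measurable]: "f \<in> borel_measurable N" using f by (simp add: bounded_by_def)
  have re: "\<bar>Re (f x)\<bar> \<le> C" and im: "\<bar>Im (f x)\<bar> \<le> C" if "x \<in> space N" for x
    using f that abs_Re_le_cmod[of "f x"] abs_Im_le_cmod[of "f x"] by (force simp: bounded_by_def)+
  define p where "p = (\<lambda>g :: 'a \<Rightarrow> real. \<lambda>x. complex_of_real (max 0 (g x)))"
  have b: "bounded_by N C (p g)" and e: "L1 (p g) = L2 (p g)"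
    if [measurable]: "g \<in> borel_measurable N" and g: "\<And>x. x \<in> space N \<Longrightarrow> \<bar>g x\<bar> \<le> C" for g
  proof -
    have le: "max 0 (g x) \<le> C" if "x \<in> space N" for x
      using g[OF that] by (cases "g x \<ge> 0") (auto simp: max_def abs_if)
    then show "bounded_by N C (p g)" unfolding bounded_by_def p_def by auto
    show "L1 (p g) = L2 (p g)" unfolding p_def
      by (rule measure_functional_eq_nonneg[OF L eq, where C=C]) (use le in auto)
  qed
  let ?r = "\<lambda>x. Re (f x)" and ?i = "\<lambda>x. Im (f x)"
  have dec: "f = (\<lambda>x. (p ?r x + (-1) * p (\<lambda>x. - ?r x) x) + \<i> * (p ?i x + (-1) * p (\<lambda>x. - ?i x) x))"
    by (auto simp: fun_eq_iff p_def complex_eq_iff max_def)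
  have bb: "bounded_by N C (p ?r)" "bounded_by N C (p (\<lambda>x. - ?r x))"
    "bounded_by N C (p ?i)" "bounded_by N C (p (\<lambda>x. - ?i x))"
    by (intro b; use re im in simp)+
  note B = bounded_by_scale bounded_by_add bb
  have expand: "L f = (L (p ?r) + (-1) * L (p (\<lambda>x. - ?r x))) + \<i> * (L (p ?i) + (-1) * L (p (\<lambda>x. - ?i x)))"
    if "measure_functional N L" for L
    by (subst dec)
       (simp only: measure_functionalD(1)[OF that bounded_by_add[OF bb(1) bounded_by_scale[OF bb(2)]]
            bounded_by_scale[OF bounded_by_add[OF bb(3) bounded_by_scale[OF bb(4)]]]]
          measure_functionalD(1)[OF that bb(1) bounded_by_scale[OF bb(2)]]
          measure_functionalD(1)[OF that bb(3) bounded_by_scale[OF bb(4)]]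
          measure_functionalD(2)[OF that bounded_by_add[OF bb(3) bounded_by_scale[OF bb(4)]]]
          measure_functionalD(2)[OF that bb(2)] measure_functionalD(2)[OF that bb(4)])
  have "L1 (p ?r) = L2 (p ?r)" "L1 (p (\<lambda>x. - ?r x)) = L2 (p (\<lambda>x. - ?r x))"
    "L1 (p ?i) = L2 (p ?i)" "L1 (p (\<lambda>x. - ?i x)) = L2 (p (\<lambda>x. - ?i x))"
    by (intro e; use re im in simp)+
  then show ?thesis unfolding expand[OF L(1)] expand[OF L(2)] by simp
qed

lemma measure_functional_integral:
  assumes "finite_measure p" "sets p = sets N"
  shows "measure_functional N (\<lambda>f. \<integral>x. f x \<partial>p)"
proof -
  interpret finite_measure p by fact
  have sp: "space p = space N" by (rule sets_eq_imp_space_eq[OF assms(2)])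
  have m: "f \<in> borel_measurable p" if "bounded_by N C f" for C f
    using that by (simp add: bounded_by_def measurable_cong_sets[OF assms(2) refl])
  have i: "integrable p f" if "bounded_by N C f" for C f
    using m[OF that] that by (intro integrable_const_bound[of f C]) (auto simp: bounded_by_def sp)
  show ?thesis
    unfolding measure_functional_def
  proof (intro conjI allI impI)
    fix f :: "nat \<Rightarrow> 'a \<Rightarrow> complex" and g C
    assume f: "\<forall>n. bounded_by N C (f n)" "\<forall>x\<in>space N. (\<lambda>n. f n x) \<longlonglongrightarrow> g x"
    show "(\<lambda>n. \<integral>x. f n x \<partial>p) \<longlonglongrightarrow> (\<integral>x. g x \<partial>p)"
    proof (rule integral_dominated_convergence[where w="\<lambda>_. C"])
      show "g \<in> borel_measurable p" by (rule m[OF bounded_by_lim]) (use f in auto)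
      show "f n \<in> borel_measurable p" for n using m f by blast
    qed (use f in \<open>auto simp: bounded_by_def sp\<close>)
  qed (use i in auto)
qed

lemma norm_integral_le:
  assumes p: "finite_measure p" "sets p = sets N" and f: "bounded_by N C f"
  shows "norm (\<integral>x. f x \<partial>p) \<le> measure p (space p) * C"
proof -
  interpret finite_measure p by fact
  have sp: "space p = space N" by (rule sets_eq_imp_space_eq[OF p(2)])
  have "f \<in> borel_measurable p" using f by (simp add: bounded_by_def measurable_cong_sets[OF p(2) refl])
  then have i: "integrable p f"
    using f by (intro integrable_const_bound[of f C]) (auto simp: bounded_by_def sp)
  have "norm (\<integral>x. f x \<partial>p) \<le> (\<integral>x. norm (f x) \<partial>p)" by (rule integral_norm_bound)
  also have "\<dots> \<le> (\<integral>x. C \<partial>p)"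
    by (rule integral_mono) (use i f in \<open>auto simp: bounded_by_def sp\<close>)
  finally show ?thesis by simp
qed

lemma measure_functional_add:
  assumes "measure_functional N L1" "measure_functional N L2"
  shows "measure_functional N (\<lambda>f. L1 f + L2 f)"
  unfolding measure_functional_def
proof (intro conjI allI impI)
  note D = measure_functionalD[OF assms(1)] and D' = measure_functionalD[OF assms(2)]
  show "L1 (\<lambda>x. f x + g x) + L2 (\<lambda>x. f x + g x) = L1 f + L2 f + (L1 g + L2 g)"
    if "bounded_by N C f" "bounded_by N D g" for f g C D
    using D(1)[OF that] D'(1)[OF that] by simp
  show "L1 (\<lambda>x. c * f x) + L2 (\<lambda>x. c * f x) = c * (L1 f + L2 f)" if "bounded_by N C f" for f C c
    using D(2)[OF that] D'(2)[OF that] by (simp add: distrib_left)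
  show "(\<lambda>n. L1 (f n) + L2 (f n)) \<longlonglongrightarrow> L1 g + L2 g"
    if "\<forall>n. bounded_by N C (f n)" "\<forall>x\<in>space N. (\<lambda>n. f n x) \<longlonglongrightarrow> g x" for f g C
    using that by (intro tendsto_add D(3)[of C f g] D'(3)[of C f g]) auto
qed

lemma measure_functional_scale:
  assumes "measure_functional N L"
  shows "measure_functional N (\<lambda>f. c * L f)"
  unfolding measure_functional_def
proof (intro conjI allI impI)
  note D = measure_functionalD[OF assms]
  show "c * L (\<lambda>x. f x + g x) = c * L f + c * L g"
    if "bounded_by N C f" "bounded_by N D g" for f g C D
    using D(1)[OF that] by (simp add: distrib_left)
  show "c * L (\<lambda>x. d * f x) = d * (c * L f)" if "bounded_by N C f" for f C d
    using D(2)[OF that] by simp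
  show "(\<lambda>n. c * L (f n)) \<longlonglongrightarrow> c * L g"
    if "\<forall>n. bounded_by N C (f n)" "\<forall>x\<in>space N. (\<lambda>n. f n x) \<longlonglongrightarrow> g x" for f g C
    using that by (intro tendsto_mult_left D(3)[of C f g]) auto
qed

lemma measure_functional_signed_integral:
  assumes "signed_measure N s"
  shows "measure_functional N (signed_integral N s)"
proof -
  note m = signed_measure_uminus[OF assms]
  have "measure_functional N (\<lambda>f. (\<integral>x. f x \<partial>positive_variation N s)
      + (-1) * (\<integral>x. f x \<partial>positive_variation N (\<lambda>E. - s E)))"
    by (intro measure_functional_add measure_functional_scale measure_functional_integral
        finite_positive_variation assms m sets_positive_variation)
  then show ?thesis by (simp add: signed_integral_def[abs_def])
qed

lemma integral_complex_indicator:
  assumes "E \<in> sets p"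
  shows "(\<integral>x. indicator E x \<partial>p) = complex_of_real (measure p E)"
proof -
  have "(\<integral>x. indicator E x \<partial>p) = (\<integral>x. complex_of_real (indicator E x) \<partial>p)"
    by (simp add: of_real_indicator)
  also have "\<dots> = complex_of_real (\<integral>x. indicator E x \<partial>p)"
    by (rule integral_complex_of_real)
  finally show ?thesis
    using sets.sets_into_space[OF assms] by (simp add: Int_absorb2)
qed

lemma signed_integral_indicator:
  assumes s: "signed_measure N s" and E: "E \<in> sets N"
  shows "signed_integral N s (indicator E) = of_real (s E)"
proof -
  have "E \<in> sets (positive_variation N s)" "E \<in> sets (positive_variation N (\<lambda>E. - s E))"
    using E sets_positive_variation[OF s] sets_positive_variation[OF signed_measure_uminus[OF s]] by auto
  then show ?thesis
    by (simp add: signed_integral_def integral_complex_indicator jordan_decomposition[OF s E])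
qed

lemma measure_functional_complex_integral:
  assumes "\<mu> \<in> complex_measures N"
  shows "measure_functional N (complex_integral N \<mu>)"
  unfolding complex_integral_def[abs_def]
  by (intro measure_functional_add measure_functional_scale measure_functional_signed_integral
      complex_measure_signed assms)

lemma complex_integral_indicator:
  assumes "\<mu> \<in> complex_measures N" "E \<in> sets N"
  shows "complex_integral N \<mu> (indicator E) = \<mu> E"
  using signed_integral_indicator[OF complex_measure_signed(1)[OF assms(1)] assms(2)]
    signed_integral_indicator[OF complex_measure_signed(2)[OF assms(1)] assms(2)]
  by (simp add: complex_integral_def complex_eq_iff)

text \<open>V adds the masses of the four Jordan parts. It keeps the inner integral of a convolution
  bounded as a function of the outer variable.\<close>

lemma complex_integral_bound:
  assumes "\<mu> \<in> complex_measures N"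
  shows "\<exists>V\<ge>0. \<forall>f C. bounded_by N C f \<longrightarrow> norm (complex_integral N \<mu> f) \<le> V * C"
proof -
  note s = complex_measure_signed[OF assms]
  define t where "t s = measure (positive_variation N s) (space N)" for s
  have t: "norm (\<integral>x. f x \<partial>positive_variation N s) \<le> t s * C"
    if "signed_measure N s" "bounded_by N C f" for s f C
    using norm_integral_le[OF finite_positive_variation[OF that(1)] sets_positive_variation[OF that(1)] that(2)]
    by (simp add: t_def that(1))
  let ?r = "\<lambda>E. Re (\<mu> E)" and ?i = "\<lambda>E. Im (\<mu> E)"
  let ?V = "(t ?r + t (\<lambda>E. - ?r E)) + (t ?i + t (\<lambda>E. - ?i E))"
  have si: "norm (signed_integral N s f) \<le> (t s + t (\<lambda>E. - s E)) * C"
    if "signed_measure N s" "bounded_by N C f" for s f C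
    unfolding signed_integral_def
    using norm_triangle_ineq4[of "\<integral>x. f x \<partial>positive_variation N s" "\<integral>x. f x \<partial>positive_variation N (\<lambda>E. - s E)"]
      t[OF that] t[OF signed_measure_uminus[OF that(1)] that(2)] by (simp add: distrib_right)
  have "norm (complex_integral N \<mu> f) \<le> ?V * C" if "bounded_by N C f" for f C
    unfolding complex_integral_def
    using norm_triangle_ineq[of "signed_integral N ?r f" "\<i> * signed_integral N ?i f"]
      si[OF s(1) that] si[OF s(2) that] by (simp add: norm_mult distrib_right)
  moreover have "?V \<ge> 0" by (simp add: t_def)
  ultimately show ?thesis by blast
qed

text \<open>The passage back from functionals to set functions: both convolutions are given by their
  values on sets, and here they become complex measures whose integral is the known
  functional.\<close>

lemma complex_measure_of_functional:
  assumes L: "measure_functional N L" and \<mu>: "\<And>E. E \<in> sets N \<Longrightarrow> \<mu> E = L (indicator E)"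
  shows "\<mu> \<in> complex_measures N"
    and "bounded_by N C f \<Longrightarrow> complex_integral N \<mu> f = L f"
proof -
  show cm: "\<mu> \<in> complex_measures N"
    unfolding complex_measures_def
  proof (intro CollectI allI impI)
    fix E :: "nat \<Rightarrow> 'a set"
    assume E: "range E \<subseteq> sets N" "disjoint_family E"
    have UN: "(\<Sum>i<n. \<mu> (E i)) = L (indicator (\<Union>i<n. E i))" for n
    proof (induction n)
      case 0
      have "bounded_by N 0 (\<lambda>_. 0)" by (simp add: bounded_by_def)
      from measure_functionalD(2)[OF L this, of 0] have "L (\<lambda>_. 0) = 0" by simp
      then show ?case by simp
    next
      case (Suc n)
      have S: "(\<Union>i<n. E i) \<in> sets N" "E n \<in> sets N" using E(1) by auto
      have "(\<Union>i<n. E i) \<inter> E n = {}" by (rule disjoint_family_UN_less[OF E(2)])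
      then have ind: "indicator (\<Union>i<Suc n. E i) = (\<lambda>x. indicator (\<Union>i<n. E i) x + indicator (E n) x :: complex)"
        by (auto simp: fun_eq_iff lessThan_Suc indicator_def)
      show ?case
        unfolding ind
        by (subst measure_functionalD(1)[OF L bounded_by_indicator[OF S(1)] bounded_by_indicator[OF S(2)]])
           (simp add: Suc \<mu>[OF S(2)])
    qed
    have "(\<lambda>n. L (indicator (\<Union>i<n. E i))) \<longlonglongrightarrow> L (indicator (\<Union>i. E i))"
      by (rule measure_functionalD(3)[OF L bounded_by_indicator])
         (use E(1) in \<open>auto intro: LIMSEQ_indicator_UN\<close>)
    moreover have "\<mu> (\<Union>i. E i) = L (indicator (\<Union>i. E i))" using E(1) by (intro \<mu>) auto
    ultimately show "(\<lambda>n. \<mu> (E n)) sums \<mu> (\<Union>n. E n)" by (simp add: sums_def UN)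
  qed
  show "complex_integral N \<mu> f = L f" if "bounded_by N C f"
    by (rule measure_functional_eqI[OF measure_functional_complex_integral[OF cm] L _ that])
       (simp add: complex_integral_indicator[OF cm] \<mu>)
qed

lemma complex_integral_measurable:
  assumes \<mu>: "\<mu> \<in> complex_measures N" and K: "(\<lambda>(y, x). K y x) \<in> borel_measurable (N' \<Otimes>\<^sub>M N)"
  shows "(\<lambda>y. complex_integral N \<mu> (\<lambda>x. K y x)) \<in> borel_measurable N'"
proof -
  have *: "(\<lambda>y. \<integral>x. K y x \<partial>p) \<in> borel_measurable N'"
    if "finite_measure p" "sets p = sets N" for p
  proof -
    interpret finite_measure p by fact
    have "(\<lambda>(y, x). K y x) \<in> borel_measurable (N' \<Otimes>\<^sub>M p)"
      using K by (simp cong: measurable_cong_sets sets_pair_measure_cong add: that(2))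
    then show ?thesis by (rule borel_measurable_lebesgue_integral)
  qed
  note s = complex_measure_signed[OF \<mu>]
  have [measurable]: "(\<lambda>y. \<integral>x. K y x \<partial>positive_variation N s) \<in> borel_measurable N'"
    if "signed_measure N s" for s
    by (rule *[OF finite_positive_variation[OF that] sets_positive_variation[OF that]])
  show ?thesis
    unfolding complex_integral_def signed_integral_def
    using s signed_measure_uminus[OF s(1)] signed_measure_uminus[OF s(2)] by measurable
qed

text \<open>Used for the cylinder with \<open>product_kernel\<close> and for the half-line with
  \<open>\<pi>\<close>. In the measurability condition the outer variable y comes first, in the
  order of integration.\<close>

lemma convolution_functional:
  assumes \<mu>: "\<mu> \<in> complex_measures N1" and \<nu>: "\<nu> \<in> complex_measures N2"
    and \<kappa>: "(\<lambda>(y, x). \<kappa> x y) \<in> N2 \<Otimes>\<^sub>M N1 \<rightarrow>\<^sub>M subprob_algebra N"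
  defines "L \<equiv> \<lambda>f. complex_integral N2 \<nu> (\<lambda>y. complex_integral N1 \<mu> (\<lambda>x. \<integral>z. f z \<partial>\<kappa> x y))"
  shows "measure_functional N L"
    and "E \<in> sets N \<Longrightarrow> L (indicator E) = complex_integral N2 \<nu> (\<lambda>y. complex_integral N1 \<mu> (\<lambda>x. of_real (measure (\<kappa> x y) E)))"
proof -
  have k: "subprob_space (\<kappa> x y)" "sets (\<kappa> x y) = sets N" if "y \<in> space N2" "x \<in> space N1" for x y
  proof -
    have "\<kappa> x y \<in> space (subprob_algebra N)"
      using measurable_space[OF \<kappa>, of "(y, x)"] that by (simp add: space_pair_measure)
    then show "subprob_space (\<kappa> x y)" "sets (\<kappa> x y) = sets N" by (auto simp: space_subprob_algebra)
  qed
  have kf: "measure_functional N (\<lambda>f. \<integral>z. f z \<partial>\<kappa> x y)" if "y \<in> space N2" "x \<in> space N1" for x y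
    using k[OF that] by (intro measure_functional_integral) (auto simp: subprob_space_def)
  note M = measure_functional_complex_integral[OF \<mu>] and M' = measure_functional_complex_integral[OF \<nu>]
  obtain V where V: "V \<ge> 0" "\<And>f C. bounded_by N1 C f \<Longrightarrow> norm (complex_integral N1 \<mu> f) \<le> V * C"
    using complex_integral_bound[OF \<mu>] by blast
  define I where "I = (\<lambda>(f :: _ \<Rightarrow> complex) y x. \<integral>z. f z \<partial>\<kappa> x y)"
  have Im: "(\<lambda>(y, x). I f y x) \<in> borel_measurable (N2 \<Otimes>\<^sub>M N1)" if "bounded_by N C f" for f C
  proof -
    have "f \<in> borel_measurable N" using that by (simp add: bounded_by_def)
    from measurable_compose[OF \<kappa> integral_measurable_subprob_algebra[OF this]]
    show ?thesis by (simp add: I_def case_prod_beta)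
  qed
  have Ib: "bounded_by N1 C (I f y)" if f: "bounded_by N C f" "C \<ge> 0" and y: "y \<in> space N2" for f C y
    unfolding bounded_by_def
  proof (intro conjI ballI)
    show "I f y \<in> borel_measurable N1"
      using measurable_compose[OF measurable_Pair1'[OF y] Im[OF f(1)]] by simp
    fix x assume x: "x \<in> space N1"
    interpret subprob_space "\<kappa> x y" by (rule k(1)[OF y x])
    have "norm (I f y x) \<le> measure (\<kappa> x y) (space (\<kappa> x y)) * C"
      unfolding I_def by (rule norm_integral_le[OF finite_measure_axioms k(2)[OF y x] f(1)])
    also have "\<dots> \<le> C" using f(2) subprob_measure_le_1 by (simp add: mult_left_le_one_le)
    finally show "norm (I f y x) \<le> C" .
  qed
  have Jb: "bounded_by N2 (V * C) (\<lambda>y. complex_integral N1 \<mu> (I f y))" if "bounded_by N C f" "C \<ge> 0" for f C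
    unfolding bounded_by_def
    using complex_integral_measurable[OF \<mu> Im[OF that(1)]] V(2)[OF Ib[OF that]] by simp
  \<comment> \<open>On an empty space even a negative C is a bound, and estimates such as
    \<open>measure * C <= C\<close> may then fail; hence the maximum with 0.\<close>
  have bp: "bounded_by N (max C 0) f" if "bounded_by N C f" for f C
    using that by (auto simp: bounded_by_def le_max_iff_disj)
  have L: "L f = complex_integral N2 \<nu> (\<lambda>y. complex_integral N1 \<mu> (I f y))" for f
    by (simp add: L_def I_def)
  show "measure_functional N L"
    unfolding measure_functional_def
  proof (intro conjI allI impI)
    fix f g C D assume f: "bounded_by N C f" and g: "bounded_by N D g"
    let ?C = "max C 0" and ?D = "max D 0"
    have b: "bounded_by N ?C f" "bounded_by N ?D g" using f g by (auto intro: bp)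
    have "complex_integral N1 \<mu> (I (\<lambda>z. f z + g z) y)
        = complex_integral N1 \<mu> (I f y) + complex_integral N1 \<mu> (I g y)" if y: "y \<in> space N2" for y
    proof -
      have "complex_integral N1 \<mu> (I (\<lambda>z. f z + g z) y) = complex_integral N1 \<mu> (\<lambda>x. I f y x + I g y x)"
      proof (rule measure_functional_cong[OF M Ib[OF bounded_by_add[OF b] _ y]])
        show "I (\<lambda>z. f z + g z) y x = I f y x + I g y x" if "x \<in> space N1" for x
          unfolding I_def by (rule measure_functionalD(1)[OF kf[OF y that] f g])
      qed simp
      then show ?thesis
        using measure_functionalD(1)[OF M Ib[OF b(1) _ y] Ib[OF b(2) _ y]] by simp
    qed
    then have "L (\<lambda>z. f z + g z) = complex_integral N2 \<nu> (\<lambda>y. complex_integral N1 \<mu> (I f y) + complex_integral N1 \<mu> (I g y))"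
      unfolding L by (intro measure_functional_cong[OF M' Jb[OF bounded_by_add[OF b]]]) auto
    then show "L (\<lambda>z. f z + g z) = L f + L g"
      unfolding L using measure_functionalD(1)[OF M' Jb[OF b(1)] Jb[OF b(2)]] by simp
  next
    fix f C and c :: complex assume f: "bounded_by N C f"
    let ?C = "max C 0"
    have b: "bounded_by N ?C f" using f by (rule bp)
    have "complex_integral N1 \<mu> (I (\<lambda>z. c * f z) y) = c * complex_integral N1 \<mu> (I f y)" if y: "y \<in> space N2" for y
    proof -
      have "complex_integral N1 \<mu> (I (\<lambda>z. c * f z) y) = complex_integral N1 \<mu> (\<lambda>x. c * I f y x)"
      proof (rule measure_functional_cong[OF M Ib[OF bounded_by_scale[OF b] _ y]])
        show "I (\<lambda>z. c * f z) y x = c * I f y x" if "x \<in> space N1" for x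
          unfolding I_def by (rule measure_functionalD(2)[OF kf[OF y that] f])
      qed simp
      then show ?thesis
        using measure_functionalD(2)[OF M Ib[OF b _ y]] by simp
    qed
    then have "L (\<lambda>z. c * f z) = complex_integral N2 \<nu> (\<lambda>y. c * complex_integral N1 \<mu> (I f y))"
      unfolding L by (intro measure_functional_cong[OF M' Jb[OF bounded_by_scale[OF b]]]) auto
    then show "L (\<lambda>z. c * f z) = c * L f"
      unfolding L using measure_functionalD(2)[OF M' Jb[OF b]] by simp
  next
    fix f :: "nat \<Rightarrow> 'c \<Rightarrow> complex" and g C
    assume f: "\<forall>n. bounded_by N C (f n)" "\<forall>z\<in>space N. (\<lambda>n. f n z) \<longlonglongrightarrow> g z"
    let ?C = "max C 0"
    have b: "bounded_by N ?C (f n)" for n using f(1) by (auto intro: bp)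
    have "(\<lambda>n. complex_integral N1 \<mu> (I (f n) y)) \<longlonglongrightarrow> complex_integral N1 \<mu> (I g y)" if y: "y \<in> space N2" for y
    proof (rule measure_functionalD(3)[OF M Ib[OF b _ y]])
      show "(\<lambda>n. I (f n) y x) \<longlonglongrightarrow> I g y x" if "x \<in> space N1" for x
        unfolding I_def by (rule measure_functionalD(3)[OF kf[OF y that] b]) (use f(2) in auto)
    qed simp
    then show "(\<lambda>n. L (f n)) \<longlonglongrightarrow> L g"
      unfolding L by (intro measure_functionalD(3)[OF M' Jb[OF b]]) auto
  qed
  assume E: "E \<in> sets N"
  have ind: "I (indicator E) y x = of_real (measure (\<kappa> x y) E)" if "y \<in> space N2" "x \<in> space N1" for x y
  proof -
    interpret subprob_space "\<kappa> x y" by (rule k(1)[OF that])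
    have "E \<in> sets (\<kappa> x y)" using E k(2)[OF that] by simp
    then show ?thesis unfolding I_def by (rule integral_complex_indicator)
  qed
  have b: "bounded_by N 1 (indicator E)" by (rule bounded_by_indicator[OF E])
  have "complex_integral N1 \<mu> (I (indicator E) y) = complex_integral N1 \<mu> (\<lambda>x. of_real (measure (\<kappa> x y) E))"
    if "y \<in> space N2" for y
    by (rule measure_functional_cong[OF M Ib[OF b _ that]]) (use ind that in auto)
  then show "L (indicator E) = complex_integral N2 \<nu> (\<lambda>y. complex_integral N1 \<mu> (\<lambda>x. of_real (measure (\<kappa> x y) E)))"
    unfolding L by (intro measure_functional_cong[OF M' Jb[OF b]]) auto
qed

section \<open>The torus and the cylinder\<close>

lemma abs_torus_eq_iff: "abs_torus s = abs_torus t \<longleftrightarrow> s - t \<in> \<int>"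
  by (rule torus.abs_eq_iff)

lemma open_abs_torus_vimage: "open U \<Longrightarrow> open (abs_torus -` U)"
  by (simp add: open_torus_def)

text \<open>The preimage of the image is the union of the integer translates of S.\<close>

lemma open_abs_torus_image:
  assumes "open S"
  shows "open (abs_torus ` S)"
proof -
  have "abs_torus -` (abs_torus ` S) = (\<Union>n\<in>\<int>. (\<lambda>s. n + s) ` S)"
  proof (intro set_eqI iffI)
    fix t assume "t \<in> abs_torus -` (abs_torus ` S)"
    then obtain s where s: "s \<in> S" "t - s \<in> \<int>" by (auto simp: abs_torus_eq_iff)
    then have "t = (t - s) + s" by simp
    with s show "t \<in> (\<Union>n\<in>\<int>. (\<lambda>s. n + s) ` S)" by blast
  next
    fix t assume "t \<in> (\<Union>n\<in>\<int>. (\<lambda>s. n + s) ` S)"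
    then obtain n s where "n \<in> \<int>" "s \<in> S" "t = n + s" by auto
    then have "abs_torus t = abs_torus s" by (simp add: abs_torus_eq_iff)
    with \<open>s \<in> S\<close> show "t \<in> abs_torus -` (abs_torus ` S)" by auto
  qed
  moreover have "open (\<Union>n\<in>\<int>. (\<lambda>s. n + s) ` S)"
    by (intro open_UN ballI open_translation assms)
  ultimately show ?thesis by (simp add: open_torus_def)
qed

lemma abs_torus_surj: "\<exists>t. x = abs_torus t"
  by (metis Quotient_torus Quotient_abs_rep)

text \<open>Second countability identifies the Borel sets of products with the torus as product
  sigma-algebras (\<open>borel_prod\<close>).\<close>

instance torus :: second_countable_topology
proof
  obtain B :: "real set set" where B: "countable B" "topological_basis B"
    using ex_countable_basis by blast
  have "topological_basis ((`) abs_torus ` B)"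
  proof (rule topological_basisI)
    show "open S" if "S \<in> (`) abs_torus ` B" for S
      using that open_abs_torus_image topological_basis_open[OF B(2)] by auto
    fix U and x :: torus assume U: "open U" "x \<in> U"
    obtain t where t: "x = abs_torus t" using abs_torus_surj by blast
    obtain S where "S \<in> B" "t \<in> S" "S \<subseteq> abs_torus -` U"
      using topological_basisE[OF B(2) open_abs_torus_vimage[OF U(1)], of t] U(2) t by auto
    then show "\<exists>S\<in>(`) abs_torus ` B. x \<in> S \<and> S \<subseteq> U" using t by auto
  qed
  then show "\<exists>B :: torus set set. countable B \<and> open = generate_topology B"
    using B(1) by (intro exI[of _ "(`) abs_torus ` B"]) (auto dest: topological_basis_imp_subbasis)
qed

lemma continuous_torus_add: "continuous_on UNIV (\<lambda>p :: torus \<times> torus. fst p + snd p)"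
proof (rule continuous_on_open_vimage[THEN iffD2, OF open_UNIV], intro allI impI)
  fix U :: "torus set" assume U: "open U"
  have "\<exists>S. open S \<and> p \<in> S \<and> S \<subseteq> (\<lambda>p. fst p + snd p) -` U \<inter> UNIV"
    if p: "p \<in> (\<lambda>p :: torus \<times> torus. fst p + snd p) -` U \<inter> UNIV" for p
  proof -
    obtain s t where st: "fst p = abs_torus s" "snd p = abs_torus t" using abs_torus_surj by metis
    have "s + t \<in> abs_torus -` U" using p st by (simp add: plus_torus.abs_eq)
    then obtain e where e: "e > 0" "ball (s + t) e \<subseteq> abs_torus -` U"
      using open_abs_torus_vimage[OF U] open_contains_ball by blast
    let ?S = "abs_torus ` ball s (e / 2) \<times> abs_torus ` ball t (e / 2)"
    have "open ?S" by (intro open_Times open_abs_torus_image open_ball)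
    moreover have "p \<in> ?S" using st e by (auto simp: mem_Times_iff)
    moreover have "?S \<subseteq> (\<lambda>p. fst p + snd p) -` U"
    proof
      fix q assume "q \<in> ?S"
      then obtain s' t' where q: "q = (abs_torus s', abs_torus t')" "dist s s' < e / 2" "dist t t' < e / 2"
        by auto
      have "dist (s + t) (s' + t') < e" using dist_triangle_add[of s t s' t'] q by linarith
      then show "q \<in> (\<lambda>p. fst p + snd p) -` U" using e(2) q(1) by (auto simp: plus_torus.abs_eq)
    qed
    ultimately show ?thesis by auto
  qed
  then show "open ((\<lambda>p :: torus \<times> torus. fst p + snd p) -` U \<inter> UNIV)"
    by (subst open_subopen) blast
qed

lemma torus_char_abs: "torus_char k (abs_torus t) = exp (\<i> * of_real (2 * of_int k * pi * t))"
  by (rule torus_char.abs_eq)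

lemma continuous_torus_char: "continuous_on UNIV (torus_char k)"
proof (rule continuous_on_open_vimage[THEN iffD2, OF open_UNIV], intro allI impI)
  fix U :: "complex set" assume U: "open U"
  have "continuous_on UNIV (\<lambda>t. torus_char k (abs_torus t))"
    unfolding torus_char_abs by (intro continuous_intros)
  then have "open ((\<lambda>t. torus_char k (abs_torus t)) -` U)"
    using U by (simp add: continuous_on_open_vimage)
  then show "open (torus_char k -` U \<inter> UNIV)"
    by (simp add: open_torus_def vimage_def)
qed

lemma norm_torus_char: "norm (torus_char k \<theta>) = 1"
proof -
  obtain t where "\<theta> = abs_torus t" using abs_torus_surj by blast
  then show ?thesis by (simp only: torus_char_abs norm_exp_i_times)
qed

lemma torus_char_add: "torus_char k (\<theta> + \<theta>') = torus_char k \<theta> * torus_char k \<theta>'"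
proof -
  obtain s t where "\<theta> = abs_torus s" "\<theta>' = abs_torus t" using abs_torus_surj by metis
  then show ?thesis
    by (simp only: plus_torus.abs_eq torus_char_abs exp_add[symmetric]) (simp add: algebra_simps)
qed

lemma torus_char_measurable [measurable]: "torus_char k \<in> borel_measurable borel"
  by (rule borel_measurable_continuous_onI[OF continuous_torus_char])

lemma torus_add_measurable: "(\<lambda>p :: torus \<times> torus. fst p + snd p) \<in> borel \<Otimes>\<^sub>M borel \<rightarrow>\<^sub>M borel"
  unfolding borel_prod by (rule borel_measurable_continuous_onI[OF continuous_torus_add])

lemma space_half_line [simp]: "space half_line = {0..}"
  by (simp add: half_line_def space_restrict_space)

lemma space_cylinder [simp]: "space cylinder = {0..} \<times> UNIV"
  by (simp add: cylinder_def space_restrict_space)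

lemma half_line_borel: "(\<lambda>x. x) \<in> half_line \<rightarrow>\<^sub>M borel"
  unfolding half_line_def by (rule measurable_restrict_space1) simp

lemma sets_half_line: "J \<in> sets half_line \<Longrightarrow> J \<in> sets borel"
  unfolding half_line_def by (auto simp: sets_restrict_space)

lemma fst_cylinder [measurable]: "fst \<in> cylinder \<rightarrow>\<^sub>M half_line"
  unfolding cylinder_def half_line_def
  by (rule measurable_restrict_space3) (auto simp: borel_prod[symmetric])

lemma snd_cylinder [measurable]: "snd \<in> cylinder \<rightarrow>\<^sub>M borel"
  unfolding cylinder_def
  by (rule measurable_restrict_space1) (auto simp: borel_prod[symmetric])

text \<open>\<open>cylinder\<close> is a restricted Borel space while \<open>product_kernel\<close>
  consists of product measures; this reconciles the two.\<close>

lemma sets_cylinder: "sets cylinder = sets (half_line \<Otimes>\<^sub>M (borel :: torus measure))"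
proof
  have "(\<lambda>x. (fst x, snd x)) \<in> cylinder \<rightarrow>\<^sub>M half_line \<Otimes>\<^sub>M (borel :: torus measure)"
    by (intro measurable_Pair fst_cylinder snd_cylinder)
  then have 1: "(\<lambda>x. x) \<in> cylinder \<rightarrow>\<^sub>M half_line \<Otimes>\<^sub>M (borel :: torus measure)" by simp
  show "sets (half_line \<Otimes>\<^sub>M (borel :: torus measure)) \<subseteq> sets cylinder"
  proof
    fix E assume E: "E \<in> sets (half_line \<Otimes>\<^sub>M (borel :: torus measure))"
    then have "E \<subseteq> space cylinder" using sets.sets_into_space[OF E] by (auto simp: space_pair_measure)
    then show "E \<in> sets cylinder" using measurable_sets[OF 1 E] by (simp add: Int_absorb2)
  qed
  have "(\<lambda>x. (fst x, snd x)) \<in> half_line \<Otimes>\<^sub>M (borel :: torus measure) \<rightarrow>\<^sub>M borel \<Otimes>\<^sub>M borel"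
    by (intro measurable_Pair measurable_compose[OF measurable_fst half_line_borel] measurable_snd)
  then have "(\<lambda>x. x) \<in> half_line \<Otimes>\<^sub>M (borel :: torus measure) \<rightarrow>\<^sub>M borel"
    by (simp add: borel_prod)
  then have 2: "(\<lambda>x. x) \<in> half_line \<Otimes>\<^sub>M (borel :: torus measure) \<rightarrow>\<^sub>M cylinder"
    unfolding cylinder_def
    by (intro measurable_restrict_space2) (auto simp: space_pair_measure)
  show "sets cylinder \<subseteq> sets (half_line \<Otimes>\<^sub>M (borel :: torus measure))"
  proof
    fix E assume E: "E \<in> sets cylinder"
    then have "E \<subseteq> space (half_line \<Otimes>\<^sub>M (borel :: torus measure))"
      using sets.sets_into_space[OF E] by (auto simp: space_pair_measure)
    then show "E \<in> sets (half_line \<Otimes>\<^sub>M (borel :: torus measure))"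
      using measurable_sets[OF 2 E] by (simp add: Int_absorb2)
  qed
qed

section \<open>Normalized Sturm--Liouville solutions\<close>

lemma set_integral_Icc_eq_Ioc:
  fixes f :: "real \<Rightarrow> real"
  shows "(LBINT y:{0..x}. f y) = (LBINT y:{0<..x}. f y)"
  unfolding set_lebesgue_integral_def
  by (rule integral_discrete_difference[of "{0}"]) (auto simp: indicator_def)

context
  fixes A :: "real \<Rightarrow> real"
  assumes A: "admissible A"
begin

lemma A_pos: "x > 0 \<Longrightarrow> A x > 0"
  using A by (simp add: admissible_def)

lemma A_deriv: "x > 0 \<Longrightarrow> (A has_real_derivative deriv A x) (at x)"
  using A by (simp add: admissible_def DERIV_deriv_iff_real_differentiable)

lemma A_deriv_nonneg: "x > 0 \<Longrightarrow> deriv A x \<ge> 0"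
  using A A_pos[of x] by (auto simp: admissible_def zero_le_divide_iff dest!: spec[of _ x])

text \<open>The Liouville variable. Half-open intervals are used so that the results on functions
  continuous on (0, infinity) apply; \<open>zeta_eq\<close> compares with the closed
  interval.\<close>

definition liouville :: "real \<Rightarrow> real"
  where "liouville x = (LBINT y:{0<..x}. 1 / A y)"

lemma inverse_A_cont: "continuous_on {0<..} (\<lambda>x. 1 / A x)"
proof -
  have "continuous_on {0<..} A"
    using A by (auto simp: admissible_def intro: continuous_on_subset)
  then show ?thesis
    by (intro continuous_on_divide continuous_on_const) (auto dest: A_pos)
qed

lemma inverse_A_int: "set_integrable lborel {0<..R} (\<lambda>x. 1 / A x)"
  by (rule set_integrable_Ioc_extend[OF inverse_A_cont]) (use A in \<open>simp add: admissible_def\<close>)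

lemma liouville_deriv: "x > 0 \<Longrightarrow> (liouville has_real_derivative 1 / A x) (at x)"
  unfolding liouville_def by (rule DERIV_integral_Ioc[OF inverse_A_cont inverse_A_int])

lemma continuous_liouville: "continuous_on UNIV liouville"
  unfolding liouville_def by (rule continuous_integral_Ioc[OF inverse_A_cont inverse_A_int])

lemma liouville_left: "x \<le> 0 \<Longrightarrow> liouville x = 0"
  by (simp add: liouville_def set_lebesgue_integral_def)

lemma liouville_nonneg: "liouville x \<ge> 0"
  unfolding liouville_def set_lebesgue_integral_def
  using A_pos by (intro integral_nonneg_AE) (auto simp: indicator_def less_imp_le)

lemma zeta_eq: "zeta A k x = cosh (2 * of_int k * pi * liouville x)"
  by (simp add: zeta_def liouville_def set_integral_Icc_eq_Ioc)

lemma zeta_ge_1: "zeta A k x \<ge> 1"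
  by (simp add: zeta_eq cosh_real_ge_1)

lemma zeta_neq_0: "zeta A k x \<noteq> 0"
  using zeta_ge_1[of k x] by auto

lemma zeta_uminus: "zeta A (- k) x = zeta A k x"
  by (simp add: zeta_eq)

lemma continuous_zeta: "continuous_on UNIV (zeta A k)"
  unfolding zeta_eq[abs_def] by (intro continuous_intros continuous_liouville)

lemma zeta_deriv:
  "x > 0 \<Longrightarrow> (zeta A k has_real_derivative 2 * of_int k * pi * sinh (2 * of_int k * pi * liouville x) / A x) (at x)"
  unfolding zeta_eq[abs_def]
  by (rule derivative_eq_intros liouville_deriv refl | assumption)+ (simp add: field_simps)

definition sl_coeff :: "int \<Rightarrow> real \<Rightarrow> real"
  where "sl_coeff k x = A x * (zeta A k x)\<^sup>2"

text \<open>The derivative of \<open>sl_coeff\<close> after replacing A zeta' by c sinh(c l), where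
  c = 2 k pi and l is \<open>liouville\<close>. In this form each summand is nonnegative for either
  sign of k.\<close>

definition sl_coeff' :: "int \<Rightarrow> real \<Rightarrow> real"
  where "sl_coeff' k x = deriv A x * (zeta A k x)\<^sup>2
     + 2 * zeta A k x * (2 * of_int k * pi * sinh (2 * of_int k * pi * liouville x))"

lemma sl_weight_sl_coeff: "sl_weight (sl_coeff k) (sl_coeff' k)"
proof
  fix x :: real assume x: "x > 0"
  show pos: "sl_coeff k x > 0" using A_pos[OF x] zeta_ge_1[of k x] by (simp add: sl_coeff_def)
  have "(sl_coeff k has_real_derivative deriv A x * (zeta A k x)\<^sup>2
      + (2 * ((2 * of_int k * pi * sinh (2 * of_int k * pi * liouville x) / A x) * zeta A k x)) * A x) (at x)"
    unfolding sl_coeff_def[abs_def]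
    using DERIV_mult[OF A_deriv[OF x] DERIV_power[OF zeta_deriv[OF x], of k 2]] by simp
  then show "(sl_coeff k has_real_derivative sl_coeff' k x) (at x)"
    by (rule DERIV_cong) (use A_pos[OF x] in \<open>simp add: sl_coeff'_def field_simps\<close>)
  have "0 \<le> c * sinh (c * s)" if "s \<ge> 0" for c s :: real
    using that by (cases "c \<ge> 0") (auto simp: mult_nonneg_nonneg mult_nonpos_nonpos mult_nonpos_nonneg)
  from this[OF liouville_nonneg] show "sl_coeff' k x \<ge> 0"
    unfolding sl_coeff'_def using A_deriv_nonneg[OF x] zeta_ge_1[of k x]
    by (intro add_nonneg_nonneg mult_nonneg_nonneg[of "2 * zeta A k x"]) auto
next
  show "set_integrable lborel {0<..1} (\<lambda>x. 1 / sl_coeff k x)"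
  proof (rule set_integrable_bound[OF inverse_A_int[of 1]])
    have "continuous_on {0<..} A"
      using A by (auto simp: admissible_def intro: continuous_on_subset)
    then have "continuous_on {0<..} (\<lambda>x. 1 / sl_coeff k x)"
      unfolding sl_coeff_def
      by (intro continuous_on_divide continuous_on_const continuous_on_mult continuous_on_power
           continuous_on_subset[OF continuous_zeta]) (auto simp: zeta_neq_0 dest: A_pos)
    from set_borel_measurable_Ioi[OF this _ subsetI, of "{0<..1}"]
    show "set_borel_measurable lborel {0<..1} (\<lambda>x. 1 / sl_coeff k x)"
      unfolding set_borel_measurable_def by simp
    show "AE x in lborel. x \<in> {0<..1} \<longrightarrow> norm (1 / sl_coeff k x) \<le> norm (1 / A x)"
    proof (intro AE_I2 impI)
      fix x :: real assume x: "x \<in> {0<..1}"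
      have "A x * 1 \<le> A x * (zeta A k x)\<^sup>2"
        using A_pos[of x] x zeta_ge_1[of k x] by (intro mult_left_mono) (auto simp: one_le_power)
      then show "norm (1 / sl_coeff k x) \<le> norm (1 / A x)"
        using A_pos[of x] x zeta_ge_1[of k x]
        by (auto simp: sl_coeff_def abs_mult intro!: divide_left_mono mult_pos_pos)
    qed
  qed
qed

text \<open>For the weight A zeta^2 the quasi-derivative of u / zeta is the Wronskian zeta A u' - u
  A zeta'. Its derivative is free of the potential because (A zeta')' = (2 k pi)^2 zeta / A.\<close>

lemma sl_neumann:
  assumes u: "continuous_on {0..} u"
    "\<And>x. x > 0 \<Longrightarrow> (u has_real_derivative u1 x) (at x)"
    "\<And>x. x > 0 \<Longrightarrow> (u1 has_real_derivative u2 x) (at x)"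
    and eq: "\<And>x. x > 0 \<Longrightarrow> - u2 x - deriv A x / A x * u1 x + (2 * of_int k * pi)\<^sup>2 / (A x)\<^sup>2 * u x = lam * u x"
    and lim: "((\<lambda>x. A x * u1 x) \<longlongrightarrow> 0) (at_right 0)"
  shows "neumann (sl_coeff k) (\<lambda>x. u x / zeta A k x) (\<lambda>x. - lam * (u x / zeta A k x))"
proof (rule neumannI)
  define c where "c = 2 * of_int k * pi"
  define z where "z = (\<lambda>x. zeta A k x)"
  define sh where "sh = (\<lambda>x. sinh (c * liouville x))"
  have z1: "z x \<noteq> 0" for x using zeta_ge_1[of k x] by (simp add: z_def)
  have dz: "(z has_real_derivative c * sh x / A x) (at x)" if "x > 0" for x
    using zeta_deriv[OF that, of k] by (simp add: z_def c_def sh_def)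
  have dsh: "(sh has_real_derivative c * z x / A x) (at x)" if "x > 0" for x
    unfolding sh_def z_def zeta_eq c_def
    by (rule derivative_eq_intros liouville_deriv[OF that] refl)+ simp
  show "continuous_on {0..} (\<lambda>x. u x / zeta A k x)"
    using z1 by (intro continuous_on_divide u continuous_on_subset[OF continuous_zeta]) (auto simp: z_def)
  show "((\<lambda>x. u x / zeta A k x) has_real_derivative (z x * (A x * u1 x) - u x * (c * sh x)) / sl_coeff k x) (at x)"
    if x: "x > 0" for x
    unfolding z_def[symmetric, THEN fun_cong]
  proof (rule DERIV_cong[OF DERIV_divide[OF u(2)[OF x] dz[OF x] z1]])
    show "(u1 x * z x - u x * (c * sh x / A x)) / (z x * z x) = (z x * (A x * u1 x) - u x * (c * sh x)) / sl_coeff k x"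
      using A_pos[OF x] z1[of x] by (simp add: sl_coeff_def z_def[symmetric, THEN fun_cong] field_simps power2_eq_square)
  qed
  show "((\<lambda>x. z x * (A x * u1 x) - u x * (c * sh x)) has_real_derivative sl_coeff k x * (- lam * (u x / zeta A k x))) (at x)"
    if x: "x > 0" for x
  proof (rule DERIV_cong)
    show "((\<lambda>x. z x * (A x * u1 x) - u x * (c * sh x)) has_real_derivative
        ((c * sh x / A x) * (A x * u1 x) + (deriv A x * u1 x + u2 x * A x) * z x)
        - (u1 x * (c * sh x) + (c * (c * z x / A x)) * u x)) (at x)"
      by (intro DERIV_diff DERIV_mult DERIV_cmult dz dsh u A_deriv x)
    have Ax: "A x > 0" by (rule A_pos[OF x])
    have "u2 x = - deriv A x / A x * u1 x + c\<^sup>2 / (A x)\<^sup>2 * u x - lam * u x"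
      using eq[OF x] by (simp add: c_def)
    then have "deriv A x * u1 x + u2 x * A x = c\<^sup>2 / A x * u x - lam * u x * A x"
      using Ax by (simp add: field_simps power2_eq_square)
    then have "((c * sh x / A x) * (A x * u1 x) + (deriv A x * u1 x + u2 x * A x) * z x)
        - (u1 x * (c * sh x) + (c * (c * z x / A x)) * u x)
        = ((c * sh x / A x) * (A x * u1 x) + (c\<^sup>2 / A x * u x - lam * u x * A x) * z x)
        - (u1 x * (c * sh x) + (c * (c * z x / A x)) * u x)" by (simp only:)
    also have "\<dots> = - lam * u x * A x * z x"
      using Ax by (simp add: field_simps power2_eq_square)
    also have "\<dots> = sl_coeff k x * (- lam * (u x / zeta A k x))"
      using z1[of x] by (simp add: sl_coeff_def z_def power2_eq_square)
    finally show "((c * sh x / A x) * (A x * u1 x) + (deriv A x * u1 x + u2 x * A x) * z x)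
        - (u1 x * (c * sh x) + (c * (c * z x / A x)) * u x) = sl_coeff k x * (- lam * (u x / zeta A k x))" .
  qed
  have "((\<lambda>x. z x * (A x * u1 x) - u x * (c * sh x)) \<longlongrightarrow> z 0 * 0 - u 0 * (c * sh 0)) (at_right 0)"
    unfolding z_def sh_def
    by (intro tendsto_intros lim continuous_on_at_right_0 u(1) continuous_on_subset[OF continuous_zeta]
         continuous_on_subset[OF continuous_liouville]) auto
  then show "((\<lambda>x. z x * (A x * u1 x) - u x * (c * sh x)) \<longlongrightarrow> 0) (at_right 0)"
    by (simp add: sh_def liouville_left)
qed

lemma v_tilde_neumann:
  assumes "sl_solution A k (of_real lam) (v k (of_real lam))"
  shows "neumann (sl_coeff k) (\<lambda>x. Re (v_tilde A v k (of_real lam) x)) (\<lambda>x. - lam * Re (v_tilde A v k (of_real lam) x))"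
    and "neumann (sl_coeff k) (\<lambda>x. Im (v_tilde A v k (of_real lam) x)) (\<lambda>x. - lam * Im (v_tilde A v k (of_real lam) x))"
    and "v_tilde A v k (of_real lam) 0 = 1"
proof -
  let ?v = "v k (of_real lam)"
  from assms obtain v' v'' where v: "continuous_on {0..} ?v" "?v 0 = 1"
    "\<And>x. x > 0 \<Longrightarrow> (?v has_vector_derivative v' x) (at x)"
    "\<And>x. x > 0 \<Longrightarrow> (v' has_vector_derivative v'' x) (at x)"
    "\<And>x. x > 0 \<Longrightarrow> - v'' x - of_real (deriv A x / A x) * v' x
               + of_real ((2 * of_int k * pi)\<^sup>2 / (A x)\<^sup>2) * ?v x = of_real lam * ?v x"
    "((\<lambda>x. of_real (A x) * v' x) \<longlongrightarrow> 0) (at_right 0)"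
    unfolding sl_solution_def by blast
  have "zeta A k 0 = 1" by (simp add: zeta_eq liouville_left)
  then show "v_tilde A v k (of_real lam) 0 = 1" by (simp add: v_tilde_def v(2))
  \<comment> \<open>h stands for Re and Im; for real lam both parts solve the real equation.\<close>
  have *: "neumann (sl_coeff k) (\<lambda>x. h (?v x) / zeta A k x) (\<lambda>x. - lam * (h (?v x) / zeta A k x))"
    if h: "bounded_linear h" "\<And>c z. h (of_real c * z) = c * h z" for h :: "complex \<Rightarrow> real"
  proof (rule sl_neumann)
    note lin = bounded_linear.linear[OF h(1)]
    show "continuous_on {0..} (\<lambda>x. h (?v x))" by (rule bounded_linear.continuous_on[OF h(1) v(1)])
    show "((\<lambda>x. h (?v x)) has_real_derivative h (v' x)) (at x)" if "x > 0" for x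
      using bounded_linear.has_vector_derivative[OF h(1) v(3)[OF that]]
      by (simp add: has_real_derivative_iff_has_vector_derivative)
    show "((\<lambda>x. h (v' x)) has_real_derivative h (v'' x)) (at x)" if "x > 0" for x
      using bounded_linear.has_vector_derivative[OF h(1) v(4)[OF that]]
      by (simp add: has_real_derivative_iff_has_vector_derivative)
    show "- h (v'' x) - deriv A x / A x * h (v' x) + (2 * of_int k * pi)\<^sup>2 / (A x)\<^sup>2 * h (?v x) = lam * h (?v x)"
      if "x > 0" for x using arg_cong[OF v(5)[OF that], of h]
      by (simp only: linear_add[OF lin] linear_diff[OF lin] linear_neg[OF lin] h(2))
    show "((\<lambda>x. A x * h (v' x)) \<longlongrightarrow> 0) (at_right 0)"
      using bounded_linear.tendsto[OF h(1) v(6)] by (simp only: h(2) linear_0[OF lin])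
  qed
  show "neumann (sl_coeff k) (\<lambda>x. Re (v_tilde A v k (of_real lam) x)) (\<lambda>x. - lam * Re (v_tilde A v k (of_real lam) x))"
    using *[OF bounded_linear_Re] by (simp add: v_tilde_def)
  show "neumann (sl_coeff k) (\<lambda>x. Im (v_tilde A v k (of_real lam) x)) (\<lambda>x. - lam * Im (v_tilde A v k (of_real lam) x))"
    using *[OF bounded_linear_Im] by (simp add: v_tilde_def)
qed

end

section \<open>Measurability of the kernel and injectivity of the transform\<close>

context
  fixes A :: "real \<Rightarrow> real"
    and v :: "int \<Rightarrow> complex \<Rightarrow> real \<Rightarrow> complex"
    and \<pi> :: "int \<Rightarrow> real \<Rightarrow> real \<Rightarrow> real measure"
  assumes adm: "admissible A"
    and sol: "\<And>k lam. sl_solution A k lam (v k lam)"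
    and pf: "\<And>k x1 x2. x1 \<ge> 0 \<Longrightarrow> x2 \<ge> 0 \<Longrightarrow> product_formula_measure A v k x1 x2 (\<pi> k x1 x2)"
begin

lemmas v_tilde_facts = v_tilde_neumann[where v=v, OF adm sol]

definition vr :: "int \<Rightarrow> real \<Rightarrow> real \<Rightarrow> real"
  where "vr k lam x = Re (v_tilde A v k (of_real lam) x)"

lemma vr_neumann: "neumann (sl_coeff A k) (vr k lam) (\<lambda>x. - lam * vr k lam x)"
  unfolding vr_def by (rule v_tilde_facts(1))

lemma vr_0: "vr k lam 0 = 1"
  unfolding vr_def v_tilde_facts(3) by simp

text \<open>The imaginary part solves the same problem with value 0 at 0, and the energy bound makes
  it vanish.\<close>

lemma v_tilde_eq_vr:
  assumes "lam \<ge> 0" "x \<ge> 0"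
  shows "v_tilde A v k (of_real lam) x = of_real (vr k lam x)"
proof -
  have "\<bar>Im (v_tilde A v k (of_real lam) x)\<bar> \<le> \<bar>Im (v_tilde A v k (of_real lam) 0)\<bar>"
    by (rule sl_weight.neumann_eigen_bound[OF sl_weight_sl_coeff[OF adm] v_tilde_facts(2) assms])
  then have "Im (v_tilde A v k (of_real lam) x) = 0"
    unfolding v_tilde_facts(3) by simp
  then show ?thesis by (simp add: vr_def complex_eq_iff)
qed

text \<open>The weight is even in k, so the difference solves the same problem with value 0 at 0.
  This reconciles \<open>w v (- k)\<close> in \<open>fourier\<close> with \<open>v_tilde\<close> at
  k, the function in the product formula for \<open>\<pi> k\<close>.\<close>

lemma vr_uminus:
  assumes "lam \<ge> 0" "x \<ge> 0"
  shows "vr (- k) lam x = vr k lam x"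
proof -
  have "sl_coeff A (- k) = sl_coeff A k"
    by (simp add: fun_eq_iff sl_coeff_def[OF adm] zeta_uminus[OF adm])
  then have "neumann (sl_coeff A k) (vr (- k) lam) (\<lambda>x. - lam * vr (- k) lam x)"
    using vr_neumann[of "- k" lam] by simp
  from neumann_diff[OF this vr_neumann[of k lam]]
  have "neumann (sl_coeff A k) (\<lambda>x. vr (- k) lam x - vr k lam x) (\<lambda>x. - lam * (vr (- k) lam x - vr k lam x))"
    by (rule neumann_cong) (auto simp: algebra_simps)
  from sl_weight.neumann_eigen_bound[OF sl_weight_sl_coeff[OF adm] this assms]
  show ?thesis by (simp add: vr_0)
qed

text \<open>The hypothesis on solutions covers lam = -1, and this solution plays the part of
  \<open>phi\<close>.\<close>

lemma sl_spectral_vr: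
  "sl_spectral (sl_coeff A k) (sl_coeff' A k) (\<lambda>x. vr k (-1) (max 0 x)) (vr k)"
proof (intro sl_spectral.intro sl_green.intro sl_weight_sl_coeff[OF adm] sl_green_axioms.intro sl_spectral_axioms.intro)
  show "neumann (sl_coeff A k) (\<lambda>x. vr k (-1) (max 0 x)) (\<lambda>x. vr k (-1) (max 0 x))"
    by (rule neumann_cong[OF vr_neumann[of k "-1"]]) auto
qed (auto simp: vr_0 max_def intro: vr_neumann[simplified])

lemma vr_bound: "lam \<ge> 0 \<Longrightarrow> x \<ge> 0 \<Longrightarrow> \<bar>vr k lam x\<bar> \<le> 1"
  using sl_spectral.v_bound[OF sl_spectral_vr] .

lemma vr_measurable: "vr k lam \<in> borel_measurable half_line"
  unfolding half_line_def
  by (rule borel_measurable_continuous_on_restrict) (use vr_neumann in \<open>auto simp: neumann_def\<close>)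

lemma v_tilde_bounded: "lam \<ge> 0 \<Longrightarrow> bounded_by half_line 1 (\<lambda>x. v_tilde A v k (of_real lam) x)"
proof -
  assume lam: "lam \<ge> 0"
  have "(\<lambda>x. v_tilde A v k (of_real lam) x) \<in> borel_measurable half_line
      \<longleftrightarrow> (\<lambda>x. complex_of_real (vr k lam x)) \<in> borel_measurable half_line"
    by (rule measurable_cong) (simp add: v_tilde_eq_vr lam)
  then show ?thesis
    using vr_measurable lam vr_bound[OF lam] by (simp add: bounded_by_def v_tilde_eq_vr)
qed

text \<open>The bounded functions annihilated by L satisfy the closure conditions of
  \<open>eigenfunctions_generate\<close>. Applied to a difference of functionals, this is
  injectivity of the transform.\<close>

lemma functional_determined:
  assumes L: "measure_functional half_line L"
    and zero: "\<And>lam. lam \<ge> 0 \<Longrightarrow> L (\<lambda>x. v_tilde A v k (of_real lam) x) = 0"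
    and J: "J \<in> sets half_line"
  shows "L (indicator J) = 0"
proof -
  \<comment> \<open>The bound belongs to P since linearity and continuity of L are granted for
    bounded functions only.\<close>
  define P where "P f \<longleftrightarrow> (\<exists>C. bounded_by half_line C (\<lambda>x. of_real (f x))) \<and> L (\<lambda>x. of_real (f x)) = 0"
    for f :: "real \<Rightarrow> real"
  have "P (indicator J)"
  proof (rule sl_spectral.eigenfunctions_generate[OF sl_spectral_vr[of k] _ _ _ _ _ sets_half_line[OF J]])
    fix f g assume f: "P f" and fg: "\<And>x. x \<ge> 0 \<Longrightarrow> f x = g x"
    from f obtain C where C: "bounded_by half_line C (\<lambda>x. of_real (f x))" and 0: "L (\<lambda>x. of_real (f x)) = 0"
      by (auto simp: P_def)
    have eq: "complex_of_real (f x) = of_real (g x)" if "x \<in> space half_line" for x using fg that by simp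
    have "bounded_by half_line C (\<lambda>x. of_real (g x))"
      using bounded_by_lim[of half_line C "\<lambda>_ x. of_real (f x)" "\<lambda>x. of_real (g x)"] C eq by simp
    then show "P g" unfolding P_def using measure_functional_cong[OF L C eq] 0 by auto
  next
    fix lam :: real assume lam: "lam \<ge> 0"
    have eq: "v_tilde A v k (of_real lam) x = of_real (vr k lam x)" if "x \<in> space half_line" for x
      using that lam by (simp add: v_tilde_eq_vr)
    have "bounded_by half_line 1 (\<lambda>x. of_real (vr k lam x))"
      using vr_measurable vr_bound[OF lam] by (simp add: bounded_by_def)
    moreover have "L (\<lambda>x. of_real (vr k lam x)) = 0"
      using measure_functional_cong[OF L v_tilde_bounded[OF lam] eq] zero[OF lam] by simp
    ultimately show "P (vr k lam)" unfolding P_def by blast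
  next
    fix f g assume "P f" "P g"
    then obtain C D where CD: "bounded_by half_line C (\<lambda>x. of_real (f x))" "bounded_by half_line D (\<lambda>x. of_real (g x))"
      and 0: "L (\<lambda>x. of_real (f x)) = 0" "L (\<lambda>x. of_real (g x)) = 0" by (auto simp: P_def)
    show "P (\<lambda>x. f x + g x)"
      unfolding P_def using bounded_by_add[OF CD] measure_functionalD(1)[OF L CD] 0 by auto
  next
    fix c f assume "P f"
    then obtain C where C: "bounded_by half_line C (\<lambda>x. of_real (f x))"
      and 0: "L (\<lambda>x. of_real (f x)) = 0" by (auto simp: P_def)
    show "P (\<lambda>x. c * f x)"
      unfolding P_def using bounded_by_scale[OF C, of "of_real c"] measure_functionalD(2)[OF L C, of "of_real c"] 0 by auto
  next
    fix f :: "nat \<Rightarrow> real \<Rightarrow> real" and g C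
    assume f: "\<And>n. P (f n)" and C: "\<And>n x. 0 \<le> x \<Longrightarrow> \<bar>f n x\<bar> \<le> C"
      and lim: "\<And>x. 0 \<le> x \<Longrightarrow> (\<lambda>n. f n x) \<longlonglongrightarrow> g x"
    have b: "bounded_by half_line C (\<lambda>x. of_real (f n x))" for n
      using f[of n] C by (auto simp: P_def bounded_by_def)
    have l: "(\<lambda>n. complex_of_real (f n x)) \<longlonglongrightarrow> of_real (g x)" if "x \<in> space half_line" for x
      using lim[of x] that by (intro tendsto_of_real) simp
    have "(\<lambda>n. L (\<lambda>x. of_real (f n x))) \<longlonglongrightarrow> L (\<lambda>x. of_real (g x))"
      by (rule measure_functionalD(3)[OF L b l])
    then have "L (\<lambda>x. of_real (g x)) = 0" using f by (simp add: P_def LIMSEQ_const_iff)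
    then show "P g" unfolding P_def using bounded_by_lim[OF b l] by blast
  qed
  moreover have "(\<lambda>x. complex_of_real (indicator J x)) = indicator J" by (simp add: fun_eq_iff of_real_indicator)
  ultimately show ?thesis by (simp add: P_def)
qed

lemma \<pi>_prob: "x1 \<ge> 0 \<Longrightarrow> x2 \<ge> 0 \<Longrightarrow> prob_space (\<pi> k x1 x2)"
  and \<pi>_sets: "x1 \<ge> 0 \<Longrightarrow> x2 \<ge> 0 \<Longrightarrow> sets (\<pi> k x1 x2) = sets half_line"
  and \<pi>_product: "x1 \<ge> 0 \<Longrightarrow> x2 \<ge> 0 \<Longrightarrow>
    (\<integral>y. v_tilde A v k lam y \<partial>\<pi> k x1 x2) = v_tilde A v k lam x1 * v_tilde A v k lam x2"
  using pf[of x1 x2 k] by (auto simp: product_formula_measure_def)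

text \<open>For eigenfunctions the integral against the kernel is a product of a function of x and a
  function of y, hence measurable, and bounded limits carry this over to indicators.\<close>

lemma \<pi>_kernel: "(\<lambda>(y, x). \<pi> k x y) \<in> half_line \<Otimes>\<^sub>M half_line \<rightarrow>\<^sub>M subprob_algebra half_line"
proof (rule measurable_subprob_algebra)
  fix p assume "p \<in> space (half_line \<Otimes>\<^sub>M half_line)"
  then have p: "fst p \<ge> 0" "snd p \<ge> 0" by (auto simp: space_pair_measure)
  show "subprob_space (case p of (y, x) \<Rightarrow> \<pi> k x y)"
    using \<pi>_prob[OF p(2,1)] by (simp add: case_prod_beta prob_space_imp_subprob_space)
  show "sets (case p of (y, x) \<Rightarrow> \<pi> k x y) = sets half_line"
    using \<pi>_sets[OF p(2,1)] by (simp add: case_prod_beta)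
next
  let ?H = "half_line \<Otimes>\<^sub>M half_line" and ?\<pi> = "\<lambda>p. \<pi> k (snd p) (fst p)"
  fix J assume J: "J \<in> sets half_line"
  define P where "P f \<longleftrightarrow> f \<in> borel_measurable half_line \<and> (\<exists>C. \<forall>x\<ge>0. \<bar>f x\<bar> \<le> C) \<and>
      (\<lambda>p. \<integral>z. f z \<partial>?\<pi> p) \<in> borel_measurable ?H"
    for f :: "real \<Rightarrow> real"
  have pos: "fst p \<ge> 0" "snd p \<ge> 0" if "p \<in> space ?H" for p
    using that by (auto simp: space_pair_measure)
  have sp: "space (?\<pi> p) = {0..}" if "p \<in> space ?H" for p
    using sets_eq_imp_space_eq[OF \<pi>_sets[OF pos(2,1)[OF that]]] by simp
  have meas: "f \<in> borel_measurable (?\<pi> p)"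
    if "p \<in> space ?H" "f \<in> borel_measurable half_line" for p and f :: "real \<Rightarrow> real"
    using that(2) by (simp add: measurable_cong_sets[OF \<pi>_sets[OF pos(2,1)[OF that(1)]] refl])
  have int: "integrable (?\<pi> p) f"
    if p: "p \<in> space ?H" and f: "f \<in> borel_measurable half_line"
      and C: "\<forall>x\<ge>0. \<bar>f x\<bar> \<le> C" for p C and f :: "real \<Rightarrow> real"
  proof -
    interpret prob_space "?\<pi> p" by (rule \<pi>_prob[OF pos(2,1)[OF p]])
    show ?thesis
      by (rule integrable_const_bound[of _ C, OF _ meas[OF p f]]) (use C sp[OF p] in auto)
  qed
  have "P (indicator J)"
  proof (rule sl_spectral.eigenfunctions_generate[OF sl_spectral_vr[of k] _ _ _ _ _ sets_half_line[OF J]])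
    fix f g assume f: "P f" and fg: "\<And>x. x \<ge> 0 \<Longrightarrow> f x = g x"
    have "(f \<in> borel_measurable half_line) = (g \<in> borel_measurable half_line)"
      by (rule measurable_cong) (use fg in auto)
    moreover have "(\<lambda>p. \<integral>z. f z \<partial>?\<pi> p) \<in> borel_measurable ?H
        \<longleftrightarrow> (\<lambda>p. \<integral>z. g z \<partial>?\<pi> p) \<in> borel_measurable ?H"
      by (intro measurable_cong Bochner_Integration.integral_cong refl) (use fg sp in auto)
    moreover have "\<exists>C. \<forall>x\<ge>0. \<bar>g x\<bar> \<le> C" using f fg by (auto simp: P_def)
    ultimately show "P g" using f by (simp add: P_def)
  next
    fix lam :: real assume lam: "lam \<ge> 0"
    have "(\<integral>z. vr k lam z \<partial>?\<pi> p) = vr k lam (snd p) * vr k lam (fst p)"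
      if p: "p \<in> space ?H" for p
    proof -
      have "complex_of_real (\<integral>z. vr k lam z \<partial>?\<pi> p)
          = (\<integral>z. of_real (vr k lam z) \<partial>?\<pi> p)"
        by (rule integral_complex_of_real[symmetric])
      also have "\<dots> = (\<integral>z. v_tilde A v k (of_real lam) z \<partial>?\<pi> p)"
        by (rule Bochner_Integration.integral_cong) (use sp[OF p] lam in \<open>auto simp: v_tilde_eq_vr\<close>)
      also have "\<dots> = of_real (vr k lam (snd p) * vr k lam (fst p))"
        using pos[OF p] lam by (simp add: \<pi>_product v_tilde_eq_vr)
      finally show ?thesis by (simp only: of_real_eq_iff)
    qed
    then have "(\<lambda>p. \<integral>z. vr k lam z \<partial>?\<pi> p) \<in> borel_measurable ?H
      \<longleftrightarrow> (\<lambda>p. vr k lam (snd p) * vr k lam (fst p)) \<in> borel_measurable ?H"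
      by (intro measurable_cong) auto
    moreover have "(\<lambda>p. vr k lam (snd p) * vr k lam (fst p)) \<in> borel_measurable ?H"
      by (intro borel_measurable_times measurable_compose[OF _ vr_measurable] measurable_fst measurable_snd)
    ultimately show "P (vr k lam)"
      using vr_measurable vr_bound[OF lam] unfolding P_def by blast
  next
    fix f g assume f: "P f" and g: "P g"
    from f g obtain C D where CD: "\<forall>x\<ge>0. \<bar>f x\<bar> \<le> C" "\<forall>x\<ge>0. \<bar>g x\<bar> \<le> D" by (auto simp: P_def)
    have "(\<lambda>p. \<integral>z. f z + g z \<partial>?\<pi> p) \<in> borel_measurable ?H
      \<longleftrightarrow> (\<lambda>p. (\<integral>z. f z \<partial>?\<pi> p) + (\<integral>z. g z \<partial>?\<pi> p)) \<in> borel_measurable ?H"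
      by (intro measurable_cong Bochner_Integration.integral_add int)
         (use f g CD in \<open>auto simp: P_def\<close>)
    moreover have "\<forall>x\<ge>0. \<bar>f x + g x\<bar> \<le> C + D" using CD by (auto intro: order.trans[OF abs_triangle_ineq add_mono])
    ultimately show "P (\<lambda>x. f x + g x)" using f g by (auto simp: P_def)
  next
    fix c f assume f: "P f"
    then obtain C where "\<forall>x\<ge>0. \<bar>f x\<bar> \<le> C" by (auto simp: P_def)
    then have "\<forall>x\<ge>0. \<bar>c * f x\<bar> \<le> \<bar>c\<bar> * C" by (auto simp: abs_mult intro: mult_left_mono)
    then show "P (\<lambda>x. c * f x)" using f by (auto simp: P_def)
  next
    fix f :: "nat \<Rightarrow> real \<Rightarrow> real" and g C
    assume f: "\<And>n. P (f n)" and C: "\<And>n x. 0 \<le> x \<Longrightarrow> \<bar>f n x\<bar> \<le> C"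
      and lim: "\<And>x. 0 \<le> x \<Longrightarrow> (\<lambda>n. f n x) \<longlonglongrightarrow> g x"
    have fm: "f n \<in> borel_measurable half_line" for n using f by (simp add: P_def)
    have gm: "g \<in> borel_measurable half_line"
      by (rule borel_measurable_LIMSEQ_real[OF _ fm]) (use lim in auto)
    have "\<bar>g x\<bar> \<le> C" if "x \<ge> 0" for x
      by (rule LIMSEQ_le_const2[OF tendsto_rabs[OF lim[OF that]]]) (use C that in auto)
    moreover have "(\<lambda>p. \<integral>z. g z \<partial>?\<pi> p) \<in> borel_measurable ?H"
    proof (rule borel_measurable_LIMSEQ_real)
      show "(\<lambda>p. \<integral>z. f n z \<partial>?\<pi> p) \<in> borel_measurable ?H" for n
        using f by (simp add: P_def)
      fix p assume p: "p \<in> space ?H"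
      interpret prob_space "?\<pi> p" by (rule \<pi>_prob[OF pos(2,1)[OF p]])
      show "(\<lambda>n. \<integral>z. f n z \<partial>?\<pi> p) \<longlonglongrightarrow> (\<integral>z. g z \<partial>?\<pi> p)"
        by (rule integral_dominated_convergence[where w="\<lambda>_. C"])
           (use meas[OF p gm] meas[OF p fm] C lim sp[OF p] in auto)
    qed
    ultimately show "P g" using gm by (auto simp: P_def)
  qed
  then have m: "(\<lambda>p. \<integral>z. (indicator J z :: real) \<partial>?\<pi> p) \<in> borel_measurable ?H"
    unfolding P_def by (elim conjE)
  have em: "emeasure (case p of (y, x) \<Rightarrow> \<pi> k x y) J = ennreal (\<integral>z. indicator J z \<partial>?\<pi> p)"
    if p: "p \<in> space ?H" for p
  proof -
    interpret prob_space "?\<pi> p" by (rule \<pi>_prob[OF pos(2,1)[OF p]])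
    have "J \<inter> space (?\<pi> p) = J"
      using sets.sets_into_space[OF J] sp[OF p] by auto
    then show ?thesis by (simp add: case_prod_beta emeasure_eq_measure)
  qed
  show "(\<lambda>p. emeasure (case p of (y, x) \<Rightarrow> \<pi> k x y) J) \<in> borel_measurable ?H"
    by (subst measurable_cong[OF em]) (assumption, rule measurable_compose[OF m measurable_ennreal])
qed

text \<open>Lifts f from the half-line so that integrating the lift against tau is integrating f
  against \<open>hat k \<tau>\<close> (\<open>hat_integral\<close>); the lift of
  \<open>v_tilde\<close> is the integrand of \<open>fourier\<close>.\<close>

definition twist :: "int \<Rightarrow> (real \<Rightarrow> complex) \<Rightarrow> real \<times> torus \<Rightarrow> complex"
  where "twist k f \<xi> = torus_char (- k) (snd \<xi>) * f (fst \<xi>)"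

lemma twist_bounded: "bounded_by half_line C f \<Longrightarrow> bounded_by cylinder C (twist k f)"
proof -
  assume f: "bounded_by half_line C f"
  have "f \<in> borel_measurable half_line" using f by (simp add: bounded_by_def)
  from measurable_compose[OF fst_cylinder this] measurable_compose[OF snd_cylinder torus_char_measurable]
  have "(\<lambda>\<xi>. torus_char (- k) (snd \<xi>) * f (fst \<xi>)) \<in> borel_measurable cylinder"
    by (intro borel_measurable_times)
  then show ?thesis
    using f by (auto simp: bounded_by_def twist_def[abs_def] norm_mult norm_torus_char)
qed

lemma twist_functional:
  assumes "\<tau> \<in> complex_measures cylinder"
  shows "measure_functional half_line (\<lambda>f. complex_integral cylinder \<tau> (twist k f))"
  unfolding measure_functional_def
proof (intro conjI allI impI)
  note D = measure_functionalD[OF measure_functional_complex_integral[OF assms]]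
  let ?L = "\<lambda>f. complex_integral cylinder \<tau> (twist k f)"
  show "?L (\<lambda>x. f x + g x) = ?L f + ?L g" if "bounded_by half_line C f" "bounded_by half_line D g" for f g C D
    using D(1)[OF twist_bounded[OF that(1), of k] twist_bounded[OF that(2), of k]]
    by (simp add: twist_def[abs_def] distrib_left)
  show "?L (\<lambda>x. c * f x) = c * ?L f" if "bounded_by half_line C f" for f C c
    using D(2)[OF twist_bounded[OF that, of k], of c] by (simp add: twist_def[abs_def] mult_ac)
  show "(\<lambda>n. ?L (f n)) \<longlonglongrightarrow> ?L g"
    if "\<forall>n. bounded_by half_line C (f n)" "\<forall>x\<in>space half_line. (\<lambda>n. f n x) \<longlonglongrightarrow> g x" for f g C
    by (rule D(3)[OF twist_bounded]) (use that in \<open>auto simp: twist_def intro!: tendsto_mult_left\<close>)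
qed

lemma hat_eq: "hat k \<tau> J = complex_integral cylinder \<tau> (twist k (indicator J))"
  by (simp add: hat_def twist_def[abs_def] case_prod_unfold)

lemma hat_complex_measure: "\<tau> \<in> complex_measures cylinder \<Longrightarrow> hat k \<tau> \<in> complex_measures half_line"
  and hat_integral: "\<tau> \<in> complex_measures cylinder \<Longrightarrow> bounded_by half_line C f \<Longrightarrow>
    complex_integral half_line (hat k \<tau>) f = complex_integral cylinder \<tau> (twist k f)"
  using complex_measure_of_functional[OF twist_functional hat_eq] by blast+

lemma fourier_eq:
  assumes "\<tau> \<in> complex_measures cylinder" "lam \<ge> 0"
  shows "fourier A v \<tau> k lam = complex_integral cylinder \<tau> (twist k (\<lambda>x. v_tilde A v k (of_real lam) x))"
  unfolding fourier_def
proof (rule measure_functional_cong[OF measure_functional_complex_integral[OF assms(1)]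
      twist_bounded[OF v_tilde_bounded[OF assms(2)]], symmetric])
  fix \<xi> :: "real \<times> torus" assume "\<xi> \<in> space cylinder"
  then have x: "fst \<xi> \<ge> 0" by auto
  have "v (- k) (of_real lam) (fst \<xi>) / of_real (zeta A k (fst \<xi>)) = v_tilde A v (- k) (of_real lam) (fst \<xi>)"
    by (simp add: v_tilde_def zeta_uminus[OF adm])
  also have "\<dots> = v_tilde A v k (of_real lam) (fst \<xi>)"
    by (simp add: v_tilde_eq_vr assms(2) x vr_uminus)
  finally have e: "v (- k) (of_real lam) (fst \<xi>) / of_real (zeta A k (fst \<xi>)) = v_tilde A v k (of_real lam) (fst \<xi>)" .
  show "twist k (\<lambda>x. v_tilde A v k (of_real lam) x) \<xi> = w v (- k) (of_real lam) \<xi> / of_real (zeta A k (fst \<xi>))"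
    unfolding twist_def e[symmetric] by (simp add: w_def case_prod_unfold)
qed

lemma product_kernel_measurable:
  "(\<lambda>(\<xi>2, \<xi>1). product_kernel \<pi> k \<xi>1 \<xi>2) \<in> cylinder \<Otimes>\<^sub>M cylinder \<rightarrow>\<^sub>M subprob_algebra cylinder"
proof -
  have f: "(\<lambda>p. (fst (fst p), fst (snd p))) \<in> cylinder \<Otimes>\<^sub>M cylinder \<rightarrow>\<^sub>M half_line \<Otimes>\<^sub>M half_line"
    by (intro measurable_Pair measurable_compose[OF _ fst_cylinder] measurable_fst measurable_snd)
  have s: "(\<lambda>p. (snd (snd p), snd (fst p))) \<in> cylinder \<Otimes>\<^sub>M cylinder \<rightarrow>\<^sub>M borel \<Otimes>\<^sub>M (borel :: torus measure)"
    by (intro measurable_Pair measurable_compose[OF _ snd_cylinder] measurable_fst measurable_snd)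
  have 1: "(\<lambda>p. \<pi> k (fst (snd p)) (fst (fst p))) \<in> cylinder \<Otimes>\<^sub>M cylinder \<rightarrow>\<^sub>M subprob_algebra half_line"
    using measurable_compose[OF f \<pi>_kernel[of k]] by simp
  have 2: "(\<lambda>p. return borel (snd (snd p) + snd (fst p))) \<in> cylinder \<Otimes>\<^sub>M cylinder \<rightarrow>\<^sub>M subprob_algebra (borel :: torus measure)"
    using measurable_compose[OF measurable_compose[OF s torus_add_measurable] return_measurable] by simp
  from measurable_pair_measure[OF 1 2] show ?thesis
    by (simp add: product_kernel_def case_prod_beta subprob_algebra_cong[OF sets_cylinder])
qed

text \<open>The second factor is a point mass at the sum of the angles, where the character is
  multiplicative.\<close>

lemma product_kernel_twist:
  assumes "fst \<xi>1 \<ge> 0" "fst \<xi>2 \<ge> 0" and f: "bounded_by half_line C f"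
  shows "(\<integral>\<xi>. twist k f \<xi> \<partial>product_kernel \<pi> k \<xi>1 \<xi>2)
    = torus_char (- k) (snd \<xi>1) * torus_char (- k) (snd \<xi>2) * (\<integral>x. f x \<partial>\<pi> k (fst \<xi>1) (fst \<xi>2))"
proof -
  let ?p = "\<pi> k (fst \<xi>1) (fst \<xi>2)" and ?r = "return borel (snd \<xi>1 + snd \<xi>2)"
  interpret p: prob_space ?p by (rule \<pi>_prob[OF assms(1,2)])
  interpret r: prob_space ?r by (rule prob_space_return) simp
  interpret pr: pair_prob_space ?p ?r ..
  have sets: "sets (?p \<Otimes>\<^sub>M ?r) = sets cylinder"
    unfolding sets_cylinder by (rule sets_pair_measure_cong) (simp_all add: \<pi>_sets assms(1,2))
  have b: "bounded_by cylinder C (twist k f)" by (rule twist_bounded[OF f])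
  then have m: "twist k f \<in> borel_measurable (?p \<Otimes>\<^sub>M ?r)"
    by (simp add: bounded_by_def measurable_cong_sets[OF sets refl])
  have i: "integrable (?p \<Otimes>\<^sub>M ?r) (twist k f)"
    by (rule pr.P.integrable_const_bound[of _ C, OF _ m])
       (use b sets_eq_imp_space_eq[OF sets] in \<open>auto simp: bounded_by_def\<close>)
  have "(\<integral>\<xi>. twist k f \<xi> \<partial>product_kernel \<pi> k \<xi>1 \<xi>2) = (\<integral>\<xi>. twist k f \<xi> \<partial>(?p \<Otimes>\<^sub>M ?r))"
    by (simp add: product_kernel_def case_prod_beta)
  also have "\<dots> = (\<integral>x. \<integral>\<theta>. twist k f (x, \<theta>) \<partial>?r \<partial>?p)"
    using pr.integral_fst'[OF i] by simp
  also have "\<dots> = (\<integral>x. twist k f (x, snd \<xi>1 + snd \<xi>2) \<partial>?p)"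
  proof (intro Bochner_Integration.integral_cong refl integral_return)
    fix x assume "x \<in> space ?p"
    have "(\<lambda>\<theta>. torus_char (- k) \<theta> * f x) \<in> borel_measurable borel" by measurable
    then show "(\<lambda>\<theta>. twist k f (x, \<theta>)) \<in> borel_measurable borel" by (simp add: twist_def)
  qed simp
  also have "\<dots> = (\<integral>x. torus_char (- k) (snd \<xi>1) * torus_char (- k) (snd \<xi>2) * f x \<partial>?p)"
    by (simp add: twist_def torus_char_add)
  also have "\<dots> = torus_char (- k) (snd \<xi>1) * torus_char (- k) (snd \<xi>2) * (\<integral>x. f x \<partial>?p)"
    by (rule integral_mult_right_zero)
  finally show ?thesis .
qed

section \<open>The transform of a convolution\<close>

context
  fixes \<mu> \<nu> :: "(real \<times> torus) set \<Rightarrow> complex"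
  assumes \<mu>: "\<mu> \<in> complex_measures cylinder" and \<nu>: "\<nu> \<in> complex_measures cylinder"
begin

text \<open>The integrand \<open>?h\<close> of the transform is multiplicative for the kernel, by
  the product formula and \<open>torus_char_add\<close>; so the inner integral is a constant times
  \<open>?h\<close>, and the iterated one factors.\<close>

lemma fourier_delta_convolution:
  assumes lam: "lam \<ge> 0"
  shows "fourier A v (delta_convolution \<pi> k \<mu> \<nu>) k lam = fourier A v \<mu> k lam * fourier A v \<nu> k lam"
proof -
  let ?h = "twist k (\<lambda>x. v_tilde A v k (of_real lam) x)"
  define L where "L = (\<lambda>f. complex_integral cylinder \<nu> (\<lambda>\<xi>2. complex_integral cylinder \<mu>
      (\<lambda>\<xi>1. \<integral>\<xi>. f \<xi> \<partial>product_kernel \<pi> k \<xi>1 \<xi>2)))"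
  note conv = convolution_functional[OF \<mu> \<nu> product_kernel_measurable[of k], folded L_def]
  have b: "bounded_by cylinder 1 ?h" by (rule twist_bounded[OF v_tilde_bounded[OF lam]])
  have eq: "delta_convolution \<pi> k \<mu> \<nu> E = L (indicator E)" if "E \<in> sets cylinder" for E
    using conv(2)[OF that] by (simp add: delta_convolution_def L_def)
  \<comment> \<open>From here on \<open>delta_convolution\<close> is a complex measure, and its
    transform is the value of L at \<open>?h\<close>.\<close>
  note cm = complex_measure_of_functional[OF conv(1) eq]
  have "fourier A v (delta_convolution \<pi> k \<mu> \<nu>) k lam = complex_integral cylinder (delta_convolution \<pi> k \<mu> \<nu>) ?h"
    by (rule fourier_eq[OF cm(1) lam])
  also have "\<dots> = L ?h" by (rule cm(2)[OF _ b])
  finally have F: "fourier A v (delta_convolution \<pi> k \<mu> \<nu>) k lam = L ?h" .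
  note M = measure_functional_complex_integral[OF \<mu>] and N = measure_functional_complex_integral[OF \<nu>]
  have k: "(\<integral>\<xi>. ?h \<xi> \<partial>product_kernel \<pi> k \<xi>1 \<xi>2) = ?h \<xi>2 * ?h \<xi>1"
    if "\<xi>1 \<in> space cylinder" "\<xi>2 \<in> space cylinder" for \<xi>1 \<xi>2
    using that by (subst product_kernel_twist[OF _ _ v_tilde_bounded[OF lam]])
      (auto simp: \<pi>_product twist_def)
  have "complex_integral cylinder \<mu> (\<lambda>\<xi>1. \<integral>\<xi>. ?h \<xi> \<partial>product_kernel \<pi> k \<xi>1 \<xi>2)
      = fourier A v \<mu> k lam * ?h \<xi>2" if "\<xi>2 \<in> space cylinder" for \<xi>2
  proof -
    have "complex_integral cylinder \<mu> (\<lambda>\<xi>1. ?h \<xi>2 * ?h \<xi>1)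
        = complex_integral cylinder \<mu> (\<lambda>\<xi>1. \<integral>\<xi>. ?h \<xi> \<partial>product_kernel \<pi> k \<xi>1 \<xi>2)"
      by (rule measure_functional_cong[OF M bounded_by_scale[OF b]]) (simp only: k that)
    then show ?thesis
      using measure_functionalD(2)[OF M b, of "?h \<xi>2"] by (simp add: fourier_eq[OF \<mu> lam] mult.commute)
  qed
  then have "L ?h = complex_integral cylinder \<nu> (\<lambda>\<xi>2. fourier A v \<mu> k lam * ?h \<xi>2)"
    unfolding L_def by (intro measure_functional_cong[OF N bounded_by_scale[OF b], symmetric]) simp
  also have "\<dots> = fourier A v \<mu> k lam * fourier A v \<nu> k lam"
    using measure_functionalD(2)[OF N b] by (simp add: fourier_eq[OF \<nu> lam])
  finally show ?thesis unfolding F .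
qed

text \<open>Here \<open>diamond\<close> appears through its functional, whose values on
  eigenfunctions are computed as on the cylinder; \<open>hat_integral\<close> translates the factors
  into Fourier transforms.\<close>

lemma diamond_functional:
  obtains L where "measure_functional half_line L"
    "\<And>J. J \<in> sets half_line \<Longrightarrow> diamond \<pi> k (hat k \<mu>) (hat k \<nu>) J = L (indicator J)"
    "\<And>lam. lam \<ge> 0 \<Longrightarrow> L (\<lambda>x. v_tilde A v k (of_real lam) x) = fourier A v \<mu> k lam * fourier A v \<nu> k lam"
proof -
  note M = hat_complex_measure[OF \<mu>, of k] and N = hat_complex_measure[OF \<nu>, of k]
  define L where "L = (\<lambda>f. complex_integral half_line (hat k \<nu>) (\<lambda>x2. complex_integral half_line (hat k \<mu>)
      (\<lambda>x1. \<integral>x. f x \<partial>\<pi> k x1 x2)))"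
  note conv = convolution_functional[OF M N \<pi>_kernel[of k], folded L_def]
  show ?thesis
  proof (rule that[OF conv(1)])
    show "diamond \<pi> k (hat k \<mu>) (hat k \<nu>) J = L (indicator J)" if "J \<in> sets half_line" for J
      using conv(2)[OF that] by (simp add: diamond_def L_def)
    fix lam :: real assume lam: "lam \<ge> 0"
    let ?h = "\<lambda>x. v_tilde A v k (of_real lam) x"
    note b = v_tilde_bounded[OF lam, of k]
    note M' = measure_functional_complex_integral[OF M] and N' = measure_functional_complex_integral[OF N]
    have fm: "complex_integral half_line (hat k \<mu>) ?h = fourier A v \<mu> k lam"
      unfolding hat_integral[OF \<mu> b] fourier_eq[OF \<mu> lam] ..
    have fn: "complex_integral half_line (hat k \<nu>) ?h = fourier A v \<nu> k lam"
      unfolding hat_integral[OF \<nu> b] fourier_eq[OF \<nu> lam] ..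
    have "complex_integral half_line (hat k \<mu>) (\<lambda>x1. \<integral>x. ?h x \<partial>\<pi> k x1 x2) = fourier A v \<mu> k lam * ?h x2"
      if "x2 \<in> space half_line" for x2
    proof -
      have "complex_integral half_line (hat k \<mu>) (\<lambda>x1. ?h x2 * ?h x1)
          = complex_integral half_line (hat k \<mu>) (\<lambda>x1. \<integral>x. ?h x \<partial>\<pi> k x1 x2)"
        by (rule measure_functional_cong[OF M' bounded_by_scale[OF b]]) (use that in \<open>simp add: \<pi>_product\<close>)
      then show ?thesis
        using measure_functionalD(2)[OF M' b, of "?h x2"] by (simp add: fm mult.commute)
    qed
    then have "L ?h = complex_integral half_line (hat k \<nu>) (\<lambda>x2. fourier A v \<mu> k lam * ?h x2)"
      unfolding L_def by (intro measure_functional_cong[OF N' bounded_by_scale[OF b], symmetric]) simp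
    then show "L ?h = fourier A v \<mu> k lam * fourier A v \<nu> k lam"
      using measure_functionalD(2)[OF N' b] by (simp add: fn)
  qed
qed

text \<open>Two functionals on the half-line are compared, one from \<open>\<alpha>\<close> and one
  from \<open>diamond\<close>: agreement on eigenfunctions gives agreement on indicators by
  \<open>functional_determined\<close>, and the converse is
  \<open>measure_functional_eqI\<close>.\<close>

lemma fourier_eq_iff_hat_eq:
  assumes \<alpha>: "\<alpha> \<in> complex_measures cylinder"
  shows "(\<forall>lam\<ge>0. fourier A v \<alpha> k lam = fourier A v \<mu> k lam * fourier A v \<nu> k lam)
    \<longleftrightarrow> (\<forall>J\<in>sets half_line. hat k \<alpha> J = diamond \<pi> k (hat k \<mu>) (hat k \<nu>) J)"
proof (rule diamond_functional[of k])
  fix L assume L: "measure_functional half_line L"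
    "\<And>J. J \<in> sets half_line \<Longrightarrow> diamond \<pi> k (hat k \<mu>) (hat k \<nu>) J = L (indicator J)"
    "\<And>lam. lam \<ge> 0 \<Longrightarrow> L (\<lambda>x. v_tilde A v k (of_real lam) x) = fourier A v \<mu> k lam * fourier A v \<nu> k lam"
  define L' where "L' = (\<lambda>f. complex_integral cylinder \<alpha> (twist k f))"
  have L': "measure_functional half_line L'" unfolding L'_def by (rule twist_functional[OF \<alpha>])
  have F: "fourier A v \<alpha> k lam = L' (\<lambda>x. v_tilde A v k (of_real lam) x)" if "lam \<ge> 0" for lam
    unfolding L'_def by (rule fourier_eq[OF \<alpha> that])
  have H: "hat k \<alpha> J = L' (indicator J)" for J unfolding L'_def by (rule hat_eq)
  show ?thesis
  proof (intro iffI ballI allI impI)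
    fix J assume *: "\<forall>lam\<ge>0. fourier A v \<alpha> k lam = fourier A v \<mu> k lam * fourier A v \<nu> k lam"
      and J: "J \<in> sets half_line"
    have "(\<lambda>f. L' f + (-1) * L f) (indicator J) = 0"
    proof (rule functional_determined[OF _ _ J])
      show "measure_functional half_line (\<lambda>f. L' f + (-1) * L f)"
        by (intro measure_functional_add measure_functional_scale L' L)
      show "L' (\<lambda>x. v_tilde A v k (of_real lam) x) + (-1) * L (\<lambda>x. v_tilde A v k (of_real lam) x) = 0"
        if "lam \<ge> 0" for lam using * F[OF that] L(3)[OF that] that by simp
    qed
    then show "hat k \<alpha> J = diamond \<pi> k (hat k \<mu>) (hat k \<nu>) J" by (simp add: H L(2)[OF J])
  next
    fix lam :: real assume *: "\<forall>J\<in>sets half_line. hat k \<alpha> J = diamond \<pi> k (hat k \<mu>) (hat k \<nu>) J" and lam: "lam \<ge> 0"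
    have "L' (\<lambda>x. v_tilde A v k (of_real lam) x) = L (\<lambda>x. v_tilde A v k (of_real lam) x)"
      by (rule measure_functional_eqI[OF L' L(1) _ v_tilde_bounded[OF lam]]) (use * H L(2) in auto)
    then show "fourier A v \<alpha> k lam = fourier A v \<mu> k lam * fourier A v \<nu> k lam"
      using F[OF lam] L(3)[OF lam] by simp
  qed
qed

end

end

theorem proposition3p5:
  fixes A :: "real \<Rightarrow> real"
    and v :: "int \<Rightarrow> complex \<Rightarrow> real \<Rightarrow> complex"
    and \<pi> :: "int \<Rightarrow> real \<Rightarrow> real \<Rightarrow> real measure"
    and \<mu> \<nu> :: "(real \<times> torus) set \<Rightarrow> complex"
  assumes "admissible A"
    and "\<And>k lam. sl_solution A k lam (v k lam)"
    and "\<And>k x1 x2. x1 \<ge> 0 \<Longrightarrow> x2 \<ge> 0 \<Longrightarrow> product_formula_measure A v k x1 x2 (\<pi> k x1 x2)"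
    and "\<mu> \<in> complex_measures cylinder"
    and "\<nu> \<in> complex_measures cylinder"
  shows "(\<forall>k. \<forall>lam\<ge>0. fourier A v (delta_convolution \<pi> k \<mu> \<nu>) k lam
                       = fourier A v \<mu> k lam * fourier A v \<nu> k lam) \<and>
         (\<forall>k. \<forall>\<alpha>\<in>complex_measures cylinder.
            (\<forall>lam\<ge>0. fourier A v \<alpha> k lam = fourier A v \<mu> k lam * fourier A v \<nu> k lam)
            \<longleftrightarrow> (\<forall>J\<in>sets half_line. hat k \<alpha> J = diamond \<pi> k (hat k \<mu>) (hat k \<nu>) J))"
  using fourier_delta_convolution[OF assms] fourier_eq_iff_hat_eq[OF assms] by blast

end
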